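(* Let $n\ge 1$ be an integer, let $(a,b)\subset\mathbb{R}$ be an open interval and let $f:(a,b)\to\mathbb{R}$. Then $f$ is $n$-convex if and only if for every real polynomial $q\in\mathbb{R}_{n-1}[x]$ and all pairwise distinct $x_0,x_1,\ldots,x_{2n}\in(a,b)$ one has $$[x_0,x_1,\ldots,x_{2n-1},x_{2n}]_{f q^2}\ge 0.$$
   Context: Matrices are ordered by the Loewner order: $A\le B$ iff $B-A$ is positive semidefinite. $f:(a,b)\to\mathbb{R}$ is $n$-convex if for all $t\in[0,1]$ and all $n\times n$ (complex) Hermitian matrices $A,B$ with all eigenvalues in $(a,b)$ one has $f(tA+(1-t)B)\le tf(A)+(1-t)f(B)$, where $f(A)$ is defined by the functional calculus. $\mathbb{R}_{m}[x]$ denotes the real polynomials of degree at most $m$. For pairwise distinct points $\lambda_0,\ldots,\lambda_m$ the divided difference of a function $g$ is $[\lambda_0,\ldots,\lambda_m]_g=\sum_{i=0}^{m}\frac{g(\lambda_i)}{\prod_{j\ne i}(\lambda_i-\lambda_j)}$. $fq^2$ is the pointwise product $x\mapsto f(x)q(x)^2$. *)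

theory Defs
  imports
    "HOL-Analysis.Interval_Integral"
    "HOL-Computational_Algebra.Polynomial"
    "Jordan_Normal_Form.Schur_Decomposition"
begin

definition hermitian_mats :: "nat \<Rightarrow> complex mat set" where
  "hermitian_mats n = {A \<in> carrier_mat n n. mat_adjoint A = A}"

definition unitary_mats :: "nat \<Rightarrow> complex mat set" where
  "unitary_mats n = {U \<in> carrier_mat n n. U * mat_adjoint U = 1\<^sub>m n \<and> mat_adjoint U * U = 1\<^sub>m n}"

text \<open>The order on \<^typ>\<open>complex\<close> used here is the one of \<^theory>\<open>HOL-Library.Complex_Order\<close>:
  \<open>0 \<le> z\<close> means that \<open>z\<close> is real and nonnegative.\<close>

definition psd_mat :: "nat \<Rightarrow> complex mat \<Rightarrow> bool" where
  "psd_mat n A \<longleftrightarrow> A \<in> hermitian_mats n \<and> (\<forall>v \<in> carrier_vec n. 0 \<le> (A *\<^sub>v v) \<bullet>c v)"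

definition loewner_le :: "nat \<Rightarrow> complex mat \<Rightarrow> complex mat \<Rightarrow> bool" where
  "loewner_le n A B \<longleftrightarrow> psd_mat n (B - A)"

definition real_diag :: "nat \<Rightarrow> (nat \<Rightarrow> real) \<Rightarrow> complex mat" where
  "real_diag n d = mat_diag n (\<lambda>i. complex_of_real (d i))"

text \<open>The functional calculus: \<open>f(A) = U diag(f(d\<^sub>0), \<dots>) U\<^sup>*\<close> for any unitary diagonalization
  \<open>A = U diag(d\<^sub>0, \<dots>) U\<^sup>*\<close>. Every Hermitian matrix has one by the spectral theorem; that the result
  does not depend on the choice is lemma \<open>mat_fun_eq\<close> below. Only the values of \<open>f\<close> at the
  eigenvalues \<open>d\<^sub>i\<close> of \<open>A\<close> matter.\<close>

definition mat_fun :: "nat \<Rightarrow> (real \<Rightarrow> real) \<Rightarrow> complex mat \<Rightarrow> complex mat" where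
  "mat_fun n f A = (THE B. \<exists>U \<in> unitary_mats n. \<exists>d.
     A = U * real_diag n d * mat_adjoint U \<and>
     B = U * real_diag n (\<lambda>i. f (d i)) * mat_adjoint U)"

definition n_convex :: "nat \<Rightarrow> real set \<Rightarrow> (real \<Rightarrow> real) \<Rightarrow> bool" where
  "n_convex n I f \<longleftrightarrow>
     (\<forall>t \<in> {0..1}. \<forall>A \<in> hermitian_mats n. \<forall>B \<in> hermitian_mats n.
        (\<forall>z. eigenvalue A z \<longrightarrow> z \<in> complex_of_real ` I) \<longrightarrow>
        (\<forall>z. eigenvalue B z \<longrightarrow> z \<in> complex_of_real ` I) \<longrightarrow>
        loewner_le n
          (mat_fun n f (complex_of_real t \<cdot>\<^sub>m A + complex_of_real (1 - t) \<cdot>\<^sub>m B))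
          (complex_of_real t \<cdot>\<^sub>m mat_fun n f A + complex_of_real (1 - t) \<cdot>\<^sub>m mat_fun n f B))"

definition divided_difference :: "nat \<Rightarrow> (nat \<Rightarrow> real) \<Rightarrow> (real \<Rightarrow> real) \<Rightarrow> real" where
  "divided_difference m x g = (\<Sum>i\<le>m. g (x i) / (\<Prod>j \<in> {..m} - {i}. x i - x j))"

lemma mat_adjoint_carrier [simp]:
  "A \<in> carrier_mat n m \<Longrightarrow> mat_adjoint A \<in> carrier_mat m n"
  unfolding mat_adjoint_def by auto

lemma real_diag_carrier [simp]: "real_diag n d \<in> carrier_mat n n"
  by (simp add: real_diag_def mat_diag_def)

lemma mat_fun_eq:
  assumes U: "U \<in> unitary_mats n"
  shows "mat_fun n f (U * real_diag n d * mat_adjoint U)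
           = U * real_diag n (\<lambda>i. f (d i)) * mat_adjoint U"
proof -
  have unique: "V * real_diag n (\<lambda>i. f (e i)) * mat_adjoint V
                 = U * real_diag n (\<lambda>i. f (d i)) * mat_adjoint U"
    if V: "V \<in> unitary_mats n"
      and eq: "U * real_diag n d * mat_adjoint U = V * real_diag n e * mat_adjoint V" for V e
  proof -
    define W where "W = mat_adjoint V * U"
    have cU: "U \<in> carrier_mat n n" "mat_adjoint U \<in> carrier_mat n n"
      and cV: "V \<in> carrier_mat n n" "mat_adjoint V \<in> carrier_mat n n"
      using U V by (auto simp: unitary_mats_def)
    have cW: "W \<in> carrier_mat n n" unfolding W_def by (rule mult_carrier_mat[OF cV(2) cU(1)])
    have UU: "mat_adjoint U * U = 1\<^sub>m n" "U * mat_adjoint U = 1\<^sub>m n"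
      and VV: "mat_adjoint V * V = 1\<^sub>m n" "V * mat_adjoint V = 1\<^sub>m n"
      using U V by (auto simp: unitary_mats_def)
    note cs = cU cV cW real_diag_carrier mult_carrier_mat[of _ n n _ n] assoc_mult_mat[of _ n n _ n _ n]
      left_mult_one_mat[of _ n n] right_mult_one_mat[of _ n n]
    have collapse: "mat_adjoint V * (U * D * mat_adjoint U) * U = W * D"
      and collapse': "mat_adjoint V * (V * D * mat_adjoint V) * U = D * W"
      if D: "D \<in> carrier_mat n n" for D
    proof -
      have "mat_adjoint V * (U * D * mat_adjoint U) * U
              = mat_adjoint V * U * D * (mat_adjoint U * U)"
        by (simp add: cs D)
      then show "mat_adjoint V * (U * D * mat_adjoint U) * U = W * D"
        by (simp add: cs D UU W_def)
      have "mat_adjoint V * (V * D * mat_adjoint V) * U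
              = (mat_adjoint V * V) * D * (mat_adjoint V * U)"
        by (simp add: cs D)
      then show "mat_adjoint V * (V * D * mat_adjoint V) * U = D * W"
        by (simp add: cs D VV W_def)
    qed
    have comm: "W * real_diag n d = real_diag n e * W"
      using collapse[of "real_diag n d"] collapse'[of "real_diag n e"] eq by simp
    have entry: "W $$ (i, j) * complex_of_real (d j) = complex_of_real (e i) * W $$ (i, j)"
      if "i < n" "j < n" for i j
    proof -
      have "(W * real_diag n d) $$ (i, j) = (real_diag n e * W) $$ (i, j)"
        using comm by simp
      then show ?thesis
        using that cW by (simp add: real_diag_def mat_diag_mult_left mat_diag_mult_right)
    qed
    have comm': "W * real_diag n (\<lambda>i. f (d i)) = real_diag n (\<lambda>i. f (e i)) * W"
    proof (rule eq_matI)
      fix i j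
      assume "i < dim_row (real_diag n (\<lambda>i. f (e i)) * W)"
        and "j < dim_col (real_diag n (\<lambda>i. f (e i)) * W)"
      then have ij: "i < n" "j < n" using cW by (auto simp: real_diag_def mat_diag_def)
      have "W $$ (i, j) * complex_of_real (f (d j)) = complex_of_real (f (e i)) * W $$ (i, j)"
        using entry[OF ij] by (cases "W $$ (i, j) = 0") (auto simp: mult.commute)
      then show "(W * real_diag n (\<lambda>i. f (d i))) $$ (i, j)
                   = (real_diag n (\<lambda>i. f (e i)) * W) $$ (i, j)"
        using ij cW by (simp add: real_diag_def mat_diag_mult_left mat_diag_mult_right)
    qed (use cW in \<open>auto simp: real_diag_def mat_diag_def\<close>)
    have VW: "V * W = U"
    proof -
      have "V * W = (V * mat_adjoint V) * U" by (simp add: cs W_def)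
      then show ?thesis by (simp add: VV cs)
    qed
    have WU: "W * mat_adjoint U = mat_adjoint V"
    proof -
      have "W * mat_adjoint U = mat_adjoint V * (U * mat_adjoint U)" by (simp add: cs W_def)
      then show ?thesis by (simp add: UU cs)
    qed
    have "U * real_diag n (\<lambda>i. f (d i)) * mat_adjoint U
            = V * (W * real_diag n (\<lambda>i. f (d i))) * mat_adjoint U"
    proof -
      have "V * (W * real_diag n (\<lambda>i. f (d i))) = (V * W) * real_diag n (\<lambda>i. f (d i))"
        by (simp add: cs)
      then show ?thesis by (simp add: VW)
    qed
    also have "\<dots> = V * real_diag n (\<lambda>i. f (e i)) * (W * mat_adjoint U)"
      by (simp add: cs comm')
    finally show ?thesis by (simp add: WU)
  qed
  show ?thesis
    unfolding mat_fun_def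
  proof (rule the_equality)
    show "\<exists>V\<in>unitary_mats n. \<exists>e.
        U * real_diag n d * mat_adjoint U = V * real_diag n e * mat_adjoint V \<and>
        U * real_diag n (\<lambda>i. f (d i)) * mat_adjoint U
          = V * real_diag n (\<lambda>i. f (e i)) * mat_adjoint V"
      using U by blast
  next
    fix B
    assume "\<exists>V\<in>unitary_mats n. \<exists>e.
        U * real_diag n d * mat_adjoint U = V * real_diag n e * mat_adjoint V \<and>
        B = V * real_diag n (\<lambda>i. f (e i)) * mat_adjoint V"
    then show "B = U * real_diag n (\<lambda>i. f (d i)) * mat_adjoint U"
      using unique by blast
  qed
qed

end

theory Submission
  imports Defs "HOL-Analysis.Weierstrass_Theorems" "Jordan_Normal_Form.Spectral_Radius"
begin

text \<open>For a function \<open>f\<close> with \<open>2n\<close> continuous derivatives, both sides of the equivalence turn out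
to say the same thing: at every point \<open>x\<close> of the interval the Hankel matrix
\<open>(f\<^sub>i\<^sub>+\<^sub>j\<^sub>+\<^sub>2)\<close>, \<open>i, j < n\<close>, of the Taylor coefficients \<open>f\<^sub>k = f\<^sup>(\<^sup>k\<^sup>)(x) / k!\<close> is positive
semidefinite.

\<^item> The Taylor coefficient of order \<open>2n\<close> of \<open>f q\<^sup>2\<close> at \<open>x\<close> is the Hankel form evaluated at the
coefficients of \<open>q\<close> around \<open>x\<close> (\<open>coeff_mult_square\<close>). A divided difference of order \<open>2n\<close> is such a
coefficient at an intermediate point, which gives \<open>divided_difference_nonneg_if_hankel\<close>; letting all
nodes shrink to \<open>x\<close> gives the converse \<open>hankel_if_divided_difference_nonneg\<close>.

\<^item> Matrix convexity is tested at the three matrices \<open>x + h (A + E)\<close>, \<open>x + h (A - E)\<close> and their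
midpoint \<open>x + h A\<close>, where \<open>A\<close> is the adjacency matrix of a path, \<open>E\<close> is a loop at its first vertex,
and the test vector has the entries \<open>c\<^sub>i h\<^sup>n\<^sup>-\<^sup>1\<^sup>-\<^sup>i\<close>. A walk between the vertices \<open>i\<close> and \<open>j\<close> has to make
\<open>i + j\<close> steps to reach the loop and to come back. So the even part in \<open>E\<close> is of order
\<open>h\<^sup>2\<^sup>n\<close>, and its leading coefficient is the Hankel form at \<open>c\<close>
(\<open>hankel_if_convexity_functionals_nonneg\<close>).

\<^item> Conversely, for a polynomial \<open>f\<close> the second derivative of \<open>s \<mapsto> \<langle>f(B + s H) v, v\<rangle>\<close> is, in an
eigenbasis, twice a sum of Kraus's forms \<open>\<Sum>\<^sub>i\<^sub>j c\<^sub>i c\<^sub>j [\<lambda>\<^sub>i, \<lambda>\<^sub>m, \<lambda>\<^sub>j]\<^sub>f\<close>. Each of these is a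
divided difference of \<open>f p\<^sup>2\<close> with the nodes \<open>\<lambda>\<^sub>1, \<lambda>\<^sub>1, \<dots>, \<lambda>\<^sub>n, \<lambda>\<^sub>n, \<lambda>\<^sub>m\<close>, where \<open>p\<close> is the numerator of
\<open>\<Sum>\<^sub>i c\<^sub>i / (z - \<lambda>\<^sub>i)\<close>, hence again a Hankel form at an intermediate point
(\<open>kraus_form_mean_value\<close>). A general \<open>f\<close> is approximated by polynomials together with its
derivatives, at the price of an arbitrarily small error (\<open>convexity_functionals_nonneg_if_hankel\<close>).

Smoothness is removed by averaging. Both conditions require that certain finite sums
\<open>\<Sum>\<^sub>i w\<^sub>i f(x\<^sub>i)\<close> be nonnegative, and both families of sums are invariant under translation of the
nodes. So both conditions pass to the averages \<open>1/h \<integral>\<^bsub>x\<^esub>\<^bsup>x+h\<^esup> f\<close>, which have one more derivative than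
\<open>f\<close>, and back from the averages to a continuous \<open>f\<close> as \<open>h \<rightarrow> 0\<close> (\<open>nonneg_on_smoothing\<close>). Continuity
follows from ordinary convexity: on the matrix side by looking at multiples of the identity, on the
other side by merging a node with a root of \<open>q\<close>, which lowers \<open>n\<close> step by step down to \<open>1\<close>
(\<open>dd_nonneg_Suc\<close>).\<close>

section \<open>Positivity of finite functionals and smoothing by averages\<close>

text \<open>A list of pairs (weight, node) stands for the functional \<open>f \<mapsto> \<Sum>\<^sub>i w\<^sub>i f(x\<^sub>i)\<close>; a list rather than a
function of the node, because the same node may occur several times.\<close>

definition wsum :: "(real \<times> real) list \<Rightarrow> (real \<Rightarrow> real) \<Rightarrow> real" where
  "wsum l f = (\<Sum>(w, x)\<leftarrow>l. w * f x)"

definition nonneg_on :: "(real \<times> real) list set \<Rightarrow> real set \<Rightarrow> (real \<Rightarrow> real) \<Rightarrow> bool" where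
  "nonneg_on \<Phi> I f \<longleftrightarrow> (\<forall>l\<in>\<Phi>. snd ` set l \<subseteq> I \<longrightarrow> 0 \<le> wsum l f)"

definition translation_invariant :: "(real \<times> real) list set \<Rightarrow> bool" where
  "translation_invariant \<Phi> \<longleftrightarrow> (\<forall>l\<in>\<Phi>. \<forall>s. map (\<lambda>(w, x). (w, x + s)) l \<in> \<Phi>)"

text \<open>The sequence \<open>F\<close> lists the derivatives of \<open>F 0\<close>, so this says that \<open>F 0\<close> has \<open>k\<close> continuous
derivatives on \<open>I\<close>.\<close>

definition smooth_seq :: "nat \<Rightarrow> real set \<Rightarrow> (nat \<Rightarrow> real \<Rightarrow> real) \<Rightarrow> bool" where
  "smooth_seq k I F \<longleftrightarrow>
     (\<forall>j<k. \<forall>x\<in>I. (F j has_real_derivative F (Suc j) x) (at x)) \<and> continuous_on I (F k)"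

lemma wsum_Nil [simp]: "wsum [] f = 0"
  and wsum_Cons: "wsum (p # l) f = fst p * f (snd p) + wsum l f"
  and wsum_append: "wsum (l @ l') f = wsum l f + wsum l' f"
  by (auto simp: wsum_def split_beta)

lemma wsum_upt: "wsum (map (\<lambda>i. (w i, x i)) [0..<m]) f = (\<Sum>i<m. w i * f (x i))"
  by (simp add: wsum_def comp_def interv_sum_list_conv_sum_set_nat atLeast0LessThan)

lemma wsum_translate: "wsum (map (\<lambda>(w, x). (w, x + s)) l) f = wsum l (\<lambda>x. f (x + s))"
  by (induction l) (auto simp: wsum_Cons)

lemma tendsto_wsum:
  assumes "\<And>x. x \<in> snd ` set l \<Longrightarrow> ((\<lambda>h. G h x) \<longlongrightarrow> f x) net"
  shows "((\<lambda>h. wsum l (G h)) \<longlongrightarrow> wsum l f) net"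
  using assms by (induction l) (auto simp: wsum_Cons intro!: tendsto_intros)

lemma smooth_seq_continuous_on:
  assumes "smooth_seq k I F" "j \<le> k"
  shows "continuous_on I (F j)"
proof (cases "j = k")
  case False
  then have "(F j has_real_derivative F (Suc j) x) (at x)" if "x \<in> I" for x
    using assms that by (auto simp: smooth_seq_def)
  then show ?thesis
    by (blast intro: continuous_at_imp_continuous_on DERIV_isCont)
qed (use assms in \<open>auto simp: smooth_seq_def\<close>)

text \<open>The mean of \<open>F 0\<close> over \<open>[x, x + h]\<close>, followed by its derivatives: these are the difference
quotients of the functions \<open>F i\<close>, so there is one more of them.\<close>

definition steklov :: "real \<Rightarrow> (nat \<Rightarrow> real \<Rightarrow> real) \<Rightarrow> nat \<Rightarrow> real \<Rightarrow> real" where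
  "steklov h F j x = (case j of 0 \<Rightarrow> integral {x..x + h} (F 0) / h
     | Suc i \<Rightarrow> (F i (x + h) - F i x) / h)"

text \<open>With a base point \<open>c\<close> fixed to the left of \<open>x\<close>, the integral is a difference of two values of the
same antiderivative.\<close>

lemma DERIV_moving_integral:
  fixes f :: "real \<Rightarrow> real"
  assumes I: "open I" "convex I" and f: "continuous_on I f"
    and h: "0 < h" and x: "x \<in> I" "x + h \<in> I"
  shows "((\<lambda>y. integral {y..y + h} f) has_real_derivative (f (x + h) - f x)) (at x)"
proof -
  obtain e where e: "0 < e" "cball x e \<subseteq> I" "cball (x + h) e \<subseteq> I"
  proof -
    obtain e1 where e1: "e1 > 0" "cball x e1 \<subseteq> I" using I(1) x(1) open_contains_cball by blast
    obtain e2 where e2: "e2 > 0" "cball (x + h) e2 \<subseteq> I" using I(1) x(2) open_contains_cball by blast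
    show ?thesis by (rule that[of "min e1 e2"]) (use e1 e2 in auto)
  qed
  define c where "c = x - e"
  define d where "d = x + h + e"
  have cd: "{c..d} \<subseteq> I"
  proof -
    have "c \<in> I" using e(1) by (intro subsetD[OF e(2)]) (auto simp: c_def dist_real_def)
    moreover have "d \<in> I" using e(1) by (intro subsetD[OF e(3)]) (auto simp: d_def dist_real_def)
    ultimately show ?thesis using I(2)
      using closed_segment_subset[of c I d] e(1) h
      by (simp add: closed_segment_eq_real_ivl c_def d_def)
  qed
  have cont: "continuous_on {c..d} f" using f cd continuous_on_subset by blast
  define J where "J = (\<lambda>u. integral {c..u} f)"
  have J: "(J has_real_derivative f t) (at t)" if "c < t" "t < d" for t
  proof -
    have "(J has_real_derivative f t) (at t within {c..d})"
      unfolding J_def by (rule integral_has_real_derivative[OF cont]) (use that in auto)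
    then show ?thesis using that by (simp add: at_within_Icc_at)
  qed
  have 1: "((\<lambda>y. J (y + h) - J y) has_real_derivative (f (x + h) - f x)) (at x)"
  proof (rule DERIV_diff)
    have "(J has_real_derivative f (x + h)) (at (x + h))"
      by (rule J) (use e h in \<open>auto simp: c_def d_def\<close>)
    then show "((\<lambda>y. J (y + h)) has_real_derivative f (x + h)) (at x)"
      by (simp add: DERIV_shift)
    show "(J has_real_derivative f x) (at x)"
      by (rule J) (use e h in \<open>auto simp: c_def d_def\<close>)
  qed
  show ?thesis
  proof (rule has_field_derivative_transform_within[OF 1 e(1)])
    fix y assume "dist y x < e"
    then have y: "c \<le> y" "y + h \<le> d" by (auto simp: c_def d_def dist_real_def)
    have "integral {c..y} f + integral {y..y + h} f = integral {c..y + h} f"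
      by (rule Henstock_Kurzweil_Integration.integral_combine)
        (use y h in \<open>auto intro!: integrable_continuous_real continuous_on_subset[OF cont]\<close>)
    then show "J (y + h) - J y = integral {y..y + h} f" by (simp add: J_def)
  qed auto
qed

lemma smooth_seq_steklov:
  assumes I: "open I" "convex I" and F: "smooth_seq k I F" and h: "0 < h"
  shows "smooth_seq (Suc k) {x \<in> I. x + h \<in> I} (steklov h F)"
  unfolding smooth_seq_def
proof (intro conjI allI impI ballI)
  fix j x assume j: "j < Suc k" and x: "x \<in> {x \<in> I. x + h \<in> I}"
  show "(steklov h F j has_real_derivative steklov h F (Suc j) x) (at x)"
  proof (cases j)
    case 0
    have "((\<lambda>y. integral {y..y + h} (F 0) / h) has_real_derivative (F 0 (x + h) - F 0 x) / h) (at x)"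
      by (rule DERIV_cdivide[OF DERIV_moving_integral])
        (use I x h smooth_seq_continuous_on[OF F] in auto)
    then show ?thesis by (simp add: steklov_def[abs_def] 0)
  next
    case (Suc i)
    have D: "(F i has_real_derivative F (Suc i) y) (at y)" if "y \<in> I" for y
      using F j Suc that by (auto simp: smooth_seq_def)
    have "((\<lambda>y. (F i (y + h) - F i y) / h) has_real_derivative (F (Suc i) (x + h) - F (Suc i) x) / h) (at x)"
      by (intro DERIV_cdivide DERIV_diff) (use D[of x] D[of "x + h"] x in \<open>auto simp: DERIV_shift\<close>)
    then show ?thesis by (simp add: steklov_def[abs_def] Suc)
  qed
next
  have F': "continuous_on I (F k)" using F by (auto simp: smooth_seq_def)
  show "continuous_on {x \<in> I. x + h \<in> I} (steklov h F (Suc k))"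
    unfolding steklov_def[abs_def]
    using h by (auto intro!: continuous_intros continuous_on_compose2[OF F'] continuous_on_subset[OF F'])
qed

lemma open_shift_Int: "open I \<Longrightarrow> open {x \<in> I. x + h \<in> (I :: real set)}"
proof -
  assume I: "open I"
  have "{x \<in> I. x + h \<in> I} = I \<inter> (\<lambda>x. x + h) -` I" by auto
  then show ?thesis using I by (auto intro!: open_Int open_vimage continuous_intros)
qed

lemma convex_shift_Int: "convex I \<Longrightarrow> convex {x \<in> I. x + h \<in> (I :: real set)}"
proof -
  assume I: "convex I"
  have "{x \<in> I. x + h \<in> I} = I \<inter> (\<lambda>x. x + h) -` I" by auto
  moreover have "(\<lambda>x. x + h) -` I = (\<lambda>x. -h + x) ` I" by (force simp: image_iff)
  ultimately show ?thesis using I by (auto intro!: convex_Int convex_translation)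
qed

text \<open>A functional applied to the average is the average of the translated functionals applied to \<open>F 0\<close>.\<close>

lemma nonneg_on_steklov:
  assumes \<Phi>: "translation_invariant \<Phi>" and I: "open I" "convex I"
    and f: "continuous_on I (F 0)" and pos: "nonneg_on \<Phi> I (F 0)" and h: "0 < h"
  shows "nonneg_on \<Phi> {x \<in> I. x + h \<in> I} (steklov h F 0)"
  unfolding nonneg_on_def
proof (intro ballI impI)
  fix l assume l: "l \<in> \<Phi>" "snd ` set l \<subseteq> {x \<in> I. x + h \<in> I}"
  have seg: "{x..x + h} \<subseteq> I" if "x \<in> I" "x + h \<in> I" for x
    using closed_segment_subset[of x I "x + h"] I h that by (auto simp: closed_segment_eq_real_ivl)
  have int: "((\<lambda>s. F 0 (x + s)) has_integral h * steklov h F 0 x) {0..h}" if "x \<in> I" "x + h \<in> I" for x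
  proof -
    have "(F 0 has_integral integral {x..x + h} (F 0)) {x..x + h}"
      by (intro integrable_integral integrable_continuous_real continuous_on_subset[OF f] seg that)
    then have "((F 0 \<circ> (+) x) has_integral integral {x..x + h} (F 0)) {0..h}"
      by (subst has_integral_shift_Icc_real) (simp add: add.commute)
    then show ?thesis using h by (simp add: steklov_def o_def)
  qed
  have "((\<lambda>s. wsum l (\<lambda>x. F 0 (x + s))) has_integral h * wsum l (steklov h F 0)) {0..h}"
    using l(2)
  proof (induction l)
    case (Cons p l)
    have "((\<lambda>s. fst p * F 0 (snd p + s)) has_integral fst p * (h * steklov h F 0 (snd p))) {0..h}"
      by (intro has_integral_mult_right int) (use Cons.prems in auto)
    from has_integral_add[OF this Cons.IH] Cons.prems show ?case
      by (simp add: wsum_Cons algebra_simps)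
  qed (auto simp: wsum_def)
  moreover have "0 \<le> wsum l (\<lambda>x. F 0 (x + s))" if "s \<in> {0..h}" for s
  proof -
    have "map (\<lambda>(w, x). (w, x + s)) l \<in> \<Phi>" using \<Phi> l(1) by (auto simp: translation_invariant_def)
    moreover have "x + s \<in> I" if "x \<in> snd ` set l" for x
    proof -
      have "{x..x + h} \<subseteq> I" using that l(2) by (intro seg) auto
      then show ?thesis using \<open>s \<in> {0..h}\<close> by auto
    qed
    ultimately have "0 \<le> wsum (map (\<lambda>(w, x). (w, x + s)) l) (F 0)"
      using pos unfolding nonneg_on_def by (force simp: image_iff)
    then show ?thesis by (simp add: wsum_translate)
  qed
  ultimately have "0 \<le> h * wsum l (steklov h F 0)" by (rule has_integral_nonneg)
  then show "0 \<le> wsum l (steklov h F 0)" using h by (simp add: zero_le_mult_iff)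
qed

lemma steklov_tendsto:
  assumes I: "open I" "convex I" and f: "continuous_on I (F 0)" and x: "x \<in> I"
  shows "((\<lambda>h. steklov h F 0 x) \<longlongrightarrow> F 0 x) (at_right 0)"
proof -
  obtain e where e: "0 < e" "cball x e \<subseteq> I" using I(1) x(1) open_contains_cball by blast
  have cont: "continuous_on {x..x + e} (F 0)"
    by (rule continuous_on_subset[OF f]) (use e in \<open>auto simp: dist_real_def subset_eq\<close>)
  have "((\<lambda>u. integral {x..u} (F 0)) has_real_derivative F 0 x) (at x within {x..x + e})"
    by (rule integral_has_real_derivative[OF cont]) (use e in auto)
  then have "((\<lambda>u. integral {x..u} (F 0)) has_real_derivative F 0 x) (at_right x)"
    using e by (simp add: at_within_Icc_at_right)
  then have "((\<lambda>u. integral {x..u} (F 0) / (u - x)) \<longlongrightarrow> F 0 x) (at_right x)"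
    by (simp add: has_field_derivative_iff)
  then show ?thesis
    by (subst (asm) filterlim_at_right_to_0) (simp add: steklov_def add.commute)
qed

text \<open>An implication between two positivity conditions has to be proved for smooth functions only.
The number of known derivatives is lowered one at a time: the averages of a function in \<open>C\<^sup>k\<close> are
in \<open>C\<^sup>k\<^sup>+\<^sup>1\<close> and inherit the hypothesis; their conclusion passes to the limit \<open>h \<rightarrow> 0\<close>, because only
finitely many nodes are involved.\<close>

lemma nonneg_on_smoothing:
  assumes \<Phi>: "translation_invariant \<Phi>"
    and smooth: "\<And>I F. open I \<Longrightarrow> convex I \<Longrightarrow> smooth_seq m I F \<Longrightarrow> nonneg_on \<Phi> I (F 0)
        \<Longrightarrow> nonneg_on \<Psi> I (F 0)"
    and I: "open I" "convex I" and f: "continuous_on I f" and pos: "nonneg_on \<Phi> I f"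
  shows "nonneg_on \<Psi> I f"
proof -
  have "nonneg_on \<Psi> I (F 0)" if "k \<le> m" "open I" "convex I" "smooth_seq k I F" "nonneg_on \<Phi> I (F 0)"
    for k I F
    using that
  proof (induction k arbitrary: I F rule: inc_induct)
    case base
    then show ?case using smooth by blast
  next
    case (step k)
    have cont: "continuous_on I (F 0)" using smooth_seq_continuous_on[OF step.prems(3)] by simp
    have h: "nonneg_on \<Psi> {x \<in> I. x + h \<in> I} (steklov h F 0)" if "0 < h" for h
      by (rule step.IH[OF open_shift_Int[OF step.prems(1)] convex_shift_Int[OF step.prems(2)]
            smooth_seq_steklov[where F = F, OF step.prems(1-3) that]
            nonneg_on_steklov[where F = F, OF \<Phi> step.prems(1,2) cont step.prems(4) that]])
    show ?case
      unfolding nonneg_on_def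
    proof (intro ballI impI)
      fix l assume l: "l \<in> \<Psi>" "snd ` set l \<subseteq> I"
      have ev: "\<forall>\<^sub>F h in at_right 0. x + h \<in> I" if xI: "x \<in> I" for x
      proof -
        obtain e where e: "0 < e" "ball x e \<subseteq> I" using step.prems(1) xI by (rule openE)
        have "x + h \<in> I" if "h \<in> {0<..<e}" for h
          by (rule subsetD[OF e(2)]) (use that in \<open>simp add: dist_real_def\<close>)
        then show ?thesis by (rule eventually_mono[OF eventually_at_right_real[OF e(1)]])
      qed
      then have "\<forall>\<^sub>F h in at_right 0. \<forall>x\<in>snd ` set l. x + h \<in> I"
        using l(2) by (intro eventually_ball_finite ballI ev) auto
      then have "\<forall>\<^sub>F h in at_right 0. 0 \<le> wsum l (steklov h F 0)"
        using eventually_at_right_less[of 0]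
      proof eventually_elim
        case (elim h)
        have "snd ` set l \<subseteq> {x \<in> I. x + h \<in> I}" using elim(1) l(2) by auto
        then show ?case using h[OF elim(2)] l(1) unfolding nonneg_on_def by blast
      qed
      moreover have "((\<lambda>h. wsum l (steklov h F 0)) \<longlongrightarrow> wsum l (F 0)) (at_right 0)"
        by (intro tendsto_wsum steklov_tendsto[where F = F, OF step.prems(1,2) cont]) (use l(2) in auto)
      ultimately show "0 \<le> wsum l (F 0)" by (intro tendsto_lowerbound) auto
    qed
  qed
  from this[of 0 I "\<lambda>_. f"] show ?thesis using I f pos by (auto simp: smooth_seq_def)
qed

section \<open>Polynomial approximation and Rolle's theorem with multiplicities\<close>

lemma ex_antiderivative_poly: "\<exists>Q. pderiv Q = (p :: real poly)"
proof
  have "pderiv (\<Sum>i\<le>degree p. monom (coeff p i / real (Suc i)) (Suc i))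
      = (\<Sum>i\<le>degree p. monom (coeff p i) i)"
    by (auto simp: pderiv_sum pderiv_monom intro!: sum.cong)
  then show "pderiv (\<Sum>i\<le>degree p. monom (coeff p i / real (Suc i)) (Suc i)) = p"
    by (simp add: poly_as_sum_of_monoms)
qed

lemma weierstrass_poly:
  assumes "continuous_on {a..b} f" "0 < e"
  shows "\<exists>P. \<forall>x\<in>{a..b}. \<bar>f x - poly P x\<bar> \<le> (e :: real)"
proof -
  obtain g where g: "real_polynomial_function g" "\<And>x. x \<in> {a..b} \<Longrightarrow> \<bar>f x - g x\<bar> < e"
    using Stone_Weierstrass_real_polynomial_function[of "{a..b}" f e] assms by auto
  from g(1) obtain c m where "g = (\<lambda>x. \<Sum>i\<le>m. c i * x ^ i)"
    unfolding real_polynomial_function_iff_sum by blast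
  then have "g x = poly (\<Sum>i\<le>m. monom (c i) i) x" for x
    by (simp add: poly_sum poly_monom)
  then show ?thesis
    using g(2) by (intro exI[of _ "\<Sum>i\<le>m. monom (c i) i"]) (auto intro: less_imp_le)
qed

text \<open>Approximate the highest derivative and integrate; each integration multiplies the error by at most
the length of the interval.\<close>

lemma weierstrass_poly_derivatives:
  fixes F :: "nat \<Rightarrow> real \<Rightarrow> real"
  assumes "\<And>j x. j < m \<Longrightarrow> x \<in> {a..b} \<Longrightarrow> (F j has_real_derivative F (Suc j) x) (at x within {a..b})"
    and "continuous_on {a..b} (F m)" and "a \<le> b" and "0 < e"
  shows "\<exists>P. \<forall>j\<le>m. \<forall>x\<in>{a..b}. \<bar>F j x - poly ((pderiv ^^ j) P) x\<bar> \<le> e"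
  using assms
proof (induction m arbitrary: F e)
  case 0
  then show ?case using weierstrass_poly[of a b "F 0" e] by auto
next
  case (Suc m)
  define e' where "e' = e / (1 + (b - a))"
  have e': "0 < e'" "e' \<le> e" "e' * (b - a) \<le> e"
    using Suc.prems(3,4) by (auto simp: e'_def field_simps mult_nonneg_nonneg)
  have "\<exists>P. \<forall>j\<le>m. \<forall>x\<in>{a..b}. \<bar>F (Suc j) x - poly ((pderiv ^^ j) P) x\<bar> \<le> e'"
    by (rule Suc.IH) (use Suc.prems e'(1) in auto)
  then obtain P1 where P1: "\<And>j x. j \<le> m \<Longrightarrow> x \<in> {a..b} \<Longrightarrow> \<bar>F (Suc j) x - poly ((pderiv ^^ j) P1) x\<bar> \<le> e'"
    by blast
  obtain Q where Q: "pderiv Q = P1" using ex_antiderivative_poly by blast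
  define P where "P = Q + [:F 0 a - poly Q a:]"
  have P: "pderiv P = P1" by (simp add: P_def pderiv_add Q pderiv_pCons)
  have 0: "\<bar>F 0 x - poly P x\<bar> \<le> e" if x: "x \<in> {a..b}" for x
  proof -
    have "norm ((F 0 x - poly P x) - (F 0 a - poly P a)) \<le> e' * norm (x - a)"
    proof (rule field_differentiable_bound[where S = "{a..b}" and f' = "\<lambda>x. F (Suc 0) x - poly P1 x"])
      fix z assume z: "z \<in> {a..b}"
      show "((\<lambda>x. F 0 x - poly P x) has_real_derivative F (Suc 0) z - poly P1 z) (at z within {a..b})"
        using Suc.prems(1)[of 0 z] z poly_DERIV[of P z, THEN has_field_derivative_at_within] P
        by (auto intro: DERIV_diff)
      show "norm (F (Suc 0) z - poly P1 z) \<le> e'" using P1[of 0 z] z by simp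
    qed (use x Suc.prems(3) in auto)
    also have "\<dots> \<le> e' * (b - a)" using x e'(1) by (auto intro!: mult_left_mono)
    finally show ?thesis using e'(3) by (simp add: P_def)
  qed
  have "\<bar>F j x - poly ((pderiv ^^ j) P) x\<bar> \<le> e" if "j \<le> Suc m" "x \<in> {a..b}" for j x
  proof (cases j)
    case (Suc i)
    have "\<bar>F (Suc i) x - poly ((pderiv ^^ i) P1) x\<bar> \<le> e'" using P1 that Suc by simp
    then show ?thesis using e'(2) by (simp add: Suc funpow_Suc_right P del: funpow.simps)
  qed (use 0 that in simp)
  then show ?case by blast
qed

text \<open>The coefficients of this polynomial are the Taylor coefficients of \<open>P\<close> at \<open>x\<close>.\<close>

definition taylor_poly :: "real poly \<Rightarrow> real \<Rightarrow> real poly" where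
  "taylor_poly P x = pcompose P [:x, 1:]"

lemma taylor_poly_mult: "taylor_poly (P * Q) x = taylor_poly P x * taylor_poly Q x"
  and taylor_poly_add: "taylor_poly (P + Q) x = taylor_poly P x + taylor_poly Q x"
  and degree_taylor_poly: "degree (taylor_poly P x) = degree P"
  by (simp_all add: taylor_poly_def pcompose_mult pcompose_add)

lemma coeff_taylor_poly: "coeff (taylor_poly P x) k = poly ((pderiv ^^ k) P) x / fact k"
proof -
  have "(pderiv ^^ k) (taylor_poly P x) = taylor_poly ((pderiv ^^ k) P) x"
    by (induction k) (simp_all add: taylor_poly_def pderiv_pcompose pderiv_pCons)
  moreover have "coeff ((pderiv ^^ k) (taylor_poly P x)) 0 = fact k * coeff (taylor_poly P x) k"
    using coeff_higher_pderiv[of k "taylor_poly P x" 0] by (simp add: pochhammer_fact)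
  moreover have "coeff (taylor_poly ((pderiv ^^ k) P) x) 0 = poly ((pderiv ^^ k) P) x"
    by (simp add: taylor_poly_def poly_0_coeff_0[symmetric] poly_pcompose)
  ultimately show ?thesis by (simp add: field_simps)
qed

lemma coeff_taylor_poly_top:
  assumes "degree P \<le> m"
  shows "coeff (taylor_poly P x) m = coeff P m"
proof (cases "degree P = m")
  case True
  have "lead_coeff (taylor_poly P x) = lead_coeff P"
    using lead_coeff_comp[of "[:x, 1:]" P] by (simp add: taylor_poly_def)
  then show ?thesis using True by (simp add: degree_taylor_poly)
next
  case False
  then show ?thesis using assms by (simp add: coeff_eq_0 degree_taylor_poly)
qed

definition root_count :: "real \<Rightarrow> real \<Rightarrow> real poly \<Rightarrow> nat" where
  "root_count a b p = (\<Sum>y | poly p y = 0 \<and> y \<in> {a..b}. order y p)"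

lemma sum_order_le_root_count:
  assumes "p \<noteq> 0" "finite T" "T \<subseteq> {a..b}"
  shows "(\<Sum>y\<in>T. order y p) \<le> root_count a b p"
proof -
  have "(\<Sum>y\<in>T. order y p) = (\<Sum>y\<in>{y \<in> T. poly p y = 0}. order y p)"
    using assms by (intro sum.mono_neutral_right) (auto simp: order_0I)
  also have "\<dots> \<le> root_count a b p"
    unfolding root_count_def
    by (intro sum_mono2) (use assms in \<open>auto intro: finite_subset[OF _ poly_roots_finite[OF assms(1)]]\<close>)
  finally show ?thesis .
qed

lemma finite_Rolle_points:
  assumes "finite Z" "\<And>z. z \<in> Z \<Longrightarrow> poly p z = (0 :: real)"
  shows "\<exists>R. finite R \<and> R \<inter> Z = {} \<and> card Z \<le> card R + 1 \<and>
    (\<forall>r\<in>R. poly (pderiv p) r = 0 \<and> (\<exists>z\<in>Z. z < r) \<and> (\<exists>z\<in>Z. r < z))"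
  using assms
proof (induction Z rule: finite_linorder_max_induct)
  case empty
  then show ?case by (intro exI[of _ "{}"]) auto
next
  case (insert z Z)
  then obtain R where R: "finite R" "R \<inter> Z = {}" "card Z \<le> card R + 1"
      "\<And>r. r \<in> R \<Longrightarrow> poly (pderiv p) r = 0 \<and> (\<exists>z\<in>Z. z < r) \<and> (\<exists>z\<in>Z. r < z)"
    by (metis insertI2)
  show ?case
  proof (cases "Z = {}")
    case True
    then show ?thesis by (intro exI[of _ "{}"]) auto
  next
    case False
    define y where "y = Max Z"
    have y: "y \<in> Z" "\<And>u. u \<in> Z \<Longrightarrow> u \<le> y" using insert.hyps(1) False by (auto simp: y_def)
    have yz: "y < z" using insert.hyps(2) y by auto
    obtain r where r: "y < r" "r < z" "poly (pderiv p) r = 0"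
    proof -
      have "\<exists>r>y. r < z \<and> poly p z - poly p y = (z - y) * poly (pderiv p) r"
        by (rule poly_MVT[OF yz])
      then show ?thesis using that insert.prems[of z] insert.prems[of y] y yz by auto
    qed
    have "r \<notin> R" using R(4)[of r] y(2) r(1) by force
    have "z \<notin> Z" using insert.hyps(2) by auto
    show ?thesis
    proof (intro exI[of _ "insert r R"] conjI)
      show "insert r R \<inter> insert z Z = {}"
        using R(2,4) r y(2) insert.hyps(2) by force
      show "card (insert z Z) \<le> card (insert r R) + 1"
        using \<open>r \<notin> R\<close> \<open>z \<notin> Z\<close> R(1,3) insert.hyps(1) by simp
      show "\<forall>s\<in>insert r R. poly (pderiv p) s = 0 \<and> (\<exists>u\<in>insert z Z. u < s) \<and> (\<exists>u\<in>insert z Z. s < u)"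
        using R(4) r y(1) by blast
    qed (use R in auto)
  qed
qed

text \<open>Differentiation lowers the multiplicity of each root by one, and Rolle's theorem provides a new root
between any two neighbouring ones.\<close>

lemma root_count_pderiv:
  assumes "p \<noteq> 0" "pderiv p \<noteq> 0"
  shows "root_count a b p \<le> root_count a b (pderiv p) + 1"
proof -
  define Z where "Z = {y. poly p y = 0 \<and> y \<in> {a..b}}"
  have Z: "finite Z" using poly_roots_finite[OF assms(1)] by (auto simp: Z_def intro: finite_subset)
  obtain R where R: "finite R" "R \<inter> Z = {}" "card Z \<le> card R + 1"
      "\<And>r. r \<in> R \<Longrightarrow> poly (pderiv p) r = 0 \<and> (\<exists>z\<in>Z. z < r) \<and> (\<exists>z\<in>Z. r < z)"
    using finite_Rolle_points[OF Z, of p] by (auto simp: Z_def)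
  have "root_count a b p = (\<Sum>y\<in>Z. order y p)" by (simp add: root_count_def Z_def)
  also have "\<dots> = (\<Sum>y\<in>Z. order y (pderiv p) + 1)"
    using assms by (intro sum.cong refl) (auto simp: Z_def order_pderiv order_root)
  also have "\<dots> = (\<Sum>y\<in>Z. order y (pderiv p)) + card Z"
    by (subst sum.distrib) simp
  also have "\<dots> \<le> (\<Sum>y\<in>Z. order y (pderiv p)) + card R + 1" using R(3) by simp
  also have "card R \<le> (\<Sum>y\<in>R. order y (pderiv p))"
  proof -
    have "(\<Sum>y\<in>R. 1) \<le> (\<Sum>y\<in>R. order y (pderiv p))"
      using R(4) assms(2) by (intro sum_mono) (auto simp: order_root Suc_le_eq)
    then show ?thesis by simp
  qed
  also have "(\<Sum>y\<in>Z. order y (pderiv p)) + (\<Sum>y\<in>R. order y (pderiv p)) + 1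
      = (\<Sum>y\<in>Z \<union> R. order y (pderiv p)) + 1"
    using Z R by (subst sum.union_disjoint) auto
  also have "\<dots> \<le> root_count a b (pderiv p) + 1"
  proof -
    have "Z \<union> R \<subseteq> {a..b}" using R(4) by (force simp: Z_def)
    then show ?thesis using sum_order_le_root_count[of "pderiv p" "Z \<union> R"] assms Z R by simp
  qed
  finally show ?thesis by simp
qed

lemma Rolle_multiplicity:
  assumes "p \<noteq> 0" "m < root_count a b p"
  shows "\<exists>\<xi>\<in>{a..b}. poly ((pderiv ^^ m) p) \<xi> = 0"
  using assms
proof (induction m arbitrary: p)
  case 0
  then have "{y. poly p y = 0 \<and> y \<in> {a..b}} \<noteq> {}" by (metis less_not_refl root_count_def sum.empty)
  then show ?case by auto
next
  case (Suc m)
  show ?case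
  proof (cases "pderiv p = 0")
    case True
    have "{y. poly p y = 0 \<and> y \<in> {a..b}} \<noteq> {}"
      using Suc.prems(2) by (metis not_less0 root_count_def sum.empty)
    then show ?thesis using True by (auto simp: funpow_Suc_right simp del: funpow.simps)
  next
    case False
    then have "m < root_count a b (pderiv p)" using root_count_pderiv[OF Suc.prems(1) False, of a b] Suc.prems(2) by simp
    then show ?thesis using Suc.IH[OF False] by (simp add: funpow_Suc_right del: funpow.simps)
  qed
qed

lemma root_count_linear_factors:
  assumes "finite S" "\<And>i. i \<in> S \<Longrightarrow> x i \<in> {a..b}" "Q \<noteq> 0"
  shows "card S \<le> root_count a b ((\<Prod>i\<in>S. [:- x i, 1:]) * Q)"
  using assms(1,2)
proof (induction S)
  case (insert i S)
  define p where "p = (\<Prod>i\<in>S. [:- x i, 1:]) * Q"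
  have p: "p \<noteq> 0" using insert.hyps assms(3) by (simp add: p_def)
  have q: "[:- x i, 1:] * p \<noteq> 0" by (rule no_zero_divisors) (use p in simp_all)
  define T where "T = insert (x i) {y. poly p y = 0 \<and> y \<in> {a..b}}"
  have T: "finite T" using poly_roots_finite[OF p] by (auto simp: T_def intro: finite_subset)
  have "card (insert i S) \<le> root_count a b p + 1" using insert by (simp add: p_def)
  also have "root_count a b p + 1 \<le> (\<Sum>y\<in>T. order y p) + 1"
    unfolding root_count_def using T by (intro add_right_mono sum_mono2) (auto simp: T_def)
  also have "(\<Sum>y\<in>T. order y p) + 1 = (\<Sum>y\<in>T. order y p) + (\<Sum>y\<in>T. if y = x i then 1 else 0)"
    using T by (simp add: T_def)
  also have "\<dots> \<le> (\<Sum>y\<in>T. order y ([:- x i, 1:] * p))"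
    unfolding sum.distrib[symmetric]
  proof (rule sum_mono)
    fix y
    have "order (x i) [:- x i, 1:] = 1" using order_power_n_n[of "x i" 1] by simp
    then show "order y p + (if y = x i then 1 else 0) \<le> order y ([:- x i, 1:] * p)"
      using order_mult[OF q, of y] by auto
  qed
  also have "\<dots> \<le> root_count a b ([:- x i, 1:] * p)"
    by (rule sum_order_le_root_count[OF q T]) (use insert.prems in \<open>auto simp: T_def\<close>)
  finally show ?case unfolding prod.insert[OF insert.hyps(1,2)] mult.assoc p_def .
qed simp

text \<open>The mean value theorem for divided differences with coinciding nodes. Here \<open>R\<close> is the remainder of
\<open>g\<close> modulo \<open>\<Prod>\<^sub>i (z - x\<^sub>i)\<close>, that is, its Hermite interpolation polynomial, and the coefficient of
\<open>R\<close> of order \<open>m\<close> is the divided difference. Since \<open>g - R\<close> has \<open>m + 1\<close> roots with multiplicity, its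
derivative of order \<open>m\<close> vanishes somewhere.\<close>

lemma confluent_mean_value:
  assumes "finite S" "card S = Suc m" "\<And>i. i \<in> S \<Longrightarrow> x i \<in> {a..b}"
    and g: "g = R + (\<Prod>i\<in>S. [:- x i, 1:]) * Q" and R: "degree R \<le> m"
  shows "\<exists>\<xi>\<in>{a..b}. coeff (taylor_poly g \<xi>) m = coeff R m"
proof -
  define w where "w = (\<Prod>i\<in>S. [:- x i, 1:])"
  have "\<exists>\<xi>\<in>{a..b}. poly ((pderiv ^^ m) (w * Q)) \<xi> = 0"
  proof (cases "Q = 0")
    case True
    obtain i where "i \<in> S" using assms(2) by fastforce
    then show ?thesis using True assms(3)[of i] by (intro bexI[of _ "x i"]) auto
  next
    case False
    then show ?thesis
      using root_count_linear_factors[where x = x, OF assms(1,3) False] assms(1,2)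
      by (intro Rolle_multiplicity) (auto simp: w_def)
  qed
  then obtain \<xi> where \<xi>: "\<xi> \<in> {a..b}" "coeff (taylor_poly (w * Q) \<xi>) m = 0"
    by (auto simp: coeff_taylor_poly)
  then have "coeff (taylor_poly g \<xi>) m = coeff R m"
    using coeff_taylor_poly_top[OF R] by (simp add: g w_def[symmetric] taylor_poly_add)
  then show ?thesis using \<xi>(1) by blast
qed

section \<open>Hankel positivity and divided differences\<close>

text \<open>The argument \<open>T\<close> is meant to be a sequence of Taylor coefficients; the matrix starts with the order
\<open>2\<close>, the first one that distinguishes convex functions.\<close>

definition hankel_nonneg :: "nat \<Rightarrow> (nat \<Rightarrow> real) \<Rightarrow> bool" where
  "hankel_nonneg n T \<longleftrightarrow> (\<forall>c. 0 \<le> (\<Sum>i<n. \<Sum>j<n. c i * c j * T (i + j + 2)))"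

lemma nonneg_if_ge_small_multiples:
  fixes x K :: real
  assumes "\<And>e. 0 < e \<Longrightarrow> - (e * K) \<le> x"
  shows "0 \<le> x"
proof -
  have "((\<lambda>e. - (e * K)) \<longlongrightarrow> - (0 * K)) (at_right 0)"
    by (intro tendsto_intros)
  then have "- (0 * K) \<le> x"
    by (rule tendsto_upperbound)
      (auto intro!: eventually_mono[OF eventually_at_right_less[of 0]] assms)
  then show ?thesis by simp
qed

text \<open>The coefficients of \<open>q\<close> enter in reversed order, because \<open>q\<close> has room for the degrees up to \<open>n - 1\<close>
and the coefficients of \<open>P\<close> have to fill up the total degree \<open>2 n\<close>.\<close>

lemma coeff_mult_square:
  fixes P q :: "real poly"
  assumes "degree q < n"
  shows "coeff (P * q\<^sup>2) (2 * n)
    = (\<Sum>i<n. \<Sum>j<n. coeff q (n - Suc i) * coeff q (n - Suc j) * coeff P (i + j + 2))"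
proof -
  have reindex: "(\<Sum>i<n. \<Sum>j<n. G i j) = (\<Sum>i<n. \<Sum>j<n. G (n - Suc i) (n - Suc j))"
    for G :: "nat \<Rightarrow> nat \<Rightarrow> real"
    by (subst sum.nat_diff_reindex[symmetric], rule sum.cong[OF refl],
        rule sum.nat_diff_reindex[symmetric])
  have q: "q = (\<Sum>i<n. monom (coeff q i) i)"
    using assms by (intro poly_eqI) (auto simp: coeff_sum coeff_eq_0)
  have "P * q\<^sup>2 = (\<Sum>i<n. \<Sum>j<n. monom (coeff q i) i * (monom (coeff q j) j * P))"
    by (subst q) (simp add: power2_eq_square sum_product sum_distrib_left sum_distrib_right mult_ac)
  also have "coeff \<dots> (2 * n) = (\<Sum>i<n. \<Sum>j<n. coeff q i * coeff q j * coeff P (2 * n - i - j))"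
    by (auto simp: coeff_sum coeff_monom_mult intro!: sum.cong)
  also have "\<dots> = (\<Sum>i<n. \<Sum>j<n. coeff q (n - Suc i) * coeff q (n - Suc j)
      * coeff P (2 * n - (n - Suc i) - (n - Suc j)))"
    by (rule reindex)
  also have "\<dots> = (\<Sum>i<n. \<Sum>j<n. coeff q (n - Suc i) * coeff q (n - Suc j) * coeff P (i + j + 2))"
  proof (intro sum.cong refl arg_cong2[where f = "(*)"] arg_cong[where f = "coeff P"])
    fix i j assume "i \<in> {..<n}" "j \<in> {..<n}"
    then show "2 * n - (n - Suc i) - (n - Suc j) = i + j + 2" by simp
  qed
  finally show ?thesis .
qed

lemma coeff_mult_square_lower_bound:
  assumes q: "degree q < n" "\<And>i. \<bar>coeff q i\<bar> \<le> B"
    and T: "hankel_nonneg n T" and close: "\<And>k. k \<le> 2 * n \<Longrightarrow> \<bar>T k - coeff P k\<bar> \<le> e"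
  shows "- (e * (real n * B)\<^sup>2) \<le> coeff (P * q\<^sup>2) (2 * n)"
proof -
  define c where "c i = coeff q (n - Suc i)" for i
  have B: "0 \<le> B" using q(2)[of 0] by linarith
  have e: "0 \<le> e" using close[of 0] by linarith
  have "(\<Sum>i<n. \<Sum>j<n. c i * c j * T (i + j + 2)) - coeff (P * q\<^sup>2) (2 * n)
      = (\<Sum>i<n. \<Sum>j<n. c i * c j * (T (i + j + 2) - coeff P (i + j + 2)))"
    unfolding coeff_mult_square[OF q(1)] c_def by (simp add: sum_subtractf algebra_simps)
  also have "\<dots> \<le> (\<Sum>i<n. \<Sum>j<n. B * B * e)"
  proof (intro sum_mono)
    fix i j assume ij: "i \<in> {..<n}" "j \<in> {..<n}"
    have "\<bar>c i * c j * (T (i + j + 2) - coeff P (i + j + 2))\<bar> \<le> B * B * e"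
      unfolding abs_mult by (intro mult_mono) (use ij q(2) close B in \<open>auto simp: c_def\<close>)
    then show "c i * c j * (T (i + j + 2) - coeff P (i + j + 2)) \<le> B * B * e" by linarith
  qed
  also have "\<dots> = e * (real n * B)\<^sup>2" by (simp add: power2_eq_square)
  finally have "(\<Sum>i<n. \<Sum>j<n. c i * c j * T (i + j + 2)) - coeff (P * q\<^sup>2) (2 * n)
      \<le> e * (real n * B)\<^sup>2" .
  moreover have "0 \<le> (\<Sum>i<n. \<Sum>j<n. c i * c j * T (i + j + 2))"
    using T by (simp add: hankel_nonneg_def)
  ultimately show ?thesis by linarith
qed

lemma linear_factors_dvd:
  fixes p :: "real poly"
  assumes "finite S" "inj_on x S" "\<And>i. i \<in> S \<Longrightarrow> poly p (x i) = 0"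
  shows "(\<Prod>i\<in>S. [:- x i, 1:]) dvd p"
  using assms
proof (induction S)
  case (insert i S)
  then obtain Q where Q: "p = (\<Prod>i\<in>S. [:- x i, 1:]) * Q" by auto
  have "poly (\<Prod>i\<in>S. [:- x i, 1:]) (x i) \<noteq> 0"
    using insert by (auto simp: poly_prod)
  then have "poly Q (x i) = 0" using insert.prems(2)[of i] Q by simp
  then have "[:- x i, 1:] dvd Q" by (simp add: poly_eq_0_iff_dvd)
  then have "[:- x i, 1:] * (\<Prod>i\<in>S. [:- x i, 1:]) dvd Q * (\<Prod>i\<in>S. [:- x i, 1:])"
    by (intro mult_dvd_mono) auto
  then show ?case unfolding prod.insert[OF insert.hyps] Q by (simp only: mult.commute)
qed simp

lemma degree_linear_factors:
  "finite S \<Longrightarrow> degree (\<Prod>i\<in>S. [:- x i :: real, 1:]) = card S"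
  by (subst degree_prod_sum_eq) auto

lemma coeff_linear_factors:
  "finite S \<Longrightarrow> coeff (\<Prod>i\<in>S. [:- x i :: real, 1:]) (card S) = 1"
  using lead_coeff_prod[of "\<lambda>i. [:- x i, 1:]" S] degree_linear_factors[of S x] by simp

text \<open>A divided difference of order \<open>m\<close> is the coefficient of order \<open>m\<close> of Lagrange's interpolation
polynomial \<open>R\<close>.\<close>

lemma divided_difference_poly_mean_value:
  fixes g :: "real poly"
  assumes inj: "inj_on x {..m}" and x: "\<And>i. i \<le> m \<Longrightarrow> x i \<in> {a..b}"
  shows "\<exists>\<xi>\<in>{a..b}. divided_difference m x (poly g) = coeff (taylor_poly g \<xi>) m"
proof -
  define L where "L i = (\<Prod>j\<in>{..m} - {i}. [:- x j, 1:])" for i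
  define w where "w i = poly g (x i) / (\<Prod>j\<in>{..m} - {i}. x i - x j)" for i
  define R where "R = (\<Sum>i\<le>m. smult (w i) (L i))"
  have L: "degree (L i) = m" "coeff (L i) m = 1" if "i \<le> m" for i
    using degree_linear_factors[of "{..m} - {i}" x] coeff_linear_factors[of "{..m} - {i}" x] that
    by (simp_all add: L_def)
  have R: "degree R \<le> m"
    unfolding R_def by (intro degree_sum_le) (auto intro!: order_trans[OF degree_smult_le] simp: L)
  have coeff_R: "coeff R m = divided_difference m x (poly g)"
    by (auto simp: R_def w_def divided_difference_def coeff_sum L intro!: sum.cong)
  have "poly (g - R) (x k) = 0" if k: "k \<le> m" for k
  proof -
    have "poly (L i) (x k) = (if i = k then (\<Prod>j\<in>{..m} - {k}. x k - x j) else 0)" if "i \<le> m" for i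
      using k by (auto simp: L_def poly_prod)
    then have "poly R (x k) = (\<Sum>i\<le>m. if i = k then w k * (\<Prod>j\<in>{..m} - {k}. x k - x j) else 0)"
      unfolding R_def poly_sum by (intro sum.cong) simp_all
    also have "\<dots> = poly g (x k)"
    proof -
      have "(\<Prod>j\<in>{..m} - {k}. x k - x j) \<noteq> 0" using inj k by (auto simp: inj_on_def)
      then show ?thesis using k by (simp add: w_def)
    qed
    finally show ?thesis by simp
  qed
  then have "(\<Prod>i\<in>{..m}. [:- x i, 1:]) dvd g - R" by (intro linear_factors_dvd inj) auto
  then obtain Q where "g - R = (\<Prod>i\<in>{..m}. [:- x i, 1:]) * Q" by blast
  then have "g = R + (\<Prod>i\<in>{..m}. [:- x i, 1:]) * Q" by (simp add: algebra_simps)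
  from confluent_mean_value[OF _ _ _ this R, of a b] x
  obtain \<xi> where "\<xi> \<in> {a..b}" "coeff (taylor_poly g \<xi>) m = coeff R m" by auto
  then show ?thesis by (intro bexI[of _ \<xi>]) (simp_all add: coeff_R)
qed

lemma smooth_seq_poly_approx:
  assumes F: "smooth_seq m I F" and I: "{a..b} \<subseteq> I" and "a \<le> b" "0 < e"
  shows "\<exists>P. \<forall>k\<le>m. \<forall>x\<in>{a..b}. \<bar>F k x / fact k - coeff (taylor_poly P x) k\<bar> \<le> e"
proof -
  have "\<exists>P. \<forall>j\<le>m. \<forall>x\<in>{a..b}. \<bar>F j x - poly ((pderiv ^^ j) P) x\<bar> \<le> e"
  proof (rule weierstrass_poly_derivatives)
    fix j x assume "j < m" "x \<in> {a..b}"
    then have "(F j has_real_derivative F (Suc j) x) (at x)"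
      using F I unfolding smooth_seq_def by blast
    then show "(F j has_real_derivative F (Suc j) x) (at x within {a..b})"
      by (rule has_field_derivative_at_within)
  qed (use assms smooth_seq_continuous_on[OF F, of m] in \<open>auto intro: continuous_on_subset\<close>)
  then obtain P where P: "\<And>j x. j \<le> m \<Longrightarrow> x \<in> {a..b} \<Longrightarrow> \<bar>F j x - poly ((pderiv ^^ j) P) x\<bar> \<le> e"
    by blast
  have "\<bar>F k x / fact k - coeff (taylor_poly P x) k\<bar> \<le> e" if "k \<le> m" "x \<in> {a..b}" for k x
  proof -
    have "\<bar>F k x / fact k - coeff (taylor_poly P x) k\<bar> = \<bar>F k x - poly ((pderiv ^^ k) P) x\<bar> / fact k"
      by (simp add: coeff_taylor_poly diff_divide_distrib[symmetric])
    also have "\<dots> \<le> e / 1"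
      by (rule frac_le) (use P[OF that] assms(4) in auto)
    finally show ?thesis by simp
  qed
  then show ?thesis by blast
qed

lemma coeff_taylor_poly_bounded:
  "\<exists>B. \<forall>\<xi>\<in>{a..b}. \<forall>i. \<bar>coeff (taylor_poly q \<xi>) i\<bar> \<le> B"
proof -
  have "continuous_on {a..b} (\<lambda>\<xi>. \<Sum>i\<le>degree q. \<bar>coeff (taylor_poly q \<xi>) i\<bar>)"
    unfolding coeff_taylor_poly by (intro continuous_intros) auto
  then have "bounded ((\<lambda>\<xi>. \<Sum>i\<le>degree q. \<bar>coeff (taylor_poly q \<xi>) i\<bar>) ` {a..b})"
    by (intro compact_imp_bounded compact_continuous_image) auto
  then obtain B where B: "\<And>\<xi>. \<xi> \<in> {a..b} \<Longrightarrow> (\<Sum>i\<le>degree q. \<bar>coeff (taylor_poly q \<xi>) i\<bar>) \<le> B"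
    unfolding bounded_iff by fastforce
  have "\<bar>coeff (taylor_poly q \<xi>) i\<bar> \<le> B" if "\<xi> \<in> {a..b}" for \<xi> i
  proof (cases "i \<le> degree q")
    case True
    then have "\<bar>coeff (taylor_poly q \<xi>) i\<bar> \<le> (\<Sum>i\<le>degree q. \<bar>coeff (taylor_poly q \<xi>) i\<bar>)"
      by (intro member_le_sum) auto
    then show ?thesis using B[OF that] by linarith
  next
    case False
    then have "coeff (taylor_poly q \<xi>) i = 0" by (intro coeff_eq_0) (simp add: degree_taylor_poly)
    moreover have "0 \<le> B" by (rule order_trans[OF _ B[OF that]]) (simp add: sum_nonneg)
    ultimately show ?thesis by simp
  qed
  then show ?thesis by blast
qed

text \<open>For polynomials the divided difference is a Hankel form by the mean value theorem. A polynomial \<open>P\<close>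
that is \<open>e\<close>-close to \<open>F 0\<close> with its derivatives has almost nonnegative Hankel forms, and the error
vanishes with \<open>e\<close>; the bound \<open>B\<close> on the Taylor coefficients of \<open>q\<close> makes this uniform in the
intermediate point.\<close>

lemma divided_difference_nonneg_if_hankel:
  assumes F: "smooth_seq (2 * n) I F" and I: "convex I"
    and H: "\<And>x. x \<in> I \<Longrightarrow> hankel_nonneg n (\<lambda>k. F k x / fact k)"
    and q: "degree q < n" and inj: "inj_on x {..2 * n}" and x: "x ` {..2 * n} \<subseteq> I"
  shows "0 \<le> divided_difference (2 * n) x (\<lambda>t. F 0 t * (poly q t)\<^sup>2)"
proof -
  define a where "a = Min (x ` {..2 * n})"
  define b where "b = Max (x ` {..2 * n})"
  have ab: "a \<in> x ` {..2 * n}" "b \<in> x ` {..2 * n}"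
    unfolding a_def b_def by (rule Min_in Max_in; simp)+
  have xab: "x i \<in> {a..b}" if "i \<le> 2 * n" for i
    using that by (auto simp: a_def b_def)
  have le: "a \<le> b" using xab[of 0] by simp
  have sub: "{a..b} \<subseteq> I"
    using closed_segment_subset[of a I b] ab x I le by (auto simp: closed_segment_eq_real_ivl)
  obtain B where B: "\<And>\<xi> i. \<xi> \<in> {a..b} \<Longrightarrow> \<bar>coeff (taylor_poly q \<xi>) i\<bar> \<le> B"
    using coeff_taylor_poly_bounded[of a b q] by blast
  define W where "W = (\<Sum>i\<le>2 * n. \<bar>(poly q (x i))\<^sup>2 / (\<Prod>j\<in>{..2 * n} - {i}. x i - x j)\<bar>)"
  let ?D = "\<lambda>f. divided_difference (2 * n) x (\<lambda>t. f t * (poly q t)\<^sup>2)"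
  have "- (e * ((real n * B)\<^sup>2 + W)) \<le> ?D (F 0)" if e: "0 < e" for e
  proof -
    obtain P where P: "\<And>k x. k \<le> 2 * n \<Longrightarrow> x \<in> {a..b} \<Longrightarrow> \<bar>F k x / fact k - coeff (taylor_poly P x) k\<bar> \<le> e"
      using smooth_seq_poly_approx[OF F sub le e] by blast
    obtain \<xi> where \<xi>: "\<xi> \<in> {a..b}" "?D (poly P) = coeff (taylor_poly (P * q\<^sup>2) \<xi>) (2 * n)"
      using divided_difference_poly_mean_value[of x "2 * n" a b "P * q\<^sup>2", OF inj xab]
      unfolding poly_mult[abs_def] poly_power by blast
    have "- (e * (real n * B)\<^sup>2) \<le> coeff (taylor_poly P \<xi> * (taylor_poly q \<xi>)\<^sup>2) (2 * n)"
      by (rule coeff_mult_square_lower_bound[where T = "\<lambda>k. F k \<xi> / fact k"])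
        (use q B P H \<xi>(1) sub in \<open>auto simp: degree_taylor_poly\<close>)
    moreover have "taylor_poly (P * q\<^sup>2) \<xi> = taylor_poly P \<xi> * (taylor_poly q \<xi>)\<^sup>2"
      by (simp add: taylor_poly_mult power2_eq_square)
    ultimately have 1: "- (e * (real n * B)\<^sup>2) \<le> ?D (poly P)"
      by (simp only: \<xi>(2))
    have "?D (poly P) - ?D (F 0)
        = (\<Sum>i\<le>2 * n. (poly P (x i) - F 0 (x i)) * ((poly q (x i))\<^sup>2 / (\<Prod>j\<in>{..2 * n} - {i}. x i - x j)))"
      by (simp add: divided_difference_def sum_subtractf algebra_simps diff_divide_distrib)
    also have "\<dots> \<le> (\<Sum>i\<le>2 * n. e * \<bar>(poly q (x i))\<^sup>2 / (\<Prod>j\<in>{..2 * n} - {i}. x i - x j)\<bar>)"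
    proof (rule sum_mono)
      fix i assume "i \<in> {..2 * n}"
      then have "\<bar>F 0 (x i) - poly P (x i)\<bar> \<le> e" using P[of 0 "x i"] xab by (simp add: coeff_taylor_poly)
      then have "\<bar>(poly P (x i) - F 0 (x i)) * ((poly q (x i))\<^sup>2 / (\<Prod>j\<in>{..2 * n} - {i}. x i - x j))\<bar>
          \<le> e * \<bar>(poly q (x i))\<^sup>2 / (\<Prod>j\<in>{..2 * n} - {i}. x i - x j)\<bar>"
        unfolding abs_mult by (intro mult_right_mono) auto
      then show "(poly P (x i) - F 0 (x i)) * ((poly q (x i))\<^sup>2 / (\<Prod>j\<in>{..2 * n} - {i}. x i - x j))
          \<le> e * \<bar>(poly q (x i))\<^sup>2 / (\<Prod>j\<in>{..2 * n} - {i}. x i - x j)\<bar>" by linarith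
    qed
    also have "\<dots> = e * W" by (simp add: W_def sum_distrib_left)
    finally show ?thesis using 1 by (simp add: algebra_simps)
  qed
  then show ?thesis by (rule nonneg_if_ge_small_multiples)
qed

text \<open>Taylor's formula with the remainder \<open>o(h\<^sup>m)\<close>. The highest derivative at the intermediate point tends
to its value at \<open>x\<close> by continuity, so the Lagrange remainder of order \<open>m\<close> can be compared with the
term of order \<open>m\<close>.\<close>

lemma taylor_remainder_scaled:
  assumes F: "smooth_seq m I F" and I: "open I" and x: "x \<in> I" and m: "0 < m"
  shows "((\<lambda>h. (F 0 (x + h * y) - (\<Sum>k\<le>m. F k x / fact k * (h * y) ^ k)) / h ^ m) \<longlongrightarrow> 0) (at_right 0)"
proof -
  define E where "E s = F 0 (x + s) - (\<Sum>k\<le>m. F k x / fact k * s ^ k)" for s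
  obtain e where e: "0 < e" "ball x e \<subseteq> I" using I x by (rule openE)
  have "\<exists>t. \<bar>t - x\<bar> \<le> \<bar>s\<bar> \<and> E s = (F m t - F m x) / fact m * s ^ m" if s: "\<bar>s\<bar> < e" for s
  proof (cases "s = 0")
    case True
    then show ?thesis using m by (intro exI[of _ x]) (simp add: E_def power_0_left sum.atMost_shift)
  next
    case False
    have "\<exists>t. (if x + s < x then x + s < t \<and> t < x else x < t \<and> t < x + s) \<and>
        F 0 (x + s) = (\<Sum>k<m. (F k x / fact k) * (x + s - x) ^ k) + (F m t / fact m) * (x + s - x) ^ m"
    proof (rule Taylor[where a = "x - \<bar>s\<bar>" and b = "x + \<bar>s\<bar>" and diff = F and f = "F 0" and n = m])
      have "t \<in> I" if "x - \<bar>s\<bar> \<le> t" "t \<le> x + \<bar>s\<bar>" for t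
        by (rule subsetD[OF e(2)]) (use that s in \<open>auto simp: dist_real_def\<close>)
      then show "\<forall>k t. k < m \<and> x - \<bar>s\<bar> \<le> t \<and> t \<le> x + \<bar>s\<bar> \<longrightarrow> (F k has_real_derivative F (Suc k) t) (at t)"
        using F unfolding smooth_seq_def by blast
    qed (use m False in auto)
    then obtain t where t: "if x + s < x then x + s < t \<and> t < x else x < t \<and> t < x + s"
        "F 0 (x + s) = (\<Sum>k<m. F k x / fact k * s ^ k) + (F m t / fact m) * s ^ m"
      by auto
    from t(1) have "\<bar>t - x\<bar> \<le> \<bar>s\<bar>" by (auto split: if_splits)
    with t(2) show ?thesis
      by (intro exI[of _ t])
        (simp add: E_def lessThan_Suc_atMost[symmetric] diff_divide_distrib algebra_simps)
  qed
  then obtain t where t: "\<And>s. \<bar>s\<bar> < e \<Longrightarrow> \<bar>t s - x\<bar> \<le> \<bar>s\<bar>"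
      "\<And>s. \<bar>s\<bar> < e \<Longrightarrow> E s = (F m (t s) - F m x) / fact m * s ^ m"
    by metis
  have lim: "((\<lambda>h. h * y) \<longlongrightarrow> 0) (at_right 0)"
    by (auto intro!: tendsto_eq_intros)
  then have ev: "\<forall>\<^sub>F h in at_right 0. \<bar>h * y\<bar> < e"
    using e(1) by (auto simp: tendsto_iff dist_real_def)
  have "((\<lambda>h. t (h * y)) \<longlongrightarrow> x) (at_right 0)"
  proof (rule Lim_transform[OF tendsto_const])
    show "((\<lambda>h. t (h * y) - x) \<longlongrightarrow> 0) (at_right 0)"
    proof (rule Lim_null_comparison)
      show "\<forall>\<^sub>F h in at_right 0. norm (t (h * y) - x) \<le> \<bar>h * y\<bar>"
        using ev by eventually_elim (use t(1) in simp)
      show "((\<lambda>h. \<bar>h * y\<bar>) \<longlongrightarrow> 0) (at_right 0)"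
        using lim by (rule tendsto_rabs_zero)
    qed
  qed
  moreover have "isCont (F m) x"
    using F I x by (simp add: smooth_seq_def continuous_on_eq_continuous_at)
  ultimately have "((\<lambda>h. F m (t (h * y))) \<longlongrightarrow> F m x) (at_right 0)"
    by (rule isCont_tendsto_compose[rotated])
  then have "((\<lambda>h. (F m (t (h * y)) - F m x) / fact m * y ^ m) \<longlongrightarrow> 0) (at_right 0)"
    by (auto intro!: tendsto_eq_intros)
  moreover have "\<forall>\<^sub>F h in at_right 0. (F m (t (h * y)) - F m x) / fact m * y ^ m = E (h * y) / h ^ m"
    using ev eventually_at_right_less[of 0]
    by eventually_elim (simp add: t(2) power_mult_distrib)
  ultimately show ?thesis
    unfolding E_def by (rule Lim_transform_eventually)
qed

text \<open>The nodes \<open>x0, x0 + h, \<dots>, x0 + 2nh\<close> are pushed to \<open>x0\<close>. Replacing \<open>F 0\<close> by its Taylor polynomial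
\<open>T\<close> changes the divided difference by \<open>o(1)\<close>, since the denominators are of the order \<open>h\<^sup>2\<^sup>n\<close>, and the
divided difference of \<open>T q\<^sup>2\<close> tends to a Taylor coefficient of \<open>T q\<^sup>2\<close> at \<open>x0\<close>.\<close>

lemma hankel_if_divided_difference_nonneg:
  assumes F: "smooth_seq (2 * n) I F" and I: "open I" and x0: "x0 \<in> I" and n: "0 < n"
    and D: "\<And>q x. degree q < n \<Longrightarrow> inj_on x {..2 * n} \<Longrightarrow> x ` {..2 * n} \<subseteq> I
        \<Longrightarrow> 0 \<le> divided_difference (2 * n) x (\<lambda>t. F 0 t * (poly q t)\<^sup>2)"
  shows "hankel_nonneg n (\<lambda>k. F k x0 / fact k)"
  unfolding hankel_nonneg_def
proof
  fix c :: "nat \<Rightarrow> real"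
  let ?m = "2 * n"
  \<comment> \<open>The polynomial whose coefficients around x0 are the given vector, reversed as required by the Hankel form.\<close>
  define r where "r = (\<Sum>i<n. monom (c (n - Suc i)) i)"
  define q where "q = pcompose r [:- x0, 1:]"
  define S where "S = (\<Sum>k\<le>?m. monom (F k x0 / fact k) k)"
  define T where "T = pcompose S [:- x0, 1:]"
  have coeff_r: "coeff r i = (if i < n then c (n - Suc i) else 0)" for i
    by (auto simp: r_def coeff_sum)
  have dr: "degree r < n"
    using n by (intro degree_lessI) (auto simp: coeff_r)
  then have q: "degree q < n" by (simp add: q_def)
  have inv: "taylor_poly (pcompose p [:- x0, 1:]) x0 = p" for p
    by (simp add: taylor_poly_def pcompose_assoc[symmetric] pcompose_pCons)
  have C: "coeff (taylor_poly (T * q\<^sup>2) x0) ?m = (\<Sum>i<n. \<Sum>j<n. c i * c j * (F (i + j + 2) x0 / fact (i + j + 2)))"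
  proof -
    have "coeff (taylor_poly (T * q\<^sup>2) x0) ?m = coeff (S * r\<^sup>2) ?m"
      by (simp add: taylor_poly_mult power2_eq_square T_def q_def inv)
    also have "\<dots> = (\<Sum>i<n. \<Sum>j<n. c i * c j * (F (i + j + 2) x0 / fact (i + j + 2)))"
      unfolding coeff_mult_square[OF dr]
      by (intro sum.cong refl) (auto simp: coeff_r S_def coeff_sum)
    finally show ?thesis .
  qed
  define top where "top \<xi> = coeff (taylor_poly (T * q\<^sup>2) \<xi>) ?m" for \<xi>
  define x where "x h i = x0 + h * real i" for h i
  define E where "E s = F 0 (x0 + s) - poly T (x0 + s)" for s
  have E: "((\<lambda>h. E (h * y) / h ^ ?m) \<longlongrightarrow> 0) (at_right 0)" for y
    using taylor_remainder_scaled[OF F I x0, of y] n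
    by (simp add: E_def T_def S_def poly_pcompose poly_sum poly_monom)
  \<comment> \<open>The denominators of the divided difference, up to the factor h to the power 2n.\<close>
  define \<omega> where "\<omega> i = (\<Prod>j\<in>{..?m} - {i}. real i - real j)" for i
  define rest where "rest h = (\<Sum>i\<le>?m. E (h * real i) / h ^ ?m * ((poly q (x h i))\<^sup>2 / \<omega> i))" for h
  have split: "divided_difference ?m (x h) (\<lambda>t. F 0 t * (poly q t)\<^sup>2)
      = divided_difference ?m (x h) (poly (T * q\<^sup>2))
        + rest h" for h
  proof -
    have "(\<Prod>j\<in>{..?m} - {i}. x h i - x h j) = h ^ ?m * \<omega> i" if "i \<le> ?m" for i
    proof -
      have "(\<Prod>j\<in>{..?m} - {i}. x h i - x h j) = (\<Prod>j\<in>{..?m} - {i}. h * (real i - real j))"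
        by (simp add: x_def right_diff_distrib)
      also have "\<dots> = h ^ ?m * \<omega> i" using that by (simp add: prod.distrib \<omega>_def)
      finally show ?thesis .
    qed
    then show ?thesis
      unfolding divided_difference_def rest_def sum.distrib[symmetric]
      by (intro sum.cong refl) (simp add: E_def x_def[symmetric] ring_distribs add_divide_distrib[symmetric] diff_divide_distrib[symmetric])
  qed
  have inj: "inj_on (x h) {..?m}" if "0 < h" for h
    using that by (auto simp: inj_on_def x_def)
  have "\<forall>h. \<exists>\<xi>. 0 < h \<longrightarrow> \<xi> \<in> {x0..x0 + h * real ?m} \<and>
      divided_difference ?m (x h) (poly (T * q\<^sup>2)) = top \<xi>"
  proof
    fix h :: real
    show "\<exists>\<xi>. 0 < h \<longrightarrow> \<xi> \<in> {x0..x0 + h * real ?m} \<and>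
      divided_difference ?m (x h) (poly (T * q\<^sup>2)) = top \<xi>"
    proof (cases "0 < h")
      case True
      have "x h i \<in> {x0..x0 + h * real ?m}" if "i \<le> ?m" for i
        using that True by (simp add: x_def mult_left_mono)
      from divided_difference_poly_mean_value[OF inj[OF True] this, of "T * q\<^sup>2"] show ?thesis
        unfolding top_def by blast
    qed simp
  qed
  then obtain \<xi> where \<xi>: "\<And>h. 0 < h \<Longrightarrow> \<xi> h \<in> {x0..x0 + h * real ?m}"
      "\<And>h. 0 < h \<Longrightarrow> divided_difference ?m (x h) (poly (T * q\<^sup>2)) = top (\<xi> h)"
    by metis
  have "(\<xi> \<longlongrightarrow> x0) (at_right 0)"
  proof (rule tendsto_sandwich[OF _ _ tendsto_const])
    show "\<forall>\<^sub>F h in at_right 0. x0 \<le> \<xi> h" "\<forall>\<^sub>F h in at_right 0. \<xi> h \<le> x0 + h * real ?m"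
      using \<xi>(1) by (auto intro!: eventually_mono[OF eventually_at_right_less[of 0]])
    show "((\<lambda>h. x0 + h * real ?m) \<longlongrightarrow> x0) (at_right 0)"
      by (auto intro!: tendsto_eq_intros)
  qed
  then have "((\<lambda>h. top (\<xi> h)) \<longlongrightarrow> top x0) (at_right 0)"
    unfolding top_def coeff_taylor_poly by (intro tendsto_intros) auto
  moreover have "(rest \<longlongrightarrow>
      (\<Sum>i\<le>?m. 0 * ((poly q x0)\<^sup>2 / \<omega> i))) (at_right 0)"
    unfolding rest_def[abs_def]
  proof (intro tendsto_sum tendsto_mult E tendsto_divide tendsto_power tendsto_const)
    fix i assume "i \<in> {..?m}"
    show "\<omega> i \<noteq> 0" by (auto simp: \<omega>_def)
    have "((\<lambda>h. x h i) \<longlongrightarrow> x0) (at_right 0)" unfolding x_def by (auto intro!: tendsto_eq_intros)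
    then show "((\<lambda>h. poly q (x h i)) \<longlongrightarrow> poly q x0) (at_right 0)" by (intro tendsto_intros)
  qed
  ultimately have "((\<lambda>h. top (\<xi> h)
      + rest h)
      \<longlongrightarrow> top x0 + (\<Sum>i\<le>?m. 0 * ((poly q x0)\<^sup>2 / \<omega> i))) (at_right 0)"
    by (rule tendsto_add)
  moreover have "\<forall>\<^sub>F h in at_right 0. 0 \<le> top (\<xi> h)
      + rest h"
  proof -
    have "\<forall>\<^sub>F h in at_right 0. x h i \<in> I" for i
    proof -
      have "((\<lambda>h. x h i) \<longlongrightarrow> x0) (at_right 0)" unfolding x_def by (auto intro!: tendsto_eq_intros)
      then show ?thesis using I x0 by (rule topological_tendstoD)
    qed
    then have "\<forall>\<^sub>F h in at_right 0. \<forall>i\<in>{..?m}. x h i \<in> I"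
      by (intro eventually_ball_finite) auto
    then show ?thesis using eventually_at_right_less[of 0]
    proof eventually_elim
      case (elim h)
      have "0 \<le> divided_difference ?m (x h) (\<lambda>t. F 0 t * (poly q t)\<^sup>2)"
        by (rule D[OF q inj]) (use elim in auto)
      then show ?case using \<xi>(2)[OF elim(2)] split[of h] by simp
    qed
  qed
  ultimately have "0 \<le> top x0 + (\<Sum>i\<le>?m. 0 * ((poly q x0)\<^sup>2 / \<omega> i))"
    by (intro tendsto_lowerbound[where F = "at_right (0::real)"]) auto
  then show "0 \<le> (\<Sum>i<n. \<Sum>j<n. c i * c j * (F (i + j + 2) x0 / fact (i + j + 2)))"
    by (simp add: C top_def)
qed

section \<open>Orthonormal bases and the spectral theorem\<close>

definition cip :: "nat \<Rightarrow> (nat \<Rightarrow> complex) \<Rightarrow> (nat \<Rightarrow> complex) \<Rightarrow> complex" where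
  "cip n x y = (\<Sum>i<n. x i * cnj (y i))"

definition orthonormal :: "nat \<Rightarrow> (nat \<Rightarrow> nat \<Rightarrow> complex) \<Rightarrow> bool" where
  "orthonormal n u \<longleftrightarrow> (\<forall>k<n. \<forall>l<n. cip n (u k) (u l) = (if k = l then 1 else 0))"

text \<open>The vectors \<open>u k\<close> form an orthonormal basis of eigenvectors of \<open>A\<close>, with the real eigenvalues \<open>d k\<close>.
Vectors and matrices are functions on indices, of which only the values below \<open>n\<close> matter; this
makes it easy to differentiate them and to pass between dimensions.\<close>

definition spectral :: "nat \<Rightarrow> (nat \<Rightarrow> nat \<Rightarrow> complex) \<Rightarrow> (nat \<Rightarrow> nat \<Rightarrow> complex) \<Rightarrow> (nat \<Rightarrow> real) \<Rightarrow> bool" where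
  "spectral n A u d \<longleftrightarrow> orthonormal n u \<and>
     (\<forall>i<n. \<forall>j<n. A i j = (\<Sum>k<n. complex_of_real (d k) * u k i * cnj (u k j)))"

lemma cip_commute: "cip n x y = cnj (cip n y x)"
  by (simp add: cip_def mult.commute)

lemma cip_self: "cip n x x = complex_of_real (\<Sum>i<n. (cmod (x i))\<^sup>2)"
  by (simp add: cip_def complex_norm_square[symmetric] del: of_real_power)

lemma cip_add: "cip n (\<lambda>i. x i + y i) z = cip n x z + cip n y z"
  and cip_scale: "cip n (\<lambda>i. c * x i) z = c * cip n x z"
  and cip_scale_right: "cip n x (\<lambda>i. c * z i) = cnj c * cip n x z"
  by (simp_all add: cip_def sum.distrib sum_distrib_left algebra_simps)

lemma cip_cong:
  assumes "\<And>i. i < n \<Longrightarrow> x i = x' i" "\<And>i. i < n \<Longrightarrow> y i = y' i"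
  shows "cip n x y = cip n x' y'"
  unfolding cip_def by (intro sum.cong refl) (use assms in auto)

definition mat_app :: "nat \<Rightarrow> (nat \<Rightarrow> nat \<Rightarrow> complex) \<Rightarrow> (nat \<Rightarrow> complex) \<Rightarrow> nat \<Rightarrow> complex" where
  "mat_app n A x i = (\<Sum>j<n. A i j * x j)"

lemma cip_mat_app_hermitian:
  assumes A: "\<And>i j. i < n \<Longrightarrow> j < n \<Longrightarrow> A i j = cnj (A j i)"
  shows "cip n (mat_app n A x) y = cip n x (mat_app n A y)"
proof -
  have "cip n (mat_app n A x) y = (\<Sum>j<n. \<Sum>i<n. A i j * x j * cnj (y i))"
    unfolding cip_def mat_app_def sum_distrib_right by (rule sum.swap)
  also have "\<dots> = (\<Sum>j<n. \<Sum>i<n. cnj (A j i) * x j * cnj (y i))"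
    using A by (intro sum.cong refl) (metis lessThan_iff)
  also have "\<dots> = cip n x (mat_app n A y)"
    unfolding cip_def mat_app_def cnj_sum sum_distrib_left by (intro sum.cong refl) (simp add: mult_ac)
  finally show ?thesis .
qed

text \<open>A one-sided inverse of a square matrix is a two-sided one.\<close>

lemma orthonormal_complete:
  assumes u: "orthonormal n u" and "i < n" "j < n"
  shows "(\<Sum>k<n. u k i * cnj (u k j)) = (if i = j then 1 else 0)"
proof -
  define U where "U = mat n n (\<lambda>(i, k). u k i)"
  define V where "V = mat n n (\<lambda>(k, i). cnj (u k i))"
  have U: "U \<in> carrier_mat n n" and V: "V \<in> carrier_mat n n" by (auto simp: U_def V_def)
  have "V * U = 1\<^sub>m n"
  proof (rule eq_matI)
    fix k l assume kl: "k < dim_row (1\<^sub>m n)" "l < dim_col (1\<^sub>m n)"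
    have "(V * U) $$ (k, l) = cip n (u l) (u k)"
      using kl by (simp add: U_def V_def scalar_prod_def cip_def atLeast0LessThan mult.commute)
    then show "(V * U) $$ (k, l) = 1\<^sub>m n $$ (k, l)"
      using u kl by (auto simp: orthonormal_def)
  qed (use U V in auto)
  then have "U * V = 1\<^sub>m n" using mat_mult_left_right_inverse[OF V U] by simp
  then have "(U * V) $$ (i, j) = 1\<^sub>m n $$ (i, j)" by simp
  then show ?thesis
    using assms by (simp add: U_def V_def scalar_prod_def atLeast0LessThan)
qed

lemma orthonormal_expansion:
  assumes u: "orthonormal n u" and i: "i < n"
  shows "x i = (\<Sum>k<n. cip n x (u k) * u k i)"
proof -
  have "(\<Sum>k<n. cip n x (u k) * u k i) = (\<Sum>k<n. \<Sum>j<n. x j * (u k i * cnj (u k j)))"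
    by (simp add: cip_def sum_distrib_left sum_distrib_right mult_ac)
  also have "\<dots> = (\<Sum>j<n. x j * (\<Sum>k<n. u k i * cnj (u k j)))"
    by (subst sum.swap) (simp add: sum_distrib_left)
  also have "\<dots> = (\<Sum>j<n. if j = i then x j else 0)"
    by (intro sum.cong refl) (simp add: orthonormal_complete[OF u i])
  also have "\<dots> = x i" using i by simp
  finally show ?thesis by simp
qed

lemma orthonormal_Parseval:
  assumes u: "orthonormal n u"
  shows "cip n x y = (\<Sum>k<n. cip n x (u k) * cnj (cip n y (u k)))"
proof -
  have "cip n x y = (\<Sum>i<n. (\<Sum>k<n. cip n x (u k) * u k i) * cnj (y i))"
    unfolding cip_def[of n x y]
    by (intro sum.cong refl arg_cong2[where f = "(*)"] orthonormal_expansion[OF u]) auto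
  also have "\<dots> = (\<Sum>k<n. cip n x (u k) * (\<Sum>i<n. u k i * cnj (y i)))"
    unfolding sum_distrib_right sum_distrib_left by (subst sum.swap) (simp add: mult_ac)
  also have "\<dots> = (\<Sum>k<n. cip n x (u k) * cnj (cip n y (u k)))"
    by (simp add: cip_commute[of n y] ) (simp add: cip_def)
  finally show ?thesis .
qed

lemma spectral_eigenvector:
  assumes A: "spectral n A u d" and "k < n" "i < n"
  shows "(\<Sum>j<n. A i j * u k j) = complex_of_real (d k) * u k i"
proof -
  have u: "orthonormal n u" using A by (simp add: spectral_def)
  have "(\<Sum>j<n. A i j * u k j) = (\<Sum>j<n. \<Sum>l<n. complex_of_real (d l) * u l i * (u k j * cnj (u l j)))"
    using A \<open>i < n\<close> by (simp add: spectral_def sum_distrib_left sum_distrib_right mult_ac)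
  also have "\<dots> = (\<Sum>l<n. complex_of_real (d l) * u l i * cip n (u k) (u l))"
    by (subst sum.swap) (simp add: cip_def sum_distrib_left)
  also have "\<dots> = (\<Sum>l<n. if l = k then complex_of_real (d l) * u l i else 0)"
    using u \<open>k < n\<close> by (intro sum.cong refl) (auto simp: orthonormal_def)
  finally show ?thesis using \<open>k < n\<close> by simp
qed

lemma spectralI:
  assumes u: "orthonormal n u"
    and ev: "\<And>k i. k < n \<Longrightarrow> i < n \<Longrightarrow> (\<Sum>j<n. A i j * u k j) = complex_of_real (d k) * u k i"
  shows "spectral n A u d"
  unfolding spectral_def
proof (intro conjI allI impI u)
  fix i j assume i: "i < n" and j: "j < n"
  have "(\<Sum>k<n. complex_of_real (d k) * u k i * cnj (u k j)) = (\<Sum>k<n. (\<Sum>l<n. A i l * u k l) * cnj (u k j))"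
    using ev i by simp
  also have "\<dots> = (\<Sum>l<n. A i l * (\<Sum>k<n. u k l * cnj (u k j)))"
    unfolding sum_distrib_right sum_distrib_left by (subst sum.swap) (simp add: mult_ac)
  also have "\<dots> = (\<Sum>l<n. if l = j then A i l else 0)"
    using j by (intro sum.cong refl) (simp add: orthonormal_complete[OF u])
  finally show "A i j = (\<Sum>k<n. complex_of_real (d k) * u k i * cnj (u k j))"
    using j by simp
qed

lemma spectral_hermitian:
  assumes "spectral n A u d" "i < n" "j < n"
  shows "A i j = cnj (A j i)"
  using assms by (simp add: spectral_def mult_ac)

lemma cip_mat_app_spectral:
  assumes A: "spectral n A u d" and k: "k < n"
  shows "cip n (mat_app n A x) (u k) = complex_of_real (d k) * cip n x (u k)"
proof -
  have "cip n (mat_app n A x) (u k) = cip n x (mat_app n A (u k))"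
    by (rule cip_mat_app_hermitian) (rule spectral_hermitian[OF A])
  also have "\<dots> = cip n x (\<lambda>i. complex_of_real (d k) * u k i)"
    by (rule cip_cong) (simp_all add: mat_app_def spectral_eigenvector[OF A k])
  finally show ?thesis by (simp add: cip_scale_right)
qed

lemma spectral_quadratic_form:
  assumes A: "\<And>i j. i < n \<Longrightarrow> j < n \<Longrightarrow> A i j = (\<Sum>k<n. complex_of_real (d k) * u k i * cnj (u k j))"
  shows "(\<Sum>i<n. \<Sum>j<n. A i j * v j * cnj (v i)) = complex_of_real (\<Sum>k<n. d k * (cmod (cip n v (u k)))\<^sup>2)"
proof -
  have "(\<Sum>i<n. \<Sum>j<n. A i j * v j * cnj (v i))
      = (\<Sum>i<n. \<Sum>j<n. \<Sum>k<n. complex_of_real (d k) * (v j * cnj (u k j)) * (u k i * cnj (v i)))"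
    by (simp add: A sum_distrib_left sum_distrib_right mult_ac)
  also have "\<dots> = (\<Sum>i<n. \<Sum>k<n. \<Sum>j<n. complex_of_real (d k) * (v j * cnj (u k j)) * (u k i * cnj (v i)))"
    by (intro sum.cong refl sum.swap)
  also have "\<dots> = (\<Sum>k<n. complex_of_real (d k) * ((\<Sum>j<n. v j * cnj (u k j)) * (\<Sum>i<n. u k i * cnj (v i))))"
    by (subst sum.swap) (simp add: sum_product sum_distrib_left mult_ac)
  also have "\<dots> = (\<Sum>k<n. complex_of_real (d k) * (cip n v (u k) * cnj (cip n v (u k))))"
    by (simp add: cip_def mult.commute)
  also have "\<dots> = complex_of_real (\<Sum>k<n. d k * (cmod (cip n v (u k)))\<^sup>2)"
    by (simp add: complex_norm_square[symmetric] del: of_real_power)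
  finally show ?thesis .
qed

text \<open>A Householder reflection \<open>W\<close> that exchanges, up to a phase, the first unit vector and \<open>v\<close>; its
rows form an orthonormal basis. The mirror is orthogonal to \<open>p = v + s e\<^sub>0\<close>.\<close>

lemma orthonormal_extend:
  assumes n: "0 < n" and v: "cip n v v = 1"
  shows "\<exists>w. orthonormal n w \<and> (\<forall>i<n. w 0 i = v i)"
proof -
  \<comment> \<open>The phase of the first entry of v; this choice avoids cancellation, so that p does not vanish.\<close>
  define s where "s = (if v 0 = 0 then 1 else v 0 / complex_of_real (cmod (v 0)))"
  define r where "r = complex_of_real (cmod (v 0))"
  have s: "s * cnj s = 1" "v 0 = s * r" "cnj (v 0) = cnj s * r"
    by (auto simp: s_def r_def complex_norm_square[symmetric] power2_eq_square norm_divide)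
  have "1 + cmod (v 0) \<noteq> 0" using norm_ge_zero[of "v 0"] by linarith
  then have "complex_of_real (1 + cmod (v 0)) \<noteq> 0" by (simp only: of_real_eq_0_iff not_False_eq_True)
  then have r: "1 + r \<noteq> 0" "cnj r = r" by (simp_all add: r_def)
  define p where "p i = v i + (if i = 0 then s else 0)" for i
  \<comment> \<open>This is 2 divided by the squared norm of p.\<close>
  define \<beta> where "\<beta> = 1 / (1 + r)"
  have \<beta>: "\<beta> * (1 + r) = 1" "cnj \<beta> = \<beta>" using r by (auto simp: \<beta>_def)
  have pp: "cip n p p = 2 * (1 + r)"
  proof -
    have "cip n p p = (\<Sum>i<n. v i * cnj (v i) + (if i = 0 then v i * cnj s + s * cnj (v i) + s * cnj s else 0))"
      unfolding cip_def by (intro sum.cong refl) (auto simp: p_def algebra_simps)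
    also have "\<dots> = 1 + (v 0 * cnj s + s * cnj (v 0) + s * cnj s)"
      using n v by (simp add: sum.distrib cip_def)
    also have "\<dots> = 1 + (s * cnj s) * r + (s * cnj s) * r + s * cnj s"
      by (subst s(2), subst s(3)) (simp add: algebra_simps)
    finally show ?thesis by (simp add: s(1))
  qed
  define W where "W k i = (if i = k then 1 else 0) - \<beta> * p i * cnj (p k)" for k i
  have W: "orthonormal n W"
    unfolding orthonormal_def
  proof (intro allI impI)
    fix k l assume kl: "k < n" "l < n"
    have "cip n (W k) (W l) = (\<Sum>i<n. (if i = k then if i = l then 1 else 0 else 0)
        - (if i = k then \<beta> * cnj (p i) * p l else 0) - (if i = l then \<beta> * p i * cnj (p k) else 0)
        + \<beta> * \<beta> * cnj (p k) * p l * (p i * cnj (p i)))"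
      unfolding cip_def W_def using \<beta>(2) by (intro sum.cong refl) (auto simp: algebra_simps)
    also have "\<dots> = (if k = l then 1 else 0) - \<beta> * cnj (p k) * p l - \<beta> * p l * cnj (p k)
        + \<beta> * \<beta> * cnj (p k) * p l * cip n p p"
      using kl by (simp add: sum.distrib sum_subtractf sum_distrib_left cip_def)
    also have "\<dots> = (if k = l then 1 else 0) - 2 * \<beta> * cnj (p k) * p l * (1 - \<beta> * (1 + r))"
      by (simp add: pp algebra_simps)
    finally show "cip n (W k) (W l) = (if k = l then 1 else 0)" using \<beta>(1) by simp
  qed
  have v_eq: "v i = - s * W 0 i" for i
  proof -
    have "\<beta> * cnj (p 0) = cnj s * (\<beta> * (1 + r))"
      by (simp add: p_def s(3)) (simp add: algebra_simps)
    then have "\<beta> * cnj (p 0) = cnj s" using \<beta>(1) by simp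
    then have W0: "W 0 i = (if i = 0 then 1 else 0) - p i * cnj s"
      by (simp add: W_def mult.assoc mult.left_commute[of \<beta>])
    have "- s * W 0 i = (s * cnj s) * v i + (if i = 0 then (s * cnj s) * s - s else 0)"
      unfolding W0 by (simp add: p_def algebra_simps)
    then show ?thesis by (simp add: s(1))
  qed
  define w where "w k i = (if k = 0 then - s else 1) * W k i" for k i
  have "cip n (w k) (w l) = (if k = 0 then - s else 1) * cnj (if l = 0 then - s else 1) * cip n (W k) (W l)" for k l
    unfolding cip_def w_def sum_distrib_left by (simp add: mult_ac)
  then have "orthonormal n w"
    using W s(1) by (auto simp: orthonormal_def)
  moreover have "w 0 i = v i" for i using v_eq[of i] by (simp add: w_def)
  ultimately show ?thesis by blast
qed

lemma ex_unit_eigenvector: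
  assumes "0 < n"
  shows "\<exists>v z. cip n v v = 1 \<and> (\<forall>i<n. (\<Sum>j<n. A i j * v j) = z * v i)"
proof -
  define M where "M = mat n n (\<lambda>(i, j). A i j)"
  have M: "M \<in> carrier_mat n n" by (simp add: M_def)
  obtain z where "eigenvalue M z"
    using spectrum_non_empty[OF M assms] by (auto simp: spectrum_def)
  then obtain x where x: "x \<in> carrier_vec n" "x \<noteq> 0\<^sub>v n" "M *\<^sub>v x = z \<cdot>\<^sub>v x"
    using M by (auto simp: eigenvalue_def eigenvector_def)
  have ev: "(\<Sum>j<n. A i j * x $ j) = z * x $ i" if "i < n" for i
    using arg_cong[OF x(3), of "\<lambda>y. y $ i"] that x(1)
    by (simp add: M_def scalar_prod_def atLeast0LessThan)
  define N where "N = (\<Sum>i<n. (cmod (x $ i))\<^sup>2)"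
  have "N > 0"
  proof -
    obtain i where "i < n" "x $ i \<noteq> 0" using x(1,2) by (auto simp: vec_eq_iff)
    then show ?thesis unfolding N_def by (intro sum_pos2[of _ i]) auto
  qed
  define c where "c = complex_of_real (1 / sqrt N)"
  have "cip n (\<lambda>i. c * x $ i) (\<lambda>i. c * x $ i) = c * cnj c * cip n (\<lambda>i. x $ i) (\<lambda>i. x $ i)"
    by (simp add: cip_def sum_distrib_left mult_ac)
  also have "\<dots> = complex_of_real (1 / sqrt N * (1 / sqrt N) * N)"
    unfolding cip_self N_def[symmetric] c_def
    by (simp only: complex_cnj_complex_of_real of_real_mult)
  also have "1 / sqrt N * (1 / sqrt N) * N = 1" using \<open>N > 0\<close> by (simp add: field_simps)
  also have "complex_of_real 1 = 1" by simp
  finally have 1: "cip n (\<lambda>i. c * x $ i) (\<lambda>i. c * x $ i) = 1" .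
  have "(\<Sum>j<n. A i j * (c * x $ j)) = z * (c * x $ i)" if "i < n" for i
  proof -
    have "(\<Sum>j<n. A i j * (c * x $ j)) = c * (\<Sum>j<n. A i j * x $ j)"
      by (simp add: sum_distrib_left mult_ac)
    then show ?thesis by (simp add: ev[OF that])
  qed
  with 1 show ?thesis by blast
qed

text \<open>Split off a unit eigenvector \<open>v\<close> and extend it to an orthonormal basis \<open>w\<close>. In this basis \<open>A\<close> maps
the span of the remaining vectors to itself, and the induction hypothesis applies to the matrix of
the restriction.\<close>

theorem spectral_theorem:
  assumes "\<And>i j. i < n \<Longrightarrow> j < n \<Longrightarrow> A i j = cnj (A j i)"
  shows "\<exists>u d. spectral n A u d"
  using assms
proof (induction n arbitrary: A)
  case 0
  then show ?case by (auto simp: spectral_def orthonormal_def)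
next
  case (Suc n)
  obtain v z where v: "cip (Suc n) v v = 1" "\<And>i. i < Suc n \<Longrightarrow> (\<Sum>j<Suc n. A i j * v j) = z * v i"
    using ex_unit_eigenvector[of "Suc n" A] by blast
  have adj: "cip (Suc n) (\<lambda>i. \<Sum>j<Suc n. A i j * x j) y = cip (Suc n) x (\<lambda>i. \<Sum>j<Suc n. A i j * y j)" for x y
    using cip_mat_app_hermitian[of "Suc n" A x y, OF Suc.prems] unfolding mat_app_def[abs_def] .
  have "z = cip (Suc n) (\<lambda>i. \<Sum>j<Suc n. A i j * v j) v"
    using v cip_scale[of "Suc n" z v v] cip_cong[of "Suc n" "\<lambda>i. \<Sum>j<Suc n. A i j * v j" "\<lambda>i. z * v i" v v] by simp
  also have "\<dots> = cnj z"
    unfolding adj using v cip_scale_right[of "Suc n" v z v] cip_cong[of "Suc n" v v "\<lambda>i. \<Sum>j<Suc n. A i j * v j" "\<lambda>i. z * v i"] by simp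
  finally have "z = cnj z" .
  then obtain e where z: "z = complex_of_real e"
    by (metis Reals_cases Reals_cnj_iff)
  obtain w where w: "orthonormal (Suc n) w" "\<And>i. i < Suc n \<Longrightarrow> w 0 i = v i"
    using orthonormal_extend[OF _ v(1)] by blast
  define Aw where "Aw k i = (\<Sum>j<Suc n. A i j * w k j)" for k i
  have Aw0: "Aw 0 i = z * w 0 i" if "i < Suc n" for i
    using v(2)[OF that] w(2) that by (simp add: Aw_def)
  define B where "B i j = cip (Suc n) (Aw j) (w i)" for i j
  have B_herm: "B i j = cnj (B j i)" for i j
    using adj[of "w j" "w i"] cip_commute[of "Suc n" "w j" "Aw i"] by (simp add: B_def Aw_def[abs_def])
  have B0: "B 0 (Suc j) = 0" if "j < n" for j
  proof -
    have "B 0 (Suc j) = cip (Suc n) (w (Suc j)) (Aw 0)" 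
      using adj[of "w (Suc j)" "w 0"] by (simp add: B_def Aw_def[abs_def])
    also have "\<dots> = cip (Suc n) (w (Suc j)) (\<lambda>i. z * w 0 i)" by (rule cip_cong) (simp_all add: Aw0)
    also have "\<dots> = 0" using w(1) that by (simp add: cip_scale_right orthonormal_def)
    finally show ?thesis .
  qed
  obtain u d where ud: "spectral n (\<lambda>i j. B (Suc i) (Suc j)) u d"
    using Suc.IH[of "\<lambda>i j. B (Suc i) (Suc j)"] B_herm by blast
  then have u: "orthonormal n u" by (simp add: spectral_def)
  define U where "U k i = (case k of 0 \<Rightarrow> w 0 i | Suc k \<Rightarrow> \<Sum>j<n. u k j * w (Suc j) i)" for k i
  define D where "D k = (case k of 0 \<Rightarrow> e | Suc k \<Rightarrow> d k)" for k
  have cip_comb: "cip (Suc n) (\<lambda>i. \<Sum>j<n. x j * w (Suc j) i) y = (\<Sum>j<n. x j * cip (Suc n) (w (Suc j)) y)" for x y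
    unfolding cip_def sum_distrib_right sum_distrib_left by (subst sum.swap) (simp add: mult_ac)
  have cip_U: "cip (Suc n) (U (Suc k)) y = (\<Sum>j<n. u k j * cip (Suc n) (w (Suc j)) y)" for k y
    by (simp only: U_def[abs_def] nat.case cip_comb)
  have US: "cip (Suc n) (U (Suc k)) (w (Suc l)) = u k l" if "l < n" for k l
  proof -
    have "cip (Suc n) (U (Suc k)) (w (Suc l)) = (\<Sum>j<n. if j = l then u k j else 0)"
      unfolding cip_U using w(1) that by (intro sum.cong refl) (auto simp: orthonormal_def)
    then show ?thesis using that by simp
  qed
  have U0: "cip (Suc n) (U (Suc k)) (w 0) = 0" for k
    unfolding cip_U using w(1) by (intro sum.neutral) (auto simp: orthonormal_def)
  have "orthonormal (Suc n) U"
    unfolding orthonormal_def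
  proof (intro allI impI)
    fix k l assume kl: "k < Suc n" "l < Suc n"
    have SS: "cip (Suc n) (U (Suc k')) (U (Suc l')) = (if k' = l' then 1 else 0)" if "k' < n" "l' < n" for k' l'
    proof -
      have "cip (Suc n) (U (Suc k')) (U (Suc l')) = cnj (\<Sum>j<n. u l' j * cip (Suc n) (w (Suc j)) (U (Suc k')))"
        by (subst cip_commute) (simp only: cip_U)
      also have "\<dots> = (\<Sum>j<n. u k' j * cnj (u l' j))"
        unfolding cnj_sum by (intro sum.cong refl) (simp add: US cip_commute[of _ "w (Suc _)"] mult.commute)
      also have "\<dots> = (if k' = l' then 1 else 0)" using u that by (simp add: orthonormal_def cip_def)
      finally show ?thesis .
    qed
    have "U 0 = w 0" by (simp add: U_def[abs_def])
    moreover have "cip (Suc n) (w 0) (U (Suc k')) = 0" for k'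
      by (subst cip_commute) (simp add: U0)
    ultimately show "cip (Suc n) (U k) (U l) = (if k = l then 1 else 0)"
      using kl SS U0 w(1) by (cases k; cases l) (simp_all add: orthonormal_def)
  qed
  moreover have "(\<Sum>j<Suc n. A i j * U k j) = complex_of_real (D k) * U k i" if k: "k < Suc n" and i: "i < Suc n" for k i
  proof (cases k)
    case 0
    then show ?thesis using Aw0[OF i] by (simp add: U_def D_def Aw_def z)
  next
    case (Suc k')
    have k': "k' < n" using k Suc by simp
    have expand: "Aw (Suc j) i = (\<Sum>l<n. B (Suc l) (Suc j) * w (Suc l) i)" if "j < n" for j
      using orthonormal_expansion[OF w(1) i, of "Aw (Suc j)"] B0[OF that]
      by (simp add: B_def[symmetric] sum.lessThan_Suc_shift del: sum.lessThan_Suc)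
    have "(\<Sum>j<Suc n. A i j * U k j) = (\<Sum>j<n. u k' j * Aw (Suc j) i)"
    proof -
      have "(\<Sum>j<Suc n. A i j * U k j) = (\<Sum>j<Suc n. \<Sum>l<n. u k' l * (A i j * w (Suc l) j))"
        unfolding Suc U_def nat.case sum_distrib_left by (simp only: mult.left_commute)
      also have "\<dots> = (\<Sum>l<n. u k' l * Aw (Suc l) i)"
        unfolding Aw_def sum_distrib_left by (rule sum.swap)
      finally show ?thesis .
    qed
    also have "\<dots> = (\<Sum>j<n. u k' j * (\<Sum>l<n. B (Suc l) (Suc j) * w (Suc l) i))"
      using expand by simp
    also have "\<dots> = (\<Sum>l<n. (\<Sum>j<n. B (Suc l) (Suc j) * u k' j) * w (Suc l) i)"
      unfolding sum_distrib_left sum_distrib_right by (subst sum.swap) (simp add: mult_ac)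
    also have "\<dots> = (\<Sum>l<n. (complex_of_real (d k') * u k' l) * w (Suc l) i)"
      by (intro sum.cong refl) (simp add: spectral_eigenvector[OF ud k'])
    also have "\<dots> = complex_of_real (D k) * U k i"
      by (simp add: D_def U_def Suc sum_distrib_left mult_ac)
    finally show ?thesis .
  qed
  ultimately have "spectral (Suc n) A U D" by (rule spectralI)
  then show ?case by blast
qed

section \<open>Matrix convexity as positivity of finite functionals\<close>

lemma mat_adjoint_index:
  assumes "A \<in> carrier_mat n m" "i < m" "j < n"
  shows "mat_adjoint (A :: complex mat) $$ (i, j) = cnj (A $$ (j, i))"
  using assms by (simp add: mat_adjoint_def mat_of_rows_def)

lemma mult_mat_index:
  assumes "A \<in> carrier_mat n m" "B \<in> carrier_mat m k" "i < n" "j < k"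
  shows "(A * B) $$ (i, j) = (\<Sum>l<m. A $$ (i, l) * B $$ (l, j))"
  using assms by (simp add: scalar_prod_def atLeast0LessThan)

definition basis_mat :: "nat \<Rightarrow> (nat \<Rightarrow> nat \<Rightarrow> complex) \<Rightarrow> complex mat" where
  "basis_mat n u = mat n n (\<lambda>(i, k). u k i)"

lemma basis_mat_carrier [simp]: "basis_mat n u \<in> carrier_mat n n"
  by (simp add: basis_mat_def)

lemma unitary_basis_mat:
  assumes u: "orthonormal n u"
  shows "basis_mat n u \<in> unitary_mats n"
proof -
  let ?U = "basis_mat n u"
  have "?U * mat_adjoint ?U = 1\<^sub>m n"
  proof (rule eq_matI)
    fix i j assume "i < dim_row (1\<^sub>m n)" "j < dim_col (1\<^sub>m n)"
    then have ij: "i < n" "j < n" by auto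
    have "(?U * mat_adjoint ?U) $$ (i, j) = (\<Sum>k<n. u k i * cnj (u k j))"
      unfolding mult_mat_index[OF basis_mat_carrier mat_adjoint_carrier[OF basis_mat_carrier] ij]
      by (intro sum.cong refl)
        (use ij in \<open>simp add: mat_adjoint_index[OF basis_mat_carrier], simp add: basis_mat_def\<close>)
    then show "(?U * mat_adjoint ?U) $$ (i, j) = 1\<^sub>m n $$ (i, j)"
      using orthonormal_complete[OF u ij] ij by simp
  qed (use carrier_matD[OF basis_mat_carrier[of n u]]
      carrier_matD[OF mat_adjoint_carrier[OF basis_mat_carrier[of n u]]] in simp_all)
  then show ?thesis
    using mat_mult_left_right_inverse[of ?U n "mat_adjoint ?U"]
    by (simp add: unitary_mats_def)
qed

lemma diagonalization_index:
  assumes "i < n" "j < n"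
  shows "(basis_mat n u * real_diag n d * mat_adjoint (basis_mat n u)) $$ (i, j)
    = (\<Sum>k<n. complex_of_real (d k) * u k i * cnj (u k j))"
proof -
  have "(basis_mat n u * real_diag n d * mat_adjoint (basis_mat n u)) $$ (i, j)
     = (\<Sum>k<n. (basis_mat n u * real_diag n d) $$ (i, k) * mat_adjoint (basis_mat n u) $$ (k, j))"
    by (rule mult_mat_index[OF mult_carrier_mat[OF basis_mat_carrier real_diag_carrier]
          mat_adjoint_carrier[OF basis_mat_carrier] assms])
  also have "\<dots> = (\<Sum>k<n. complex_of_real (d k) * u k i * cnj (u k j))"
    using assms by (intro sum.cong refl)
      (simp add: real_diag_def mat_diag_mult_right[OF basis_mat_carrier] mat_adjoint_index[of _ n n], simp add: basis_mat_def)
  finally show ?thesis .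
qed

lemma spectral_diagonalization:
  assumes A: "A \<in> carrier_mat n n" and s: "spectral n (\<lambda>i j. A $$ (i, j)) u d"
  shows "A = basis_mat n u * real_diag n d * mat_adjoint (basis_mat n u)"
proof (rule eq_matI)
  let ?D = "basis_mat n u * real_diag n d * mat_adjoint (basis_mat n u)"
  have D: "?D \<in> carrier_mat n n" by (simp add: mult_carrier_mat[of _ n n])
  fix i j assume "i < dim_row ?D" "j < dim_col ?D"
  then have ij: "i < n" "j < n" using D by auto
  then show "A $$ (i, j) = ?D $$ (i, j)"
    using s unfolding diagonalization_index[OF ij] spectral_def by blast
next
  have D: "basis_mat n u * real_diag n d * mat_adjoint (basis_mat n u) \<in> carrier_mat n n"
    by (simp add: mult_carrier_mat[of _ n n])
  show "dim_row A = dim_row (basis_mat n u * real_diag n d * mat_adjoint (basis_mat n u))"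
    "dim_col A = dim_col (basis_mat n u * real_diag n d * mat_adjoint (basis_mat n u))"
    using A carrier_matD[OF D] by auto
qed

lemma
  assumes A: "A \<in> carrier_mat n n" and s: "spectral n (\<lambda>i j. A $$ (i, j)) u d"
  shows mat_fun_carrier: "mat_fun n f A \<in> carrier_mat n n"
    and mat_fun_index: "i < n \<Longrightarrow> j < n \<Longrightarrow>
      mat_fun n f A $$ (i, j) = (\<Sum>k<n. complex_of_real (f (d k)) * u k i * cnj (u k j))"
proof -
  have "mat_fun n f A = basis_mat n u * real_diag n (\<lambda>k. f (d k)) * mat_adjoint (basis_mat n u)"
    using s by (subst spectral_diagonalization[OF A s], intro mat_fun_eq unitary_basis_mat)
      (simp add: spectral_def)
  then show "mat_fun n f A \<in> carrier_mat n n"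
    and "i < n \<Longrightarrow> j < n \<Longrightarrow>
      mat_fun n f A $$ (i, j) = (\<Sum>k<n. complex_of_real (f (d k)) * u k i * cnj (u k j))"
    by (simp_all add: diagonalization_index mult_carrier_mat[of _ n n])
qed

lemma hermitian_mats_iff:
  assumes "A \<in> carrier_mat n n"
  shows "A \<in> hermitian_mats n \<longleftrightarrow> (\<forall>i<n. \<forall>j<n. A $$ (i, j) = cnj (A $$ (j, i)))"
proof
  assume "A \<in> hermitian_mats n"
  then have "mat_adjoint A = A" by (simp add: hermitian_mats_def)
  then show "\<forall>i<n. \<forall>j<n. A $$ (i, j) = cnj (A $$ (j, i))"
    using mat_adjoint_index[OF assms] by metis
next
  assume *: "\<forall>i<n. \<forall>j<n. A $$ (i, j) = cnj (A $$ (j, i))"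
  have "mat_adjoint A = A"
  proof (rule eq_matI)
    fix i j assume "i < dim_row A" "j < dim_col A"
    then have ij: "i < n" "j < n" using assms by auto
    then have "A $$ (i, j) = cnj (A $$ (j, i))" using * by blast
    then show "mat_adjoint A $$ (i, j) = A $$ (i, j)"
      by (simp only: mat_adjoint_index[OF assms ij])
  qed (use carrier_matD[OF assms] carrier_matD[OF mat_adjoint_carrier[OF assms]] in simp_all)
  then show "A \<in> hermitian_mats n" using assms by (simp add: hermitian_mats_def)
qed

lemma eigenvalue_iff:
  assumes A: "A \<in> carrier_mat n n" and s: "spectral n (\<lambda>i j. A $$ (i, j)) u d"
  shows "eigenvalue A z \<longleftrightarrow> (\<exists>k<n. z = complex_of_real (d k))"
proof
  have u: "orthonormal n u" using s by (simp add: spectral_def)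
  assume "eigenvalue A z"
  then obtain v where v: "v \<in> carrier_vec n" "v \<noteq> 0\<^sub>v n" "A *\<^sub>v v = z \<cdot>\<^sub>v v"
    using A by (auto simp: eigenvalue_def eigenvector_def)
  have ev: "(\<Sum>j<n. A $$ (i, j) * v $ j) = z * v $ i" if "i < n" for i
    using arg_cong[OF v(3), of "\<lambda>y. y $ i"] that v(1) A
    by (simp add: scalar_prod_def atLeast0LessThan)
  have "\<exists>k<n. cip n (\<lambda>i. v $ i) (u k) \<noteq> 0"
  proof (rule ccontr)
    assume *: "\<not> ?thesis"
    have "v $ i = 0" if "i < n" for i
      using orthonormal_expansion[OF u that, of "\<lambda>i. v $ i"] * by simp
    then show False using v(1,2) by (auto simp: vec_eq_iff)
  qed
  then obtain k where k: "k < n" "cip n (\<lambda>i. v $ i) (u k) \<noteq> 0" by blast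
  have "z * cip n (\<lambda>i. v $ i) (u k) = cip n (mat_app n (\<lambda>i j. A $$ (i, j)) (\<lambda>i. v $ i)) (u k)"
    unfolding cip_scale[symmetric] by (rule cip_cong) (simp_all add: mat_app_def ev)
  also have "\<dots> = complex_of_real (d k) * cip n (\<lambda>i. v $ i) (u k)"
    by (rule cip_mat_app_spectral[OF s k(1)])
  finally have "z = complex_of_real (d k)" using k(2) by simp
  then show "\<exists>k<n. z = complex_of_real (d k)" using k(1) by blast
next
  assume "\<exists>k<n. z = complex_of_real (d k)"
  then obtain k where k: "k < n" "z = complex_of_real (d k)" by blast
  have "A *\<^sub>v vec n (u k) = z \<cdot>\<^sub>v vec n (u k)"
    using A spectral_eigenvector[OF s k(1)] k(2)
    by (intro eq_vecI) (auto simp: scalar_prod_def atLeast0LessThan)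
  moreover have "vec n (u k) \<noteq> 0\<^sub>v n"
  proof
    assume 0: "vec n (u k) = 0\<^sub>v n"
    have "u k i = 0" if "i < n" for i using arg_cong[OF 0, of "\<lambda>v. v $ i"] that by simp
    then have "cip n (u k) (u k) = 0" by (simp add: cip_def)
    then show False using s k(1) by (simp add: spectral_def orthonormal_def)
  qed
  ultimately show "eigenvalue A z"
    using A by (auto simp: eigenvalue_def eigenvector_def intro!: exI[of _ "vec n (u k)"])
qed

text \<open>The quadratic form of \<open>f(A)\<close> at \<open>v\<close> is \<open>\<Sum>\<^sub>k f(d\<^sub>k) |\<langle>v, u\<^sub>k\<rangle>|\<^sup>2\<close>: a finite functional of \<open>f\<close> with these
weights and the eigenvalues as nodes.\<close>

definition spectral_weight :: "nat \<Rightarrow> (nat \<Rightarrow> complex) \<Rightarrow> (nat \<Rightarrow> complex) \<Rightarrow> real" where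
  "spectral_weight n v w = (cmod (cip n v w))\<^sup>2"

abbreviation mat_comb ::
  "real \<Rightarrow> (nat \<Rightarrow> nat \<Rightarrow> complex) \<Rightarrow> (nat \<Rightarrow> nat \<Rightarrow> complex) \<Rightarrow> nat \<Rightarrow> nat \<Rightarrow> complex" where
  "mat_comb t A B \<equiv> \<lambda>i j. complex_of_real t * A i j + complex_of_real (1 - t) * B i j"

text \<open>The functional \<open>f \<mapsto> \<langle>(t f(A) + (1 - t) f(B) - f(t A + (1 - t) B)) v, v\<rangle>\<close>, given by spectral
decompositions of the three matrices.\<close>

definition convexity_functional ::
  "nat \<Rightarrow> real \<Rightarrow> (nat \<Rightarrow> complex) \<Rightarrow> (nat \<Rightarrow> nat \<Rightarrow> complex) \<Rightarrow> (nat \<Rightarrow> real)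
    \<Rightarrow> (nat \<Rightarrow> nat \<Rightarrow> complex) \<Rightarrow> (nat \<Rightarrow> real)
    \<Rightarrow> (nat \<Rightarrow> nat \<Rightarrow> complex) \<Rightarrow> (nat \<Rightarrow> real) \<Rightarrow> (real \<times> real) list" where
  "convexity_functional n t v u d u' d' w e =
     map (\<lambda>k. (t * spectral_weight n v (u k), d k)) [0..<n] @
     map (\<lambda>k. ((1 - t) * spectral_weight n v (u' k), d' k)) [0..<n] @
     map (\<lambda>k. (- spectral_weight n v (w k), e k)) [0..<n]"

definition convexity_functionals :: "nat \<Rightarrow> (real \<times> real) list set" where
  "convexity_functionals n = {convexity_functional n t v u d u' d' w e | t v u d u' d' w e.
     t \<in> {0..1} \<and> (\<exists>A B. spectral n A u d \<and> spectral n B u' d' \<and>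
       spectral n (mat_comb t A B) w e)}"

lemma wsum_convexity_functional:
  "wsum (convexity_functional n t v u d u' d' w e) f =
     t * (\<Sum>k<n. f (d k) * spectral_weight n v (u k))
     + (1 - t) * (\<Sum>k<n. f (d' k) * spectral_weight n v (u' k))
     - (\<Sum>k<n. f (e k) * spectral_weight n v (w k))"
  by (simp add: convexity_functional_def wsum_append wsum_upt sum_distrib_left sum_negf mult_ac)

lemma nodes_convexity_functional:
  "snd ` set (convexity_functional n t v u d u' d' w e) = d ` {..<n} \<union> d' ` {..<n} \<union> e ` {..<n}"
  by (simp add: convexity_functional_def image_Un image_image atLeast0LessThan Un_assoc)

lemma convexity_functionalsI:
  assumes "spectral n A u d" "spectral n B u' d'" "t \<in> {0..1}"
    and "spectral n (mat_comb t A B) w e"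
  shows "convexity_functional n t v u d u' d' w e \<in> convexity_functionals n"
  unfolding convexity_functionals_def using assms by blast

lemma spectral_translate:
  assumes A: "spectral n A u d"
  shows "spectral n (\<lambda>i j. A i j + (if i = j then complex_of_real s else 0)) u (\<lambda>k. d k + s)"
proof (rule spectralI)
  fix k i assume "k < n" "i < n"
  then show "(\<Sum>j<n. (A i j + (if i = j then complex_of_real s else 0)) * u k j)
      = complex_of_real (d k + s) * u k i"
    using spectral_eigenvector[OF A, of k i]
    by (simp add: ring_distribs sum.distrib if_distrib[of "\<lambda>x. x * _"] cong: if_cong)
qed (use A in \<open>simp add: spectral_def\<close>)

lemma spectral_cong:
  assumes "\<And>i j. i < n \<Longrightarrow> j < n \<Longrightarrow> A i j = B i j"
  shows "spectral n A u d \<longleftrightarrow> spectral n B u d"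
  using assms by (simp add: spectral_def)

text \<open>Adding \<open>s\<close> to both matrices adds \<open>s\<close> to all eigenvalues and leaves the eigenvectors unchanged.\<close>

lemma translation_invariant_convexity_functionals:
  "translation_invariant (convexity_functionals n)"
  unfolding translation_invariant_def
proof (intro ballI allI)
  fix l and s :: real assume "l \<in> convexity_functionals n"
  then obtain t v u d u' d' w e A B where l: "l = convexity_functional n t v u d u' d' w e"
    and t: "t \<in> {0..1}"
    and sp: "spectral n A u d" "spectral n B u' d'"
      "spectral n (mat_comb t A B) w e"
    unfolding convexity_functionals_def by blast
  let ?T = "\<lambda>A i j. A i j + (if i = j then complex_of_real s else 0)"
  have "spectral n (\<lambda>i j. complex_of_real t * ?T A i j + complex_of_real (1 - t) * ?T B i j) w (\<lambda>k. e k + s)"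
    using spectral_translate[OF sp(3), of s] by (rule spectral_cong[THEN iffD1, rotated]) (auto simp: algebra_simps)
  then have "convexity_functional n t v u (\<lambda>k. d k + s) u' (\<lambda>k. d' k + s) w (\<lambda>k. e k + s) \<in> convexity_functionals n"
    using t spectral_translate[OF sp(1), of s] spectral_translate[OF sp(2), of s]
    unfolding convexity_functionals_def by blast
  then show "map (\<lambda>(w, x). (w, x + s)) l \<in> convexity_functionals n"
    by (simp add: l convexity_functional_def comp_def)
qed

text \<open>An eigenvalue of the convex combination is a value of its Rayleigh quotient, hence a convex
combination of Rayleigh quotients of \<open>A\<close> and \<open>B\<close>, and these are averages of eigenvalues.\<close>

lemma spectral_convex_combination_mem:
  assumes A: "spectral n A u d" and B: "spectral n B u' d'"
    and C: "spectral n (mat_comb t A B) w e"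
    and I: "convex I" and t: "t \<in> {0..1}"
    and d: "\<And>k. k < n \<Longrightarrow> d k \<in> I" "\<And>k. k < n \<Longrightarrow> d' k \<in> I" and k: "k < n"
  shows "e k \<in> I"
proof -
  have w: "cip n (w k) (w k) = 1" using C k by (simp add: spectral_def orthonormal_def)
  define q where "q M = (\<Sum>i<n. \<Sum>j<n. M i j * w k j * cnj (w k i))" for M :: "nat \<Rightarrow> nat \<Rightarrow> complex"
  have rayleigh: "\<exists>y\<in>I. q M = complex_of_real y"
    if M: "spectral n M x D" and D: "\<And>l. l < n \<Longrightarrow> D l \<in> I" for M x D
  proof -
    have x: "orthonormal n x" using M by (simp add: spectral_def)
    have "complex_of_real (\<Sum>l<n. (cmod (cip n (w k) (x l)))\<^sup>2) = 1"
      using orthonormal_Parseval[OF x, of "w k" "w k"] w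
      by (simp add: complex_norm_square[symmetric] del: of_real_power)
    then have "(\<Sum>l<n. (cmod (cip n (w k) (x l)))\<^sup>2) = 1" using of_real_eq_1_iff by blast
    then have "(\<Sum>l<n. (cmod (cip n (w k) (x l)))\<^sup>2 *\<^sub>R D l) \<in> I"
      by (intro convex_sum I D) auto
    moreover have "q M = complex_of_real (\<Sum>l<n. D l * (cmod (cip n (w k) (x l)))\<^sup>2)"
      unfolding q_def by (rule spectral_quadratic_form) (use M in \<open>auto simp: spectral_def\<close>)
    ultimately show ?thesis by (intro bexI) (auto simp: mult.commute)
  qed
  obtain y z where y: "y \<in> I" "q A = complex_of_real y" and z: "z \<in> I" "q B = complex_of_real z"
    using rayleigh[OF A d(1)] rayleigh[OF B d(2)] by blast
  have "complex_of_real (e k) = (\<Sum>i<n. (complex_of_real (e k) * w k i) * cnj (w k i))"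
    using w by (simp add: cip_def mult.assoc flip: sum_distrib_left)
  also have "\<dots> = q (mat_comb t A B)"
    unfolding q_def by (intro sum.cong refl) (simp add: spectral_eigenvector[OF C k, symmetric] sum_distrib_right)
  also have "\<dots> = complex_of_real t * q A + complex_of_real (1 - t) * q B"
    by (simp add: q_def sum.distrib sum_distrib_left algebra_simps sum_subtractf)
  also have "\<dots> = complex_of_real (t * y + (1 - t) * z)" by (simp add: y z)
  finally have "e k = t * y + (1 - t) * z" using of_real_eq_iff by blast
  also have "\<dots> \<in> I" using I y(1) z(1) t unfolding convex_alt by (force simp: algebra_simps)
  finally show ?thesis .
qed

definition quad_mat :: "nat \<Rightarrow> complex mat \<Rightarrow> (nat \<Rightarrow> complex) \<Rightarrow> complex" where
  "quad_mat n M v = (\<Sum>i<n. \<Sum>j<n. M $$ (i, j) * v j * cnj (v i))"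

lemma psd_mat_iff: "psd_mat n M \<longleftrightarrow> M \<in> hermitian_mats n \<and> (\<forall>v. 0 \<le> quad_mat n M v)"
proof (cases "M \<in> hermitian_mats n")
  case True
  then have M: "M \<in> carrier_mat n n" by (simp add: hermitian_mats_def)
  have eq: "(M *\<^sub>v v) \<bullet>c v = quad_mat n M (\<lambda>i. v $ i)" if "v \<in> carrier_vec n" for v
    using that M by (simp add: quad_mat_def scalar_prod_def atLeast0LessThan sum_distrib_right)
  have "quad_mat n M v = quad_mat n M (\<lambda>i. vec n v $ i)" for v
    unfolding quad_mat_def by (intro sum.cong refl) auto
  then have "(\<forall>v\<in>carrier_vec n. 0 \<le> (M *\<^sub>v v) \<bullet>c v) \<longleftrightarrow> (\<forall>v. 0 \<le> quad_mat n M v)"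
    using eq by (metis vec_carrier)
  then show ?thesis by (simp add: psd_mat_def)
qed (simp add: psd_mat_def)

lemma quad_mat_convexity:
  assumes c: "A \<in> carrier_mat n n" "B \<in> carrier_mat n n" "C \<in> carrier_mat n n"
    and s: "spectral n (\<lambda>i j. A $$ (i, j)) u d" "spectral n (\<lambda>i j. B $$ (i, j)) u' d'"
      "spectral n (\<lambda>i j. C $$ (i, j)) w e"
  shows "quad_mat n (complex_of_real t \<cdot>\<^sub>m mat_fun n f A
        + complex_of_real (1 - t) \<cdot>\<^sub>m mat_fun n f B - mat_fun n f C) v
      = complex_of_real (wsum (convexity_functional n t v u d u' d' w e) f)"
proof -
  have q: "quad_mat n (mat_fun n f M) v = complex_of_real (\<Sum>k<n. f (D k) * spectral_weight n v (x k))"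
    if "M \<in> carrier_mat n n" "spectral n (\<lambda>i j. M $$ (i, j)) x D" for M x D
    unfolding quad_mat_def spectral_weight_def
    by (rule spectral_quadratic_form) (rule mat_fun_index[OF that])
  have "quad_mat n (complex_of_real t \<cdot>\<^sub>m mat_fun n f A
        + complex_of_real (1 - t) \<cdot>\<^sub>m mat_fun n f B - mat_fun n f C) v
      = complex_of_real t * quad_mat n (mat_fun n f A) v
        + complex_of_real (1 - t) * quad_mat n (mat_fun n f B) v - quad_mat n (mat_fun n f C) v"
    using mat_fun_carrier[OF c(1) s(1), of f] mat_fun_carrier[OF c(2) s(2), of f] mat_fun_carrier[OF c(3) s(3), of f]
    unfolding quad_mat_def sum_distrib_left sum.distrib[symmetric] sum_subtractf[symmetric]
    by (intro sum.cong refl) (simp add: algebra_simps)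
  then show ?thesis
    unfolding q[OF c(1) s(1)] q[OF c(2) s(2)] q[OF c(3) s(3)] wsum_convexity_functional by simp
qed

text \<open>Matrix convexity only involves quadratic forms, and the spectral theorem expresses these through
eigenvalues and eigenvectors.\<close>

theorem n_convex_iff:
  assumes I: "convex I"
  shows "n_convex n I f \<longleftrightarrow> nonneg_on (convexity_functionals n) I f"
proof
  assume nc: "n_convex n I f"
  show "nonneg_on (convexity_functionals n) I f"
    unfolding nonneg_on_def
  proof (intro ballI impI)
    fix l assume "l \<in> convexity_functionals n" and nodes: "snd ` set l \<subseteq> I"
    then obtain t v u d u' d' w e A B where l: "l = convexity_functional n t v u d u' d' w e"
      and t: "t \<in> {0..1}"
      and sp: "spectral n A u d" "spectral n B u' d'"
        "spectral n (mat_comb t A B) w e"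
      unfolding convexity_functionals_def by blast
    have d: "d k \<in> I" "d' k \<in> I" if "k < n" for k
      using nodes that unfolding l nodes_convexity_functional by auto
    define mA where "mA = mat n n (\<lambda>(i, j). A i j)"
    define mB where "mB = mat n n (\<lambda>(i, j). B i j)"
    define mC where "mC = complex_of_real t \<cdot>\<^sub>m mA + complex_of_real (1 - t) \<cdot>\<^sub>m mB"
    have c: "mA \<in> carrier_mat n n" "mB \<in> carrier_mat n n" "mC \<in> carrier_mat n n"
      by (auto simp: mA_def mB_def mC_def)
    have sA: "spectral n (\<lambda>i j. mA $$ (i, j)) u d"
      using sp(1) by (rule spectral_cong[THEN iffD1, rotated]) (simp add: mA_def)
    have sB: "spectral n (\<lambda>i j. mB $$ (i, j)) u' d'"
      using sp(2) by (rule spectral_cong[THEN iffD1, rotated]) (simp add: mB_def)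
    have sC: "spectral n (\<lambda>i j. mC $$ (i, j)) w e"
      using sp(3) by (rule spectral_cong[THEN iffD1, rotated]) (simp add: mC_def mA_def mB_def)
    have herm: "mA \<in> hermitian_mats n" "mB \<in> hermitian_mats n"
      using hermitian_mats_iff c spectral_hermitian[OF sA] spectral_hermitian[OF sB] by blast+
    have "loewner_le n (mat_fun n f mC)
        (complex_of_real t \<cdot>\<^sub>m mat_fun n f mA + complex_of_real (1 - t) \<cdot>\<^sub>m mat_fun n f mB)"
      using nc t herm d eigenvalue_iff[OF c(1) sA] eigenvalue_iff[OF c(2) sB]
      unfolding n_convex_def mC_def by (metis imageI)
    then have "0 \<le> quad_mat n (complex_of_real t \<cdot>\<^sub>m mat_fun n f mA
        + complex_of_real (1 - t) \<cdot>\<^sub>m mat_fun n f mB - mat_fun n f mC) v"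
      by (simp add: loewner_le_def psd_mat_iff)
    then show "0 \<le> wsum l f"
      unfolding l quad_mat_convexity[OF c sA sB sC] by (simp add: less_eq_complex_def)
  qed
next
  assume pos: "nonneg_on (convexity_functionals n) I f"
  show "n_convex n I f"
    unfolding n_convex_def
  proof (intro ballI impI)
    fix t :: real and A B
    assume t: "t \<in> {0..1}" and herm: "A \<in> hermitian_mats n" "B \<in> hermitian_mats n"
      and ev: "\<forall>z. eigenvalue A z \<longrightarrow> z \<in> complex_of_real ` I"
        "\<forall>z. eigenvalue B z \<longrightarrow> z \<in> complex_of_real ` I"
    define C where "C = complex_of_real t \<cdot>\<^sub>m A + complex_of_real (1 - t) \<cdot>\<^sub>m B"
    have c: "A \<in> carrier_mat n n" "B \<in> carrier_mat n n" "C \<in> carrier_mat n n"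
      using herm by (auto simp: hermitian_mats_def C_def)
    have hA: "A $$ (i, j) = cnj (A $$ (j, i))" if "i < n" "j < n" for i j
      using hermitian_mats_iff[OF c(1)] herm(1) that by blast
    have hB: "B $$ (i, j) = cnj (B $$ (j, i))" if "i < n" "j < n" for i j
      using hermitian_mats_iff[OF c(2)] herm(2) that by blast
    obtain u d where sA: "spectral n (\<lambda>i j. A $$ (i, j)) u d"
      using spectral_theorem[of n "\<lambda>i j. A $$ (i, j)"] hA by blast
    obtain u' d' where sB: "spectral n (\<lambda>i j. B $$ (i, j)) u' d'"
      using spectral_theorem[of n "\<lambda>i j. B $$ (i, j)"] hB by blast
    have hC: "C $$ (i, j) = cnj (C $$ (j, i))" if "i < n" "j < n" for i j
      using that c hA[OF that] hB[OF that] by (simp add: C_def)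
    obtain w e where sC: "spectral n (\<lambda>i j. C $$ (i, j)) w e"
      using spectral_theorem[of n "\<lambda>i j. C $$ (i, j)"] hC by blast
    have sC': "spectral n (\<lambda>i j. complex_of_real t * A $$ (i, j) + complex_of_real (1 - t) * B $$ (i, j)) w e"
      using sC by (rule spectral_cong[THEN iffD1, rotated]) (use c in \<open>simp add: C_def\<close>)
    have d: "d k \<in> I" "d' k \<in> I" if "k < n" for k
    proof -
      have "complex_of_real (d k) \<in> complex_of_real ` I" "complex_of_real (d' k) \<in> complex_of_real ` I"
        using ev that eigenvalue_iff[OF c(1) sA] eigenvalue_iff[OF c(2) sB] by blast+
      then show "d k \<in> I" "d' k \<in> I" by auto
    qed
    have e: "e k \<in> I" if "k < n" for k
      by (rule spectral_convex_combination_mem[OF sA sB sC' I t d that])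
    let ?M = "complex_of_real t \<cdot>\<^sub>m mat_fun n f A
        + complex_of_real (1 - t) \<cdot>\<^sub>m mat_fun n f B - mat_fun n f C"
    have "0 \<le> quad_mat n ?M v" for v
    proof -
      have nodes: "snd ` set (convexity_functional n t v u d u' d' w e) \<subseteq> I"
        unfolding nodes_convexity_functional using d e by auto
      have "convexity_functional n t v u d u' d' w e \<in> convexity_functionals n"
        unfolding convexity_functionals_def using t sA sB sC' by blast
      then have "0 \<le> wsum (convexity_functional n t v u d u' d' w e) f"
        using pos nodes unfolding nonneg_on_def by blast
      then show ?thesis unfolding quad_mat_convexity[OF c sA sB sC] by (simp add: less_eq_complex_def)
    qed
    moreover have "?M \<in> hermitian_mats n"
    proof (subst hermitian_mats_iff)
      have f: "mat_fun n f A \<in> carrier_mat n n" "mat_fun n f B \<in> carrier_mat n n"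
          "mat_fun n f C \<in> carrier_mat n n"
        by (rule mat_fun_carrier[OF c(1) sA] mat_fun_carrier[OF c(2) sB] mat_fun_carrier[OF c(3) sC])+
      then show "?M \<in> carrier_mat n n" by auto
      have h: "mat_fun n f M $$ (i, j) = cnj (mat_fun n f M $$ (j, i))"
        if "M \<in> carrier_mat n n" "spectral n (\<lambda>i j. M $$ (i, j)) x D" "i < n" "j < n" for M x D i j
        using that(3,4) by (simp add: mat_fun_index[OF that(1,2)] mult_ac)
      show "\<forall>i<n. \<forall>j<n. ?M $$ (i, j) = cnj (?M $$ (j, i))"
      proof (intro allI impI)
        fix i j assume ij: "i < n" "j < n"
        show "?M $$ (i, j) = cnj (?M $$ (j, i))"
          using f ij h[OF c(1) sA ij] h[OF c(2) sB ij] h[OF c(3) sC ij] by simp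
      qed
    qed
    ultimately show "loewner_le n (mat_fun n f (complex_of_real t \<cdot>\<^sub>m A + complex_of_real (1 - t) \<cdot>\<^sub>m B))
        (complex_of_real t \<cdot>\<^sub>m mat_fun n f A + complex_of_real (1 - t) \<cdot>\<^sub>m mat_fun n f B)"
      unfolding loewner_le_def psd_mat_iff C_def[symmetric] by blast
  qed
qed

section \<open>Second-order divided differences and Kraus's quadratic form\<close>

text \<open>The divided differences \<open>[a, b]\<close> and \<open>[a, b, c]\<close> of the power function \<open>z\<^sup>k\<close>, also for coinciding
nodes; the recursion is \<open>[a, \<dots>]\<^bsub>z g\<^esub> = a [a, \<dots>]\<^sub>g + [\<dots>]\<^sub>g\<close>.\<close>

fun power_dd2 :: "nat \<Rightarrow> real \<Rightarrow> real \<Rightarrow> real" where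
  "power_dd2 0 a b = 0"
| "power_dd2 (Suc k) a b = b ^ k + a * power_dd2 k a b"

fun power_dd3 :: "nat \<Rightarrow> real \<Rightarrow> real \<Rightarrow> real \<Rightarrow> real" where
  "power_dd3 0 a b c = 0"
| "power_dd3 (Suc k) a b c = power_dd2 k b c + a * power_dd3 k a b c"

definition poly_dd3 :: "real poly \<Rightarrow> real \<Rightarrow> real \<Rightarrow> real \<Rightarrow> real" where
  "poly_dd3 P a b c = (\<Sum>k\<le>degree P. coeff P k * power_dd3 k a b c)"

definition newton_quadratic :: "nat \<Rightarrow> real \<Rightarrow> real \<Rightarrow> real \<Rightarrow> real poly" where
  "newton_quadratic k a b c = [:c ^ k:] + smult (power_dd2 k b c) [:- c, 1:]
     + smult (power_dd3 k a b c) ([:- c, 1:] * [:- b, 1:])"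

text \<open>Newton's interpolation formula with the nodes \<open>c\<close>, \<open>b\<close>, \<open>a\<close>.\<close>

lemma newton_form_power:
  "\<exists>Q. monom 1 k = newton_quadratic k a b c + [:- a, 1:] * [:- b, 1:] * [:- c, 1:] * Q"
proof (induction k)
  case 0
  show ?case by (intro exI[of _ 0]) (simp add: newton_quadratic_def)
next
  case (Suc k)
  then obtain Q where Q: "monom 1 k = newton_quadratic k a b c + [:- a, 1:] * [:- b, 1:] * [:- c, 1:] * Q"
    by blast
  have m: "monom 1 (Suc k) = [:0, 1:] * (monom 1 k :: real poly)"
    by (simp add: monom_Suc)
  define x where "x = ([:0, 1:] :: real poly)"
  have lin: "[:- d, 1:] = x - [:d:]" for d by (simp add: x_def)
  have sm: "smult d p = [:d:] * p" for d and p :: "real poly" by simp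
  have pr: "[:c ^ Suc k:] = [:c:] * [:c ^ k:]" "[:power_dd2 (Suc k) b c:] = [:c ^ k:] + [:b:] * [:power_dd2 k b c:]"
    "[:power_dd3 (Suc k) a b c:] = [:power_dd2 k b c:] + [:a:] * [:power_dd3 k a b c:]" by simp_all
  have ring: "y * (E + G * (y - C) + K * ((y - C) * (y - B)) + (y - A) * (y - B) * (y - C) * R)
      = C * E + (E + B * G) * (y - C) + (G + A * K) * ((y - C) * (y - B))
        + (y - A) * (y - B) * (y - C) * (K + y * R)" for y A B C E G K R :: "real poly"
    by (simp add: algebra_simps)
  show ?case
  proof (intro exI[of _ "[:power_dd3 k a b c:] + x * Q"])
    show "monom 1 (Suc k) = newton_quadratic (Suc k) a b c
        + [:- a, 1:] * [:- b, 1:] * [:- c, 1:] * ([:power_dd3 k a b c:] + x * Q)"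
      unfolding m Q newton_quadratic_def sm lin pr x_def[symmetric] by (rule ring)
  qed
qed

lemma newton_form:
  "\<exists>r Q. P = r + [:- a, 1:] * [:- b, 1:] * [:- c, 1:] * Q \<and> degree r \<le> 2 \<and> coeff r 2 = poly_dd3 P a b c"
proof -
  define r where "r k = newton_quadratic k a b c" for k
  have "\<exists>Q. \<forall>k. monom 1 k = r k + [:- a, 1:] * [:- b, 1:] * [:- c, 1:] * Q k"
    unfolding r_def by (intro choice allI newton_form_power)
  then obtain Q where Q: "\<And>k. monom 1 k = r k + [:- a, 1:] * [:- b, 1:] * [:- c, 1:] * Q k" by blast
  have r: "degree (r k) \<le> 2" "coeff (r k) 2 = power_dd3 k a b c" for k
    by (auto simp: r_def newton_quadratic_def numeral_2_eq_2
        intro!: degree_add_le order_trans[OF degree_smult_le])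
  have "P = (\<Sum>k\<le>degree P. smult (coeff P k) (monom 1 k))"
    by (simp add: poly_as_sum_of_monoms smult_monom)
  also have "\<dots> = (\<Sum>k\<le>degree P. smult (coeff P k) (r k))
      + [:- a, 1:] * [:- b, 1:] * [:- c, 1:] * (\<Sum>k\<le>degree P. smult (coeff P k) (Q k))"
    unfolding Q smult_add_right sum.distrib sum_distrib_left by (simp only: mult_smult_right)
  finally have "P = (\<Sum>k\<le>degree P. smult (coeff P k) (r k))
      + [:- a, 1:] * [:- b, 1:] * [:- c, 1:] * (\<Sum>k\<le>degree P. smult (coeff P k) (Q k))" .
  moreover have "degree (\<Sum>k\<le>degree P. smult (coeff P k) (r k)) \<le> 2"
    by (intro degree_sum_le) (auto intro: order_trans[OF degree_smult_le] r)
  moreover have "coeff (\<Sum>k\<le>degree P. smult (coeff P k) (r k)) 2 = poly_dd3 P a b c"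
    by (simp add: coeff_sum r poly_dd3_def)
  ultimately show ?thesis by blast
qed

lemma coeff_mult_degree_le:
  assumes "degree p \<le> m" "degree q \<le> k"
  shows "coeff (p * q) (m + k) = coeff p m * coeff (q :: real poly) k"
proof (cases "degree p = m \<and> degree q = k")
  case True
  then show ?thesis using coeff_mult_degree_sum[of p q] by simp
next
  case False
  then have "degree (p * q) < m + k"
    using assms degree_mult_le[of p q] by linarith
  moreover have "coeff p m = 0 \<or> coeff q k = 0"
    using False assms by (auto intro: coeff_eq_0)
  ultimately show ?thesis by (auto simp: coeff_eq_0)
qed

text \<open>The numerator of the partial fraction \<open>\<Sum>\<^sub>i c\<^sub>i / (z - \<lambda>\<^sub>i)\<close>.\<close>

definition lagrange_comb :: "nat \<Rightarrow> (nat \<Rightarrow> real) \<Rightarrow> (nat \<Rightarrow> real) \<Rightarrow> real poly" where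
  "lagrange_comb n lam c = (\<Sum>i<n. smult (c i) (\<Prod>k\<in>{..<n} - {i}. [:- lam k, 1:]))"

text \<open>Let \<open>W = \<Prod>\<^sub>k (z - \<lambda>\<^sub>k)\<close> and \<open>L\<^sub>i = W / (z - \<lambda>\<^sub>i)\<close>. Multiplying Newton's formula for \<open>P\<close> at the nodes
\<open>\<lambda>\<^sub>i, \<mu>, \<lambda>\<^sub>j\<close> by \<open>L\<^sub>i L\<^sub>j\<close> shows that modulo \<open>W\<^sup>2 (z - \<mu>)\<close> the polynomial \<open>P L\<^sub>i L\<^sub>j\<close> has a remainder whose
coefficient of order \<open>2 n\<close> is \<open>[\<lambda>\<^sub>i, \<mu>, \<lambda>\<^sub>j]\<^sub>P\<close>. So the form on the left is the divided difference of
\<open>P (\<Sum>\<^sub>i c\<^sub>i L\<^sub>i)\<^sup>2\<close> with the \<open>2 n + 1\<close> nodes \<open>\<lambda>\<^sub>1, \<lambda>\<^sub>1, \<dots>, \<lambda>\<^sub>n, \<lambda>\<^sub>n, \<mu>\<close>.\<close>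

lemma kraus_form_mean_value:
  assumes lam: "\<And>i. i < n \<Longrightarrow> lam i \<in> {a..b}" and \<mu>: "\<mu> \<in> {a..b}" and n: "0 < n"
  shows "\<exists>\<xi>\<in>{a..b}. (\<Sum>i<n. \<Sum>j<n. c i * c j * poly_dd3 P (lam i) \<mu> (lam j))
    = coeff (taylor_poly (P * (lagrange_comb n lam c)\<^sup>2) \<xi>) (2 * n)"
proof -
  obtain r Q where rQ: "\<And>i j. P = r i j + [:- lam i, 1:] * [:- \<mu>, 1:] * [:- lam j, 1:] * Q i j"
      "\<And>i j. degree (r i j) \<le> 2" "\<And>i j. coeff (r i j) 2 = poly_dd3 P (lam i) \<mu> (lam j)"
    using newton_form[of P "lam _" \<mu> "lam _"] by metis
  define L where "L i = (\<Prod>k\<in>{..<n} - {i}. [:- lam k, 1:])" for i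
  define W where "W = (\<Prod>k\<in>{..<n}. [:- lam k, 1:])"
  have L: "degree (L i) = n - 1" "coeff (L i) (n - 1) = 1" if "i < n" for i
    using degree_linear_factors[of "{..<n} - {i}" lam] coeff_linear_factors[of "{..<n} - {i}" lam] that
    by (simp_all add: L_def)
  have W: "W = [:- lam i, 1:] * L i" if "i < n" for i
    using that unfolding W_def L_def by (intro prod.remove) auto
  define R where "R = (\<Sum>i<n. \<Sum>j<n. smult (c i * c j) (r i j * (L i * L j)))"
  define S where "S = (\<Sum>i<n. \<Sum>j<n. smult (c i * c j) (Q i j))"
  have LL: "degree (L i * L j) \<le> 2 * n - 2" "coeff (L i * L j) (2 * n - 2) = 1" if "i < n" "j < n" for i j
  proof -
    have "n - 1 + (n - 1) = 2 * n - 2" by simp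
    then show "degree (L i * L j) \<le> 2 * n - 2" "coeff (L i * L j) (2 * n - 2) = 1"
      using degree_mult_le[of "L i" "L j"] coeff_mult_degree_le[of "L i" "n - 1" "L j" "n - 1"] L that
      by simp_all
  qed
  have two: "2 + (2 * n - 2) = 2 * n" using n by simp
  have degR: "degree R \<le> 2 * n"
    unfolding R_def
  proof (intro degree_sum_le order_trans[OF degree_smult_le] order_trans[OF degree_mult_le])
    fix i j assume "i \<in> {..<n}" "j \<in> {..<n}"
    then have "degree (r i j) + degree (L i * L j) \<le> 2 + (2 * n - 2)"
      by (intro add_mono rQ(2) LL(1)) auto
    then show "degree (r i j) + degree (L i * L j) \<le> 2 * n" unfolding two .
  qed auto
  have "coeff (r i j * (L i * L j)) (2 * n) = poly_dd3 P (lam i) \<mu> (lam j)" if "i < n" "j < n" for i j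
    using coeff_mult_degree_le[OF rQ(2) LL(1)[OF that], of i j] LL(2)[OF that] rQ(3) unfolding two by simp
  then have coeffR: "coeff R (2 * n) = (\<Sum>i<n. \<Sum>j<n. c i * c j * poly_dd3 P (lam i) \<mu> (lam j))"
    by (simp add: R_def coeff_sum)
  have PLL: "P * (L i * L j) = r i j * (L i * L j) + W * (W * [:- \<mu>, 1:]) * Q i j" if "i < n" "j < n" for i j
  proof -
    have "P * (L i * L j) = (r i j + [:- lam i, 1:] * [:- \<mu>, 1:] * [:- lam j, 1:] * Q i j) * (L i * L j)"
      using rQ(1) by metis
    also have "\<dots> = r i j * (L i * L j) + ([:- lam i, 1:] * L i) * (([:- lam j, 1:] * L j) * [:- \<mu>, 1:]) * Q i j"
      by (simp only: ring_distribs mult_ac)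
    finally show ?thesis unfolding W[OF that(1), symmetric] W[OF that(2), symmetric] .
  qed
  have "P * (lagrange_comb n lam c)\<^sup>2 = (\<Sum>i<n. \<Sum>j<n. smult (c i * c j) (P * (L i * L j)))"
    unfolding lagrange_comb_def L_def[symmetric] power2_eq_square sum_product
    unfolding sum_distrib_left by (intro sum.cong refl) (simp add: mult.commute)
  also have "\<dots> = R + W * (W * [:- \<mu>, 1:]) * S"
    unfolding R_def S_def sum_distrib_left sum.distrib[symmetric]
    by (intro sum.cong refl) (simp add: PLL smult_add_right)
  finally have eq: "P * (lagrange_comb n lam c)\<^sup>2 = R + W * (W * [:- \<mu>, 1:]) * S" .
  \<comment> \<open>The roots of W * W * (z - \<mu>): the left summand of the index type lists the first factor, the right one the rest.\<close>
  define x where "x s = (case s of Inl k \<Rightarrow> lam k | Inr k \<Rightarrow> if k < n then lam k else \<mu>)" for s :: "nat + nat"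
  have "(\<Prod>s\<in>{..<n} <+> {..n}. [:- x s, 1:]) = W * (W * [:- \<mu>, 1:])"
    by (simp add: prod.Plus x_def comp_def W_def lessThan_Suc_atMost[symmetric])
  with eq have eq': "P * (lagrange_comb n lam c)\<^sup>2 = R + (\<Prod>s\<in>{..<n} <+> {..n}. [:- x s, 1:]) * S" by simp
  have "\<exists>\<xi>\<in>{a..b}. coeff (taylor_poly (P * (lagrange_comb n lam c)\<^sup>2) \<xi>) (2 * n) = coeff R (2 * n)"
    by (rule confluent_mean_value[OF _ _ _ eq' degR])
      (use lam \<mu> in \<open>auto simp: card_Plus x_def\<close>)
  then show ?thesis unfolding coeffR by metis
qed

lemma coeff_prod_linear_bound:
  assumes "finite S" "\<And>k. k \<in> S \<Longrightarrow> \<bar>y k\<bar> \<le> D"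
  shows "\<bar>coeff (\<Prod>k\<in>S. [:y k, 1 :: real:]) i\<bar> \<le> (1 + D) ^ card S"
  using assms
proof (induction S arbitrary: i)
  case (insert k S)
  have D: "0 \<le> D" using insert.prems[of k] by simp
  define p where "p = (\<Prod>k\<in>S. [:y k, 1:])"
  have p: "\<bar>coeff p i\<bar> \<le> (1 + D) ^ card S" for i using insert by (simp add: p_def)
  have "\<bar>y k * coeff p i\<bar> \<le> D * (1 + D) ^ card S"
    unfolding abs_mult by (intro mult_mono p) (use insert.prems D in auto)
  moreover have "\<bar>coeff (pCons 0 p) i\<bar> \<le> (1 + D) ^ card S"
    using p D by (cases i) auto
  moreover have "coeff ([:y k, 1:] * p) i = y k * coeff p i + coeff (pCons 0 p) i" by simp
  ultimately have "\<bar>coeff ([:y k, 1:] * p) i\<bar> \<le> (1 + D) ^ Suc (card S)"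
    by (simp add: ring_distribs)
  then show ?case unfolding prod.insert[OF insert.hyps] card_insert_disjoint[OF insert.hyps] p_def .
qed (simp add: coeff_pCons one_pCons split: nat.split)

lemma coeff_lagrange_comb_bound:
  assumes lam: "\<And>i. i < n \<Longrightarrow> lam i \<in> {a..b}" and \<xi>: "\<xi> \<in> {a..b}" and c: "\<And>i. i < n \<Longrightarrow> \<bar>c i\<bar> \<le> B"
  shows "\<bar>coeff (taylor_poly (lagrange_comb n lam c) \<xi>) k\<bar> \<le> real n * (B * (1 + (b - a)) ^ (n - 1))"
proof -
  have t: "taylor_poly (lagrange_comb n lam c) \<xi> = (\<Sum>i<n. smult (c i) (\<Prod>k\<in>{..<n} - {i}. [:\<xi> - lam k, 1:]))"
    by (simp add: taylor_poly_def lagrange_comb_def pcompose_sum pcompose_smult pcompose_prod pcompose_pCons)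
  have "\<bar>coeff (taylor_poly (lagrange_comb n lam c) \<xi>) k\<bar> \<le>
      (\<Sum>i<n. \<bar>c i * coeff (\<Prod>k\<in>{..<n} - {i}. [:\<xi> - lam k, 1:]) k\<bar>)"
    unfolding t coeff_sum coeff_smult by (rule sum_abs)
  also have "\<dots> \<le> (\<Sum>i<n. B * (1 + (b - a)) ^ (n - 1))"
  proof (rule sum_mono)
    fix i assume i: "i \<in> {..<n}"
    have "\<bar>coeff (\<Prod>k\<in>{..<n} - {i}. [:\<xi> - lam k, 1:]) k\<bar> \<le> (1 + (b - a)) ^ card ({..<n} - {i})"
      by (rule coeff_prod_linear_bound) (use lam \<xi> in \<open>force simp: abs_le_iff\<close>)+
    also have "card ({..<n} - {i}) = n - 1" using i by simp
    finally show "\<bar>c i * coeff (\<Prod>k\<in>{..<n} - {i}. [:\<xi> - lam k, 1:]) k\<bar> \<le> B * (1 + (b - a)) ^ (n - 1)"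
      unfolding abs_mult using c[of i] i \<xi> by (intro mult_mono) auto
  qed
  also have "\<dots> = real n * (B * (1 + (b - a)) ^ (n - 1))" by simp
  finally show ?thesis .
qed

lemma degree_lagrange_comb: "0 < n \<Longrightarrow> degree (lagrange_comb n lam c) < n"
proof -
  assume n: "0 < n"
  have "degree (lagrange_comb n lam c) \<le> n - 1"
    unfolding lagrange_comb_def
    by (intro degree_sum_le order_trans[OF degree_smult_le]) (simp_all add: degree_linear_factors)
  then show ?thesis using n by simp
qed

text \<open>If the Taylor coefficients of \<open>P\<close> are \<open>e\<close>-close to sequences with a nonnegative Hankel form, then
Kraus's form for \<open>P\<close> is nonnegative up to a multiple of \<open>e\<close> that depends only on the interval and on a
bound for \<open>c\<close>, not on the position of the nodes.\<close>

lemma kraus_form_lower_bound: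
  assumes n: "0 < n"
    and T: "\<And>x. x \<in> {a..b} \<Longrightarrow> hankel_nonneg n (T x)"
    and close: "\<And>k x. k \<le> 2 * n \<Longrightarrow> x \<in> {a..b} \<Longrightarrow> \<bar>T x k - coeff (taylor_poly P x) k\<bar> \<le> e"
    and lam: "\<And>i. i < n \<Longrightarrow> lam i \<in> {a..b}" and \<mu>: "\<mu> \<in> {a..b}" and c: "\<And>i. i < n \<Longrightarrow> \<bar>c i\<bar> \<le> B"
  shows "- (e * (real n * (real n * (B * (1 + (b - a)) ^ (n - 1))))\<^sup>2)
    \<le> (\<Sum>i<n. \<Sum>j<n. c i * c j * poly_dd3 P (lam i) \<mu> (lam j))"
proof -
  obtain \<xi> where \<xi>: "\<xi> \<in> {a..b}" "(\<Sum>i<n. \<Sum>j<n. c i * c j * poly_dd3 P (lam i) \<mu> (lam j))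
    = coeff (taylor_poly (P * (lagrange_comb n lam c)\<^sup>2) \<xi>) (2 * n)"
    using kraus_form_mean_value[where lam = lam and c = c and P = P, OF lam \<mu> n] by blast
  have "- (e * (real n * (real n * (B * (1 + (b - a)) ^ (n - 1))))\<^sup>2)
    \<le> coeff (taylor_poly P \<xi> * (taylor_poly (lagrange_comb n lam c) \<xi>)\<^sup>2) (2 * n)"
  proof (rule coeff_mult_square_lower_bound[where T = "T \<xi>"])
    show "degree (taylor_poly (lagrange_comb n lam c) \<xi>) < n"
      by (simp add: degree_taylor_poly degree_lagrange_comb n)
    show "\<bar>coeff (taylor_poly (lagrange_comb n lam c) \<xi>) i\<bar> \<le> real n * (B * (1 + (b - a)) ^ (n - 1))" for i
      by (rule coeff_lagrange_comb_bound[OF lam \<xi>(1) c])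
  qed (use T close \<xi>(1) in auto)
  also have "taylor_poly P \<xi> * (taylor_poly (lagrange_comb n lam c) \<xi>)\<^sup>2 = taylor_poly (P * (lagrange_comb n lam c)\<^sup>2) \<xi>"
    by (simp add: taylor_poly_mult power2_eq_square)
  finally show ?thesis by (simp add: \<xi>(2))
qed

section \<open>Hankel positivity implies matrix convexity\<close>

definition mat_pow_app :: "nat \<Rightarrow> (nat \<Rightarrow> nat \<Rightarrow> complex) \<Rightarrow> nat \<Rightarrow> (nat \<Rightarrow> complex) \<Rightarrow> nat \<Rightarrow> complex" where
  "mat_pow_app n A k v = (mat_app n A ^^ k) v"

lemma mat_pow_app_simps [simp]:
  "mat_pow_app n A 0 v = v"
  "mat_pow_app n A (Suc k) v = mat_app n A (mat_pow_app n A k v)"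
  by (simp_all add: mat_pow_app_def)

lemma cip_mat_pow_app_spectral:
  assumes A: "spectral n A u d" and k: "k < n"
  shows "cip n (mat_pow_app n A m v) (u k) = complex_of_real (d k ^ m) * cip n v (u k)"
  by (induction m) (simp_all add: cip_mat_app_spectral[OF A k])

lemma cip_mat_pow_app:
  assumes A: "spectral n A u d"
  shows "cip n (mat_pow_app n A m v) v = complex_of_real (\<Sum>k<n. d k ^ m * spectral_weight n v (u k))"
proof -
  have u: "orthonormal n u" using A by (simp add: spectral_def)
  have "cip n (mat_pow_app n A m v) v
      = (\<Sum>k<n. complex_of_real (d k ^ m) * (cip n v (u k) * cnj (cip n v (u k))))"
    unfolding orthonormal_Parseval[OF u, of "mat_pow_app n A m v" v]
    by (intro sum.cong refl) (simp add: cip_mat_pow_app_spectral[OF A] mult.assoc)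
  also have "\<dots> = complex_of_real (\<Sum>k<n. d k ^ m * spectral_weight n v (u k))"
    by (simp add: spectral_weight_def complex_norm_square[symmetric] del: of_real_power)
  finally show ?thesis .
qed

lemma poly_spectral_sum:
  assumes A: "spectral n A u d"
  shows "(\<Sum>k<n. poly P (d k) * spectral_weight n v (u k))
    = (\<Sum>m\<le>degree P. coeff P m * Re (cip n (mat_pow_app n A m v) v))"
proof -
  have "(\<Sum>k<n. poly P (d k) * spectral_weight n v (u k))
      = (\<Sum>k<n. \<Sum>m\<le>degree P. coeff P m * (d k ^ m * spectral_weight n v (u k)))"
    by (intro sum.cong refl) (simp add: poly_altdef sum_distrib_right mult.assoc)
  also have "\<dots> = (\<Sum>m\<le>degree P. \<Sum>k<n. coeff P m * (d k ^ m * spectral_weight n v (u k)))"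
    by (rule sum.swap)
  also have "\<dots> = (\<Sum>m\<le>degree P. coeff P m * Re (cip n (mat_pow_app n A m v) v))"
    unfolding cip_mat_pow_app[OF A] Re_complex_of_real sum_distrib_left ..
  finally show ?thesis .
qed

text \<open>The first two derivatives of \<open>C\<^sup>k v\<close> along a line \<open>C = B + s H\<close>, by the product rule for
\<open>C\<^sup>k\<^sup>+\<^sup>1 v = C (C\<^sup>k v)\<close>.\<close>

fun pow_d1 where
  "pow_d1 n C H v 0 = (\<lambda>i. 0)"
| "pow_d1 n C H v (Suc k) = (\<lambda>i. mat_app n H (mat_pow_app n C k v) i + mat_app n C (pow_d1 n C H v k) i)"

fun pow_d2 where
  "pow_d2 n C H v 0 = (\<lambda>i. 0)"
| "pow_d2 n C H v (Suc k) = (\<lambda>i. 2 * mat_app n H (pow_d1 n C H v k) i + mat_app n C (pow_d2 n C H v k) i)"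

lemma has_vector_derivative_mat_app_line:
  assumes "\<And>i. ((\<lambda>s. x s i) has_vector_derivative x' i) (at s)"
  shows "((\<lambda>s. mat_app n (\<lambda>i j. B i j + complex_of_real s * H i j) (x s) i) has_vector_derivative
     mat_app n H (x s) i + mat_app n (\<lambda>i j. B i j + complex_of_real s * H i j) x' i) (at s)"
proof -
  have "((\<lambda>s. complex_of_real s) has_vector_derivative 1) (at s)"
    using has_vector_derivative_of_real[OF DERIV_ident] by simp
  then have "((\<lambda>s. B i j + complex_of_real s * H i j) has_vector_derivative H i j) (at s)" for j
    by (auto intro!: derivative_eq_intros)
  from has_vector_derivative_mult[OF this assms]
  have "((\<lambda>s. \<Sum>j<n. (B i j + complex_of_real s * H i j) * x s j) has_vector_derivative
     (\<Sum>j<n. (B i j + complex_of_real s * H i j) * x' j + H i j * x s j)) (at s)"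
    by (intro has_vector_derivative_sum)
  then show ?thesis by (simp add: mat_app_def sum.distrib add.commute)
qed

lemma has_vector_derivative_mat_app:
  assumes "\<And>i. ((\<lambda>s. x s i) has_vector_derivative x' i) (at s)"
  shows "((\<lambda>s. mat_app n H (x s) i) has_vector_derivative mat_app n H x' i) (at s)"
  unfolding mat_app_def
  by (rule has_vector_derivative_sum, rule has_vector_derivative_mult_right, rule assms)

context
  fixes n :: nat and B H :: "nat \<Rightarrow> nat \<Rightarrow> complex" and v :: "nat \<Rightarrow> complex"
    and C :: "real \<Rightarrow> nat \<Rightarrow> nat \<Rightarrow> complex"
  defines "C \<equiv> \<lambda>s i j. B i j + complex_of_real s * H i j"
begin

lemma has_vector_derivative_pow:
  "((\<lambda>s. mat_pow_app n (C s) k v i) has_vector_derivative pow_d1 n (C s) H v k i) (at s)"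
proof (induction k arbitrary: i)
  case (Suc k)
  then show ?case unfolding C_def mat_pow_app_simps pow_d1.simps
    by (rule has_vector_derivative_mat_app_line)
qed simp

lemma has_vector_derivative_pow_d1:
  "((\<lambda>s. pow_d1 n (C s) H v k i) has_vector_derivative pow_d2 n (C s) H v k i) (at s)"
proof (induction k arbitrary: i)
  case (Suc k)
  have 1: "((\<lambda>s. mat_app n H (mat_pow_app n (C s) k v) i) has_vector_derivative
      mat_app n H (pow_d1 n (C s) H v k) i) (at s)"
    by (rule has_vector_derivative_mat_app[OF has_vector_derivative_pow])
  have 2: "((\<lambda>s. mat_app n (C s) (pow_d1 n (C s) H v k) i) has_vector_derivative
      mat_app n H (pow_d1 n (C s) H v k) i + mat_app n (C s) (pow_d2 n (C s) H v k) i) (at s)"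
    using Suc unfolding C_def by (rule has_vector_derivative_mat_app_line)
  from has_vector_derivative_add[OF 1 2] show ?case by simp
qed simp

lemma DERIV_Re_cip:
  assumes "\<And>i. ((\<lambda>s. x s i) has_vector_derivative x' i) (at s)"
  shows "((\<lambda>s. Re (cip n (x s) v)) has_real_derivative Re (cip n x' v)) (at s)"
proof -
  have "((\<lambda>s. cip n (x s) v) has_vector_derivative cip n x' v) (at s)"
    unfolding cip_def
    by (rule has_vector_derivative_sum, rule has_vector_derivative_mult_left, rule assms)
  then show ?thesis
    by (auto simp: has_vector_derivative_complex_iff)
qed

lemma cip_mat_app_basis:
  assumes u: "orthonormal n u"
  shows "cip n (mat_app n H x) y = (\<Sum>j<n. cip n (mat_app n H (u j)) y * cip n x (u j))"
proof -
  have "mat_app n H x i = (\<Sum>j<n. cip n x (u j) * mat_app n H (u j) i)" for i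
  proof -
    have "mat_app n H x i = (\<Sum>l<n. H i l * (\<Sum>j<n. cip n x (u j) * u j l))"
      unfolding mat_app_def
      by (intro sum.cong refl arg_cong2[where f = "(*)"] orthonormal_expansion[OF u]) auto
    then show ?thesis
      unfolding mat_app_def sum_distrib_left by (subst (asm) sum.swap) (simp add: mult_ac)
  qed
  then have "cip n (mat_app n H x) y = (\<Sum>i<n. \<Sum>j<n. cip n x (u j) * mat_app n H (u j) i * cnj (y i))"
    by (simp add: cip_def sum_distrib_right)
  also have "\<dots> = (\<Sum>j<n. cip n (mat_app n H (u j)) y * cip n x (u j))"
    by (subst sum.swap) (simp add: cip_def sum_distrib_left sum_distrib_right mult_ac)
  finally show ?thesis .
qed

text \<open>In an eigenbasis, the recursion for the derivatives of the powers is the recursion for the divided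
differences of the power functions.\<close>

lemma cip_pow_d1:
  assumes M: "spectral n M u d" and m: "m < n"
  shows "cip n (pow_d1 n M H v k) (u m)
    = (\<Sum>j<n. complex_of_real (power_dd2 k (d m) (d j)) * (cip n (mat_app n H (u j)) (u m) * cip n v (u j)))"
proof (induction k)
  case (Suc k)
  have u: "orthonormal n u" using M by (simp add: spectral_def)
  have "cip n (pow_d1 n M H v (Suc k)) (u m) = cip n (mat_app n H (mat_pow_app n M k v)) (u m)
      + complex_of_real (d m) * cip n (pow_d1 n M H v k) (u m)"
    by (simp add: cip_add cip_mat_app_spectral[OF M m])
  also have "cip n (mat_app n H (mat_pow_app n M k v)) (u m)
      = (\<Sum>j<n. complex_of_real (d j ^ k) * (cip n (mat_app n H (u j)) (u m) * cip n v (u j)))"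
    unfolding cip_mat_app_basis[OF u, of "mat_pow_app n M k v"]
    by (intro sum.cong refl) (simp add: cip_mat_pow_app_spectral[OF M])
  finally show ?case
    unfolding Suc.IH by (simp add: sum_distrib_left sum.distrib ring_distribs mult_ac)
qed (simp add: cip_def)

lemma cip_pow_d2:
  assumes M: "spectral n M u d" and i: "i < n"
  shows "cip n (pow_d2 n M H v k) (u i)
    = 2 * (\<Sum>m<n. \<Sum>j<n. complex_of_real (power_dd3 k (d i) (d m) (d j)) *
        (cip n (mat_app n H (u m)) (u i) * (cip n (mat_app n H (u j)) (u m) * cip n v (u j))))"
proof (induction k)
  case (Suc k)
  have u: "orthonormal n u" using M by (simp add: spectral_def)
  have "cip n (pow_d2 n M H v (Suc k)) (u i) = 2 * cip n (mat_app n H (pow_d1 n M H v k)) (u i)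
      + complex_of_real (d i) * cip n (pow_d2 n M H v k) (u i)"
    by (simp add: cip_add cip_scale cip_mat_app_spectral[OF M i])
  also have "cip n (mat_app n H (pow_d1 n M H v k)) (u i)
      = (\<Sum>m<n. \<Sum>j<n. complex_of_real (power_dd2 k (d m) (d j)) *
        (cip n (mat_app n H (u m)) (u i) * (cip n (mat_app n H (u j)) (u m) * cip n v (u j))))"
    unfolding cip_mat_app_basis[OF u, of "pow_d1 n M H v k"]
    by (intro sum.cong refl) (simp add: cip_pow_d1[OF M] sum_distrib_left mult_ac)
  finally show ?case
    unfolding Suc.IH by (simp add: sum_distrib_left sum.distrib ring_distribs mult_ac)
qed (simp add: cip_def)

text \<open>With \<open>c\<^sub>j = H\<^sub>m\<^sub>j v\<^sub>j\<close> in the eigenbasis, the Hermitian symmetry of \<open>H\<close> turns the second derivative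
into \<open>2 \<Sum>\<^sub>m \<Sum>\<^sub>i\<^sub>j [\<lambda>\<^sub>i, \<lambda>\<^sub>m, \<lambda>\<^sub>j] c\<^sub>j c\<^sub>i\<^sup>*\<close>. As the divided differences are real and only the real part is
needed, the real and the imaginary parts of \<open>c\<close> contribute separately.\<close>

lemma second_derivative_kraus:
  assumes M: "spectral n M u d" and H: "\<And>i j. i < n \<Longrightarrow> j < n \<Longrightarrow> H i j = cnj (H j i)"
  shows "(\<Sum>k\<le>degree P. coeff P k * Re (cip n (pow_d2 n M H v k) v))
    = 2 * (\<Sum>m<n.
        (\<Sum>i<n. \<Sum>j<n. Re (cip n (mat_app n H (u i)) (u m) * cip n v (u i))
            * Re (cip n (mat_app n H (u j)) (u m) * cip n v (u j)) * poly_dd3 P (d i) (d m) (d j))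
      + (\<Sum>i<n. \<Sum>j<n. Im (cip n (mat_app n H (u i)) (u m) * cip n v (u i))
            * Im (cip n (mat_app n H (u j)) (u m) * cip n v (u j)) * poly_dd3 P (d i) (d m) (d j)))"
proof -
  have u: "orthonormal n u" using M by (simp add: spectral_def)
  define c where "c m j = cip n (mat_app n H (u j)) (u m) * cip n v (u j)" for m j
  have herm: "cip n (mat_app n H (u m)) (u i) = cnj (cip n (mat_app n H (u i)) (u m))" for i m
  proof -
    have "cip n (mat_app n H (u m)) (u i) = cip n (u m) (mat_app n H (u i))"
      by (rule cip_mat_app_hermitian) (rule H)
    also have "\<dots> = cnj (cip n (mat_app n H (u i)) (u m))" by (rule cip_commute)
    finally show ?thesis .
  qed
  define X where "X m i j = Re (c m i) * Re (c m j) + Im (c m i) * Im (c m j)" for m i j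
  have "Re (cip n (pow_d2 n M H v k) v)
      = 2 * (\<Sum>m<n. \<Sum>i<n. \<Sum>j<n. power_dd3 k (d i) (d m) (d j) * X m i j)" for k
  proof -
    have "cip n (pow_d2 n M H v k) v
      = (\<Sum>i<n. 2 * (\<Sum>m<n. \<Sum>j<n. complex_of_real (power_dd3 k (d i) (d m) (d j)) * (cnj (c m i) * c m j)))"
      unfolding orthonormal_Parseval[OF u, of "pow_d2 n M H v k" v]
    proof (intro sum.cong refl)
      fix i assume "i \<in> {..<n}"
      then have "cip n (pow_d2 n M H v k) (u i) = 2 * (\<Sum>m<n. \<Sum>j<n. complex_of_real (power_dd3 k (d i) (d m) (d j)) *
        (cnj (cip n (mat_app n H (u i)) (u m)) * c m j))"
        unfolding c_def herm[symmetric] by (intro cip_pow_d2[OF M]) auto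
      then show "cip n (pow_d2 n M H v k) (u i) * cnj (cip n v (u i))
        = 2 * (\<Sum>m<n. \<Sum>j<n. complex_of_real (power_dd3 k (d i) (d m) (d j)) * (cnj (c m i) * c m j))"
        by (simp add: c_def[of _ i] sum_distrib_left sum_distrib_right mult_ac)
    qed
    then have "Re (cip n (pow_d2 n M H v k) v)
      = (\<Sum>i<n. 2 * (\<Sum>m<n. \<Sum>j<n. power_dd3 k (d i) (d m) (d j) * X m i j))"
      by (simp add: X_def Re_sum)
    also have "\<dots> = 2 * (\<Sum>m<n. \<Sum>i<n. \<Sum>j<n. power_dd3 k (d i) (d m) (d j) * X m i j)"
      unfolding sum_distrib_left by (rule sum.swap)
    finally show ?thesis .
  qed
  then have "(\<Sum>k\<le>degree P. coeff P k * Re (cip n (pow_d2 n M H v k) v))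
    = (\<Sum>k\<le>degree P. \<Sum>m<n. \<Sum>i<n. \<Sum>j<n. 2 * (coeff P k * power_dd3 k (d i) (d m) (d j)) * X m i j)"
    by (simp add: sum_distrib_left mult_ac)
  also have "\<dots> = (\<Sum>m<n. \<Sum>i<n. \<Sum>j<n. \<Sum>k\<le>degree P. 2 * (coeff P k * power_dd3 k (d i) (d m) (d j)) * X m i j)"
    by (subst sum.swap, rule sum.cong[OF refl], subst sum.swap, rule sum.cong[OF refl], rule sum.swap)
  also have "\<dots> = (\<Sum>m<n. \<Sum>i<n. \<Sum>j<n. 2 * poly_dd3 P (d i) (d m) (d j) * X m i j)"
    by (simp add: poly_dd3_def sum_distrib_left sum_distrib_right)
  also have "\<dots> = 2 * (\<Sum>m<n. (\<Sum>i<n. \<Sum>j<n. Re (c m i) * Re (c m j) * poly_dd3 P (d i) (d m) (d j))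
      + (\<Sum>i<n. \<Sum>j<n. Im (c m i) * Im (c m j) * poly_dd3 P (d i) (d m) (d j)))"
    unfolding sum_distrib_left sum.distrib[symmetric] by (intro sum.cong refl) (simp add: X_def algebra_simps)
  finally show ?thesis unfolding c_def .
qed

end

lemma orthonormal_entry_le_1:
  assumes u: "orthonormal n u" and "k < n" "i < n"
  shows "cmod (u k i) \<le> 1"
proof -
  have "complex_of_real (\<Sum>i<n. (cmod (u k i))\<^sup>2) = 1"
    using u assms(2) unfolding cip_self[symmetric] by (simp add: orthonormal_def)
  then have "(\<Sum>i<n. (cmod (u k i))\<^sup>2) = 1" using of_real_eq_1_iff by blast
  moreover have "(cmod (u k i))\<^sup>2 \<le> (\<Sum>i<n. (cmod (u k i))\<^sup>2)"
    by (rule member_le_sum) (use assms in auto)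
  ultimately show ?thesis by (simp add: power_le_one_iff abs_le_square_iff)
qed

lemma mat_app_basis_bound:
  assumes u: "orthonormal n u" and "j < n" "m < n"
  shows "cmod (cip n (mat_app n H (u j)) (u m)) \<le> (\<Sum>p<n. \<Sum>q<n. cmod (H p q))"
proof -
  have "cip n (mat_app n H (u j)) (u m) = (\<Sum>p<n. \<Sum>q<n. H p q * u j q * cnj (u m p))"
    by (simp add: cip_def mat_app_def sum_distrib_right)
  also have "cmod \<dots> \<le> (\<Sum>p<n. \<Sum>q<n. cmod (H p q))"
  proof (intro order_trans[OF norm_sum] sum_mono)
    fix p q assume pq: "p \<in> {..<n}" "q \<in> {..<n}"
    have "cmod (H p q * u j q * cnj (u m p)) = cmod (H p q) * (cmod (u j q) * cmod (u m p))"
      by (simp add: norm_mult)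
    also have "\<dots> \<le> cmod (H p q) * 1"
      by (intro mult_left_mono mult_le_one orthonormal_entry_le_1[OF u]) (use pq assms in auto)
    finally show "cmod (H p q * u j q * cnj (u m p)) \<le> cmod (H p q)" by simp
  qed
  finally show ?thesis .
qed

lemma cip_basis_bound:
  assumes u: "orthonormal n u" and "j < n"
  shows "cmod (cip n v (u j)) \<le> (\<Sum>i<n. cmod (v i))"
proof -
  have "cmod (cip n v (u j)) \<le> (\<Sum>i<n. cmod (v i * cnj (u j i)))"
    unfolding cip_def by (rule norm_sum)
  also have "\<dots> \<le> (\<Sum>i<n. cmod (v i))"
  proof (rule sum_mono)
    fix i assume "i \<in> {..<n}"
    then have "cmod (v i) * cmod (u j i) \<le> cmod (v i) * 1" by (intro mult_left_mono orthonormal_entry_le_1[OF u]) (use assms in auto)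
    then show "cmod (v i * cnj (u j i)) \<le> cmod (v i)" by (simp add: norm_mult)
  qed
  finally show ?thesis .
qed

text \<open>Along the segment from \<open>B\<close> to \<open>A\<close> all spectra stay in \<open>[a, b]\<close>, so the second derivative \<open>\<phi>2\<close> of the
quadratic form is bounded below by Kraus's forms, uniformly up to \<open>\<epsilon> K\<close>. Adding \<open>\<epsilon> K s\<^sup>2 / 2\<close> makes
it convex.\<close>

lemma poly_almost_n_convex:
  assumes n: "0 < n"
    and A: "spectral n A u d" and B: "spectral n B u' d'"
    and M: "spectral n (mat_comb t A B) w e"
    and t: "t \<in> {0..1}" and d: "\<And>k. k < n \<Longrightarrow> d k \<in> {a..b}" "\<And>k. k < n \<Longrightarrow> d' k \<in> {a..b}"
    and T: "\<And>x. x \<in> {a..b} \<Longrightarrow> hankel_nonneg n (T x)"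
  shows "\<exists>K. \<forall>P \<epsilon>. (\<forall>k\<le>2 * n. \<forall>x\<in>{a..b}. \<bar>T x k - coeff (taylor_poly P x) k\<bar> \<le> \<epsilon>) \<longrightarrow>
    - (\<epsilon> * K) \<le> wsum (convexity_functional n t v u d u' d' w e) (poly P)"
proof -
  define H where "H i j = A i j - B i j" for i j
  define C where "C s i j = B i j + complex_of_real s * H i j" for s i j
  have C_eq: "C s i j = complex_of_real s * A i j + complex_of_real (1 - s) * B i j" for s i j
    by (simp add: C_def H_def algebra_simps)
  have herm: "A i j = cnj (A j i)" "B i j = cnj (B j i)" if "i < n" "j < n" for i j
    using spectral_hermitian[OF A that] spectral_hermitian[OF B that] by auto
  have H_herm: "H i j = cnj (H j i)" if "i < n" "j < n" for i j
    unfolding H_def complex_cnj_diff using herm[OF that] by simp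
  have C_spectral: "\<exists>x D. spectral n (C s) x D \<and> (\<forall>k<n. D k \<in> {a..b})" if s: "s \<in> {0..1}" for s
  proof -
    have "C s i j = cnj (C s j i)" if "i < n" "j < n" for i j
      unfolding C_eq complex_cnj_add complex_cnj_mult complex_cnj_complex_of_real
      using herm[OF that] by simp
    then obtain x D where xD: "spectral n (C s) x D" using spectral_theorem[of n "C s"] by blast
    moreover have "D k \<in> {a..b}" if "k < n" for k
      by (rule spectral_convex_combination_mem[OF A B xD[unfolded C_eq[abs_def]] _ s d that]) auto
    ultimately show ?thesis by blast
  qed
  \<comment> \<open>A bound for the coefficients of all Kraus forms that occur along the segment.\<close>
  define B0 where "B0 = (\<Sum>p<n. \<Sum>q<n. cmod (H p q)) * (\<Sum>i<n. cmod (v i))"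
  define K0 where "K0 = (real n * (real n * (B0 * (1 + (b - a)) ^ (n - 1))))\<^sup>2"
  \<comment> \<open>Two forms, for real and imaginary parts, for each of the n indices m, and the factor 2 of the second derivative.\<close>
  define K where "K = 4 * real n * K0"
  have K: "0 \<le> K" by (simp add: K_def K0_def)
  show ?thesis
  proof (intro exI[of _ K] allI impI)
    fix P and \<epsilon> :: real
    assume close: "\<forall>k\<le>2 * n. \<forall>x\<in>{a..b}. \<bar>T x k - coeff (taylor_poly P x) k\<bar> \<le> \<epsilon>"
    have \<epsilon>: "0 \<le> \<epsilon>"
    proof -
      have "a \<in> {a..b}" using d(1)[of 0] n by auto
      then show ?thesis using close by (metis abs_ge_zero order_trans zero_le)
    qed
    define \<phi> where "\<phi> s = (\<Sum>k\<le>degree P. coeff P k * Re (cip n (mat_pow_app n (C s) k v) v))" for s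
    define \<phi>1 where "\<phi>1 s = (\<Sum>k\<le>degree P. coeff P k * Re (cip n (pow_d1 n (C s) H v k) v))" for s
    define \<phi>2 where "\<phi>2 s = (\<Sum>k\<le>degree P. coeff P k * Re (cip n (pow_d2 n (C s) H v k) v))" for s
    have C': "C = (\<lambda>s i j. B i j + complex_of_real s * H i j)" by (simp add: C_def[abs_def])
    have D1: "(\<phi> has_real_derivative \<phi>1 s) (at s)" for s
      unfolding \<phi>_def \<phi>1_def C'
      by (intro DERIV_sum DERIV_cmult DERIV_Re_cip has_vector_derivative_pow)
    have D2: "(\<phi>1 has_real_derivative \<phi>2 s) (at s)" for s
      unfolding \<phi>1_def \<phi>2_def C'
      by (intro DERIV_sum DERIV_cmult DERIV_Re_cip has_vector_derivative_pow_d1)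
    have lower: "- (\<epsilon> * K) \<le> \<phi>2 s" if s: "s \<in> {0..1}" for s
    proof -
      obtain x D where xD: "spectral n (C s) x D" "\<And>k. k < n \<Longrightarrow> D k \<in> {a..b}"
        using C_spectral[OF s] by blast
      have x: "orthonormal n x" using xD(1) by (simp add: spectral_def)
      define c where "c m j = cip n (mat_app n H (x j)) (x m) * cip n v (x j)" for m j
      have c: "cmod (c m j) \<le> B0" if "m < n" "j < n" for m j
        unfolding c_def B0_def norm_mult
        by (intro mult_mono mat_app_basis_bound[OF x] cip_basis_bound[OF x] that sum_nonneg) auto
      have bound: "- (\<epsilon> * K0)
          \<le> (\<Sum>i<n. \<Sum>j<n. g i * g j * poly_dd3 P (D i) (D m) (D j))"
        if "m < n" "\<And>i. i < n \<Longrightarrow> \<bar>g i\<bar> \<le> B0" for g m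
        unfolding K0_def
        by (rule kraus_form_lower_bound[OF n T _ xD(2) xD(2)[OF that(1)] that(2)])
          (use close in auto)
      have "- (\<epsilon> * K) = 2 * (\<Sum>m<n. - (\<epsilon> * K0) + - (\<epsilon> * K0))"
        by (simp add: K_def algebra_simps)
      also have "\<dots> \<le> 2 * (\<Sum>m<n.
        (\<Sum>i<n. \<Sum>j<n. Re (c m i) * Re (c m j) * poly_dd3 P (D i) (D m) (D j))
        + (\<Sum>i<n. \<Sum>j<n. Im (c m i) * Im (c m j) * poly_dd3 P (D i) (D m) (D j)))"
        by (intro mult_left_mono sum_mono add_mono bound)
          (auto intro: order_trans[OF abs_Re_le_cmod] order_trans[OF abs_Im_le_cmod] c)
      also have "\<dots> = \<phi>2 s"
        unfolding \<phi>2_def c_def by (rule second_derivative_kraus[OF xD(1) H_herm, symmetric]) auto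
      finally show ?thesis .
    qed
    define \<psi> where "\<psi> s = \<phi> s + \<epsilon> * K / 2 * s\<^sup>2" for s
    have "convex_on {0..1} \<psi>"
    proof (rule f''_ge0_imp_convex)
      show "(\<psi> has_real_derivative \<phi>1 s + \<epsilon> * K * s) (at s)" for s
        unfolding \<psi>_def by (auto intro!: derivative_eq_intros D1)
      show "((\<lambda>s. \<phi>1 s + \<epsilon> * K * s) has_real_derivative \<phi>2 s + \<epsilon> * K) (at s)" for s
        by (auto intro!: derivative_eq_intros D2)
      show "0 \<le> \<phi>2 s + \<epsilon> * K" if "s \<in> {0..1}" for s using lower[OF that] by simp
    qed auto
    then have "\<psi> ((1 - t) *\<^sub>R 0 + t *\<^sub>R 1) \<le> (1 - t) * \<psi> 0 + t * \<psi> 1"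
      by (rule convex_onD) (use t in auto)
    then have conv: "\<phi> t + \<epsilon> * K / 2 * t\<^sup>2 \<le> (1 - t) * \<phi> 0 + t * (\<phi> 1 + \<epsilon> * K / 2)"
      by (simp add: \<psi>_def)
    have val: "\<phi> s = (\<Sum>k<n. poly P (D k) * spectral_weight n v (x k))"
      if "spectral n (C s) x D" for s x D
      unfolding \<phi>_def by (rule poly_spectral_sum[OF that, symmetric])
    have "C 1 = A" "C 0 = B" by (simp_all add: C_eq[abs_def])
    then have "wsum (convexity_functional n t v u d u' d' w e) (poly P) = t * \<phi> 1 + (1 - t) * \<phi> 0 - \<phi> t"
      using val[of 1 u d] val[of 0 u' d'] val[of t w e] A B M
      by (simp add: wsum_convexity_functional C_eq[abs_def])
    also have "\<dots> \<ge> \<epsilon> * K / 2 * (t\<^sup>2 - t)" using conv by (simp add: field_simps)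
    finally have "\<epsilon> * K / 2 * (t\<^sup>2 - t) \<le> wsum (convexity_functional n t v u d u' d' w e) (poly P)" .
    moreover have "- (\<epsilon> * K) \<le> \<epsilon> * K / 2 * (t\<^sup>2 - t)"
    proof -
      have "-2 \<le> t\<^sup>2 - t" using t zero_le_power2[of t] unfolding atLeastAtMost_iff by linarith
      then have "\<epsilon> * K / 2 * (-2) \<le> \<epsilon> * K / 2 * (t\<^sup>2 - t)"
        using \<epsilon> K by (intro mult_left_mono) auto
      then show ?thesis by simp
    qed
    ultimately show "- (\<epsilon> * K) \<le> wsum (convexity_functional n t v u d u' d' w e) (poly P)" by linarith
  qed
qed

lemma wsum_diff_bound:
  assumes "\<And>x. x \<in> snd ` set l \<Longrightarrow> \<bar>f x - g x\<bar> \<le> \<epsilon>"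
  shows "\<bar>wsum l f - wsum l g\<bar> \<le> \<epsilon> * (\<Sum>p\<leftarrow>l. \<bar>fst p\<bar>)"
  using assms
proof (induction l)
  case (Cons p l)
  have "\<bar>fst p * (f (snd p) - g (snd p))\<bar> \<le> \<bar>fst p\<bar> * \<epsilon>"
    unfolding abs_mult using Cons.prems by (intro mult_left_mono) auto
  moreover have "\<bar>wsum l f - wsum l g\<bar> \<le> \<epsilon> * (\<Sum>p\<leftarrow>l. \<bar>fst p\<bar>)"
    using Cons by auto
  moreover have "wsum (p # l) f - wsum (p # l) g = fst p * (f (snd p) - g (snd p)) + (wsum l f - wsum l g)"
    by (simp add: wsum_Cons algebra_simps)
  ultimately have "\<bar>wsum (p # l) f - wsum (p # l) g\<bar> \<le> \<bar>fst p\<bar> * \<epsilon> + \<epsilon> * (\<Sum>p\<leftarrow>l. \<bar>fst p\<bar>)"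
    by linarith
  then show ?case by (simp add: split_beta ring_distribs mult.commute)
qed (simp add: wsum_def)

theorem convexity_functionals_nonneg_if_hankel:
  assumes n: "0 < n" and I: "convex I" and F: "smooth_seq (2 * n) I F"
    and H: "\<And>x. x \<in> I \<Longrightarrow> hankel_nonneg n (\<lambda>k. F k x / fact k)"
  shows "nonneg_on (convexity_functionals n) I (F 0)"
  unfolding nonneg_on_def
proof (intro ballI impI)
  fix l assume "l \<in> convexity_functionals n" and nodes: "snd ` set l \<subseteq> I"
  then obtain t v u d u' d' w e A B where l: "l = convexity_functional n t v u d u' d' w e"
    and t: "t \<in> {0..1}"
    and sp: "spectral n A u d" "spectral n B u' d'"
      "spectral n (mat_comb t A B) w e"
    unfolding convexity_functionals_def by blast
  define N where "N = snd ` set l"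
  have N: "finite N" "N \<noteq> {}" "d ` {..<n} \<union> d' ` {..<n} \<subseteq> N"
    using n by (auto simp: N_def l nodes_convexity_functional)
  define a where "a = Min N"
  define b where "b = Max N"
  have ab: "a \<in> N" "b \<in> N" unfolding a_def b_def by (rule Min_in[OF N(1,2)] Max_in[OF N(1,2)])+
  have Nab: "x \<in> {a..b}" if "x \<in> N" for x using that N(1) by (auto simp: a_def b_def)
  have le: "a \<le> b" using Nab[OF ab(1)] by simp
  have sub: "{a..b} \<subseteq> I"
    using closed_segment_subset[of a I b] ab nodes I le by (auto simp: closed_segment_eq_real_ivl N_def)
  have "\<exists>K. \<forall>P \<epsilon>. (\<forall>k\<le>2 * n. \<forall>x\<in>{a..b}. \<bar>F k x / fact k - coeff (taylor_poly P x) k\<bar> \<le> \<epsilon>) \<longrightarrow>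
    - (\<epsilon> * K) \<le> wsum (convexity_functional n t v u d u' d' w e) (poly P)"
    by (rule poly_almost_n_convex[OF n sp t]) (use N(3) Nab H sub in auto)
  then obtain K where K: "\<And>P \<epsilon>. (\<forall>k\<le>2 * n. \<forall>x\<in>{a..b}. \<bar>F k x / fact k - coeff (taylor_poly P x) k\<bar> \<le> \<epsilon>)
      \<Longrightarrow> - (\<epsilon> * K) \<le> wsum l (poly P)"
    unfolding l by blast
  define W where "W = (\<Sum>p\<leftarrow>l. \<bar>fst p\<bar>)"
  have "- (\<epsilon> * (K + W)) \<le> wsum l (F 0)" if \<epsilon>: "0 < \<epsilon>" for \<epsilon>
  proof -
    obtain P where P: "\<And>k x. k \<le> 2 * n \<Longrightarrow> x \<in> {a..b} \<Longrightarrow> \<bar>F k x / fact k - coeff (taylor_poly P x) k\<bar> \<le> \<epsilon>"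
      using smooth_seq_poly_approx[OF F sub le \<epsilon>] by blast
    have "\<bar>F 0 x - poly P x\<bar> \<le> \<epsilon>" if "x \<in> N" for x
      using P[of 0 x] Nab[OF that] by (simp add: coeff_taylor_poly)
    then have "\<bar>wsum l (F 0) - wsum l (poly P)\<bar> \<le> \<epsilon> * W"
      unfolding N_def W_def by (rule wsum_diff_bound)
    moreover have "- (\<epsilon> * K) \<le> wsum l (poly P)" using K P by blast
    ultimately show ?thesis by (simp add: algebra_simps abs_le_iff)
  qed
  then show "0 \<le> wsum l (F 0)" by (rule nonneg_if_ge_small_multiples)
qed

section \<open>Matrix convexity implies Hankel positivity\<close>

text \<open>The adjacency matrix of the path \<open>0 - 1 - 2 - \<dots>\<close> with a loop of weight \<open>\<sigma>\<close> at \<open>0\<close>.\<close>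

definition path_mat :: "real \<Rightarrow> nat \<Rightarrow> nat \<Rightarrow> complex" where
  "path_mat \<sigma> i j = (if i = Suc j \<or> j = Suc i then 1 else if i = 0 \<and> j = 0 then complex_of_real \<sigma> else 0)"

text \<open>The total weight of the walks with \<open>k\<close> steps from \<open>i\<close> to \<open>j\<close> on the path \<open>0, \<dots>, n - 1\<close>, that is, an
entry of the power \<open>k\<close> of the matrix above.\<close>

fun walks :: "nat \<Rightarrow> real \<Rightarrow> nat \<Rightarrow> nat \<Rightarrow> nat \<Rightarrow> real" where
  "walks n \<sigma> 0 i j = (if i = j then 1 else 0)"
| "walks n \<sigma> (Suc k) i j = (case i of 0 \<Rightarrow> \<sigma> * walks n \<sigma> k 0 j | Suc i' \<Rightarrow> walks n \<sigma> k i' j)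
     + (if Suc i < n then walks n \<sigma> k (Suc i) j else 0)"

lemma mat_app_path_mat:
  assumes "i < n"
  shows "mat_app n (path_mat \<sigma>) x i
    = (case i of 0 \<Rightarrow> complex_of_real \<sigma> * x 0 | Suc i' \<Rightarrow> x i') + (if Suc i < n then x (Suc i) else 0)"
proof -
  have "mat_app n (path_mat \<sigma>) x i
      = (\<Sum>j<n. (if j = Suc i then x j else 0)
          + (if j = (case i of 0 \<Rightarrow> 0 | Suc i' \<Rightarrow> i') then (case i of 0 \<Rightarrow> complex_of_real \<sigma> | Suc i' \<Rightarrow> 1) * x j else 0))"
    unfolding mat_app_def by (intro sum.cong refl) (auto simp: path_mat_def split: nat.splits)
  also have "\<dots> = (\<Sum>j<n. if j = Suc i then x j else 0)
      + (\<Sum>j<n. if j = (case i of 0 \<Rightarrow> 0 | Suc i' \<Rightarrow> i') then (case i of 0 \<Rightarrow> complex_of_real \<sigma> | Suc i' \<Rightarrow> 1) * x j else 0)"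
    by (rule sum.distrib)
  finally show ?thesis using assms by (auto split: nat.splits)
qed

lemma mat_pow_app_path_mat:
  assumes "i < n"
  shows "mat_pow_app n (path_mat \<sigma>) k (\<lambda>j. complex_of_real (r j)) i
    = complex_of_real (\<Sum>j<n. walks n \<sigma> k i j * r j)"
  using assms
proof (induction k arbitrary: i)
  case 0
  then show ?case by (simp add: if_distrib[of "\<lambda>x. x * _"] cong: if_cong)
next
  case (Suc k)
  show ?case
  proof (cases i)
    case 0
    then show ?thesis using Suc
      by (simp add: mat_app_path_mat ring_distribs sum.distrib sum_distrib_left mult_ac)
  next
    case (Suc i')
    then show ?thesis using Suc.IH[of i'] Suc.IH[of "Suc i"] Suc.prems
      by (simp add: mat_app_path_mat ring_distribs sum.distrib)
  qed
qed

lemma walks_parity: "odd (k + i + j) \<Longrightarrow> walks n 0 k i j = 0"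
proof (induction k arbitrary: i)
  case (Suc k)
  show ?case
  proof (cases i)
    case 0
    then show ?thesis using Suc.IH[of 1] Suc.prems by simp
  next
    case (Suc i')
    then show ?thesis using Suc.IH[of i'] Suc.IH[of "Suc i"] Suc.prems by simp
  qed
qed auto

lemma walks_too_short: "k + i < j \<Longrightarrow> walks n \<sigma> k i j = 0"
proof (induction k arbitrary: i)
  case (Suc k)
  then show ?case by (cases i) simp_all
qed simp

lemma walks_straight: "k + i = j \<Longrightarrow> j < n \<Longrightarrow> walks n \<sigma> k i j = 1"
proof (induction k arbitrary: i)
  case (Suc k)
  show ?case
  proof (cases i)
    case 0
    have "walks n \<sigma> k 0 j = 0" "walks n \<sigma> k 1 j = 1" "Suc 0 < n"
      using Suc.IH[of 1] Suc.prems 0 by (simp_all add: walks_too_short)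
    then show ?thesis unfolding 0 walks.simps by simp
  next
    case (Suc i')
    have "walks n \<sigma> k i' j = 0" "walks n \<sigma> k (Suc i) j = 1" "Suc i < n"
      using Suc.IH[of "Suc i"] Suc.prems Suc by (simp_all add: walks_too_short)
    then show ?thesis unfolding walks.simps by (simp add: Suc)
  qed
qed simp

text \<open>A walk from \<open>i\<close> to \<open>j\<close> that uses the loop needs \<open>i + j\<close> other steps. With \<open>i + j + 1\<close> steps there is
one such walk. With \<open>i + j + 2\<close> steps the loop must be used an even number of times by parity, so
exactly twice, and again there is one walk.\<close>

lemma walks_through_loop:
  assumes "i < n" "j < n"
  shows "k \<le> i + j \<Longrightarrow> walks n \<sigma> k i j = walks n 0 k i j"
    and "k = i + j + 1 \<Longrightarrow> walks n \<sigma> k i j = walks n 0 k i j + \<sigma>"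
    and "k = i + j + 2 \<Longrightarrow> walks n \<sigma> k i j = walks n 0 k i j + \<sigma>\<^sup>2"
proof -
  have "(k \<le> i + j \<longrightarrow> walks n \<sigma> k i j = walks n 0 k i j) \<and>
    (k = i + j + 1 \<longrightarrow> walks n \<sigma> k i j = walks n 0 k i j + \<sigma>) \<and>
    (k = i + j + 2 \<longrightarrow> walks n \<sigma> k i j = walks n 0 k i j + \<sigma>\<^sup>2)"
    using assms
  proof (induction k arbitrary: i)
    case (Suc k)
    show ?case
    proof (cases i)
      case 0
      have up: "walks n \<sigma> k 1 j = walks n 0 k 1 j" if "Suc 0 < n" "k \<le> Suc j"
        using Suc.IH[of 1] that Suc.prems by simp
      have "walks n \<sigma> k 0 j = 0" if "k < j" using walks_too_short[of k 0 j] that by simp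
      moreover have "walks n \<sigma> k 0 j = 1" if "k = j" using walks_straight[of k 0 j] that Suc.prems by simp
      moreover have "walks n \<sigma> k 0 j = \<sigma>" if "k = Suc j"
        using Suc.IH[of 0] that Suc.prems 0 walks_parity[of k 0 j n] by simp
      ultimately show ?thesis using 0 up by (auto simp: power2_eq_square)
    next
      case (Suc i')
      have up: "walks n \<sigma> k (Suc i) j = walks n 0 k (Suc i) j" if "Suc i < n" "k \<le> Suc (i + j)"
        using Suc.IH[of "Suc i"] that Suc.prems by simp
      show ?thesis using Suc Suc.IH[of i'] Suc.prems up by auto
    qed
  qed simp
  then show "k \<le> i + j \<Longrightarrow> walks n \<sigma> k i j = walks n 0 k i j"
    and "k = i + j + 1 \<Longrightarrow> walks n \<sigma> k i j = walks n 0 k i j + \<sigma>"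
    and "k = i + j + 2 \<Longrightarrow> walks n \<sigma> k i j = walks n 0 k i j + \<sigma>\<^sup>2" by auto
qed

declare walks.simps [simp del]

lemma spectral_affine:
  assumes A: "spectral n A u d"
  shows "spectral n (\<lambda>i j. complex_of_real h * A i j + (if i = j then complex_of_real x else 0)) u (\<lambda>k. x + h * d k)"
proof -
  have "spectral n (\<lambda>i j. complex_of_real h * A i j) u (\<lambda>k. h * d k)"
    using A unfolding spectral_def
    by (auto simp: sum_distrib_left mult.assoc)
  from spectral_translate[OF this, of x] show ?thesis by (simp add: add.commute)
qed

text \<open>The second difference of the quadratic forms at the loop weights \<open>1, -1, 0\<close> kills the walks that use
the loop once. With the entries \<open>c\<^sub>i h\<^sup>n\<^sup>-\<^sup>1\<^sup>-\<^sup>i\<close> of the test vector, a pair \<open>i, j\<close> and a Taylor term of order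
\<open>k\<close> contribute at the order \<open>h\<^sup>k\<^sup>+\<^sup>2\<^sup>n\<^sup>-\<^sup>2\<^sup>-\<^sup>i\<^sup>-\<^sup>j\<close>. The terms with \<open>k < i + j + 2\<close> vanish, the terms
with \<open>k = i + j + 2\<close> have the exact order \<open>h\<^sup>2\<^sup>n\<close> and form the Hankel form, and the others are smaller.\<close>

theorem hankel_if_convexity_functionals_nonneg:
  assumes n: "0 < n" and I: "open I" and F: "smooth_seq (2 * n) I F" and x: "x \<in> I"
    and pos: "nonneg_on (convexity_functionals n) I (F 0)"
  shows "hankel_nonneg n (\<lambda>k. F k x / fact k)"
  unfolding hankel_nonneg_def
proof
  fix c :: "nat \<Rightarrow> real"
  let ?m = "2 * n"
  define f where "f k = F k x / fact k" for k
  have "\<exists>u d. spectral n (path_mat \<sigma>) u d" for \<sigma>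
    by (rule spectral_theorem) (simp add: path_mat_def)
  then obtain u d where ud: "\<And>\<sigma>. spectral n (path_mat \<sigma>) (u \<sigma>) (d \<sigma>)" by metis
  define r where "r h i = c i * h ^ (n - 1 - i)" for h :: real and i
  define v where "v h i = complex_of_real (r h i)" for h i
  define wt where "wt \<sigma> h l = spectral_weight n (v h) (u \<sigma> l)" for \<sigma> h l
  define E where "E h y = F 0 (x + h * y) - (\<Sum>k\<le>?m. f k * (h * y) ^ k)" for h y
  define S where "S \<sigma> h = (\<Sum>l<n. F 0 (x + h * d \<sigma> l) * wt \<sigma> h l)" for \<sigma> h
  define M where "M \<sigma> h k = (\<Sum>i<n. \<Sum>j<n. walks n \<sigma> k i j * (r h i * r h j))" for \<sigma> h k
  have moment: "(\<Sum>l<n. d \<sigma> l ^ k * wt \<sigma> h l) = M \<sigma> h k" for \<sigma> h k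
  proof -
    have "complex_of_real (\<Sum>l<n. d \<sigma> l ^ k * wt \<sigma> h l) = cip n (mat_pow_app n (path_mat \<sigma>) k (v h)) (v h)"
      unfolding wt_def by (rule cip_mat_pow_app[OF ud, symmetric])
    also have "\<dots> = (\<Sum>i<n. complex_of_real (\<Sum>j<n. walks n \<sigma> k i j * r h j) * cnj (complex_of_real (r h i)))"
      unfolding cip_def v_def by (intro sum.cong refl) (simp add: mat_pow_app_path_mat del: of_real_sum)
    also have "\<dots> = complex_of_real (M \<sigma> h k)"
      by (simp add: M_def sum_distrib_left mult_ac)
    finally show ?thesis using of_real_eq_iff by blast
  qed
  have S_eq: "S \<sigma> h = (\<Sum>k\<le>?m. f k * h ^ k * M \<sigma> h k) + (\<Sum>l<n. E h (d \<sigma> l) * wt \<sigma> h l)" for \<sigma> h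
  proof -
    have "S \<sigma> h = (\<Sum>l<n. (\<Sum>k\<le>?m. f k * (h * d \<sigma> l) ^ k) * wt \<sigma> h l + E h (d \<sigma> l) * wt \<sigma> h l)"
      by (simp add: S_def E_def algebra_simps)
    also have "\<dots> = (\<Sum>l<n. \<Sum>k\<le>?m. f k * h ^ k * (d \<sigma> l ^ k * wt \<sigma> h l)) + (\<Sum>l<n. E h (d \<sigma> l) * wt \<sigma> h l)"
      by (simp add: sum.distrib sum_distrib_left sum_distrib_right power_mult_distrib mult_ac)
    also have "(\<Sum>l<n. \<Sum>k\<le>?m. f k * h ^ k * (d \<sigma> l ^ k * wt \<sigma> h l)) = (\<Sum>k\<le>?m. f k * h ^ k * M \<sigma> h k)"
      unfolding moment[symmetric] sum_distrib_left by (rule sum.swap)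
    finally show ?thesis .
  qed
  have E_lim: "((\<lambda>h. E h y / h ^ ?m) \<longlongrightarrow> 0) (at_right 0)" for y
    unfolding E_def f_def by (rule taylor_remainder_scaled[OF F I x]) (use n in simp)
  have wt_lim: "((\<lambda>h. wt \<sigma> h l) \<longlongrightarrow> wt \<sigma> 0 l) (at_right 0)" for \<sigma> l
  proof -
    have "isCont (\<lambda>h. wt \<sigma> h l) 0"
      unfolding wt_def spectral_weight_def cip_def v_def r_def by (intro continuous_intros)
    then show ?thesis unfolding isCont_def by (rule tendsto_within_subset) simp
  qed
  have rest_lim: "((\<lambda>h. \<Sum>l<n. E h (d \<sigma> l) / h ^ ?m * wt \<sigma> h l) \<longlongrightarrow> (\<Sum>l<n. 0 * wt \<sigma> 0 l)) (at_right 0)" for \<sigma>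
    by (rule tendsto_sum, rule tendsto_mult[OF E_lim wt_lim])
  define G where "G k i j = (walks n 1 k i j + walks n (- 1) k i j) / 2 - walks n 0 k i j" for k i j
  have G: "G k i j = 0" if "k < i + j + 2" "i < n" "j < n" for k i j
  proof (cases "k = i + j + 1")
    case True
    then show ?thesis 
      using walks_through_loop(2)[where \<sigma> = 1, OF that(2,3) True]
        walks_through_loop(2)[where \<sigma> = "- 1", OF that(2,3) True] by (simp add: G_def)
  next
    case False
    then have "k \<le> i + j" using that by simp
    then show ?thesis 
      using walks_through_loop(1)[where \<sigma> = 1 and k = k, OF that(2,3)]
        walks_through_loop(1)[where \<sigma> = "- 1" and k = k, OF that(2,3)] by (simp add: G_def)
  qed
  have G1: "G (i + j + 2) i j = 1" if "i < n" "j < n" for i j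
    using walks_through_loop(3)[where \<sigma> = 1, OF that refl]
      walks_through_loop(3)[where \<sigma> = "- 1", OF that refl] by (simp add: G_def add_divide_distrib)
  \<comment> \<open>The contribution of the Taylor polynomial, divided by h to the power 2n.\<close>
  define Z where "Z h = (\<Sum>k\<le>?m. \<Sum>i<n. \<Sum>j<n. if k < i + j + 2 then 0
      else f k * G k i j * (c i * c j) * h ^ (k - (i + j + 2)))" for h
  have Z_eq: "(\<Sum>k\<le>?m. f k * h ^ k * ((M 1 h k + M (- 1) h k) / 2 - M 0 h k)) = h ^ ?m * Z h" for h
  proof -
    have "f k * h ^ k * ((M 1 h k + M (- 1) h k) / 2 - M 0 h k)
        = (\<Sum>i<n. \<Sum>j<n. h ^ ?m * (if k < i + j + 2 then 0
            else f k * G k i j * (c i * c j) * h ^ (k - (i + j + 2))))" for k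
    proof -
      have "(M 1 h k + M (- 1) h k) / 2 - M 0 h k = (\<Sum>i<n. \<Sum>j<n. G k i j * (r h i * r h j))"
        by (simp add: M_def G_def sum.distrib sum_subtractf ring_distribs add_divide_distrib sum_divide_distrib)
      then have "f k * h ^ k * ((M 1 h k + M (- 1) h k) / 2 - M 0 h k)
          = (\<Sum>i<n. \<Sum>j<n. f k * h ^ k * (G k i j * (r h i * r h j)))"
        by (simp only: sum_distrib_left)
      also have "\<dots> = (\<Sum>i<n. \<Sum>j<n. h ^ ?m * (if k < i + j + 2 then 0
            else f k * G k i j * (c i * c j) * h ^ (k - (i + j + 2))))"
      proof (intro sum.cong refl)
        fix i j assume ij: "i \<in> {..<n}" "j \<in> {..<n}"
        show "f k * h ^ k * (G k i j * (r h i * r h j)) = h ^ ?m * (if k < i + j + 2 then 0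
            else f k * G k i j * (c i * c j) * h ^ (k - (i + j + 2)))"
        proof (cases "k < i + j + 2")
          case True
          then show ?thesis using G[OF True] ij by simp
        next
          case False
          then have "k + (n - 1 - i) + (n - 1 - j) = ?m + (k - (i + j + 2))" using ij by auto
          then have "h ^ k * h ^ (n - 1 - i) * h ^ (n - 1 - j) = h ^ ?m * h ^ (k - (i + j + 2))"
            by (simp only: power_add[symmetric])
          then have "f k * G k i j * (c i * c j) * (h ^ k * h ^ (n - 1 - i) * h ^ (n - 1 - j))
              = f k * G k i j * (c i * c j) * (h ^ ?m * h ^ (k - (i + j + 2)))" by simp
          then show ?thesis using False by (simp add: r_def mult_ac)
        qed
      qed
      finally show ?thesis .
    qed
    then show ?thesis by (simp only: Z_def sum_distrib_left)
  qed
  have Z_lim: "(Z \<longlongrightarrow> Z 0) (at_right 0)"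
    unfolding Z_def[abs_def] by (intro tendsto_sum) (auto intro!: tendsto_intros)
  have Z0: "Z 0 = (\<Sum>i<n. \<Sum>j<n. c i * c j * f (i + j + 2))"
  proof -
    have "Z 0 = (\<Sum>k\<le>?m. \<Sum>i<n. \<Sum>j<n. if k = i + j + 2 then c i * c j * f (i + j + 2) else 0)"
      unfolding Z_def by (intro sum.cong refl) (auto simp: G1 power_0_left simp del: add_2_eq_Suc')
    also have "\<dots> = (\<Sum>i<n. \<Sum>j<n. \<Sum>k\<le>?m. if k = i + j + 2 then c i * c j * f (i + j + 2) else 0)"
      by (subst sum.swap, rule sum.cong[OF refl], rule sum.swap)
    also have "\<dots> = (\<Sum>i<n. \<Sum>j<n. c i * c j * f (i + j + 2))"
      by (intro sum.cong refl) auto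
    finally show ?thesis .
  qed
  \<comment> \<open>The whole second difference, divided by h to the power 2n.\<close>
  define R where "R h = Z h + ((\<Sum>l<n. E h (d 1 l) / h ^ ?m * wt 1 h l) + (\<Sum>l<n. E h (d (- 1) l) / h ^ ?m * wt (- 1) h l)) / 2
      - (\<Sum>l<n. E h (d 0 l) / h ^ ?m * wt 0 h l)" for h
  have "(R \<longlongrightarrow> Z 0 + ((\<Sum>l<n. 0 * wt 1 0 l) + (\<Sum>l<n. 0 * wt (- 1) 0 l)) / 2 - (\<Sum>l<n. 0 * wt 0 0 l)) (at_right 0)"
    unfolding R_def[abs_def] by (intro tendsto_intros Z_lim rest_lim) auto
  then have R_lim: "(R \<longlongrightarrow> Z 0) (at_right 0)" by simp
  have R_eq: "h ^ ?m * R h = (S 1 h + S (- 1) h) / 2 - S 0 h" if "0 < h" for h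
  proof -
    have "(S 1 h + S (- 1) h) / 2 - S 0 h = (\<Sum>k\<le>?m. f k * h ^ k * ((M 1 h k + M (- 1) h k) / 2 - M 0 h k))
      + ((\<Sum>l<n. E h (d 1 l) * wt 1 h l) + (\<Sum>l<n. E h (d (- 1) l) * wt (- 1) h l)) / 2
      - (\<Sum>l<n. E h (d 0 l) * wt 0 h l)"
      unfolding S_eq by (simp add: sum.distrib sum_subtractf ring_distribs add_divide_distrib sum_divide_distrib)
    also have "\<dots> = h ^ ?m * R h"
      unfolding Z_eq R_def using that
      by (simp add: ring_distribs sum_distrib_left add_divide_distrib sum_divide_distrib)
    finally show ?thesis by simp
  qed
  have "\<forall>\<^sub>F h in at_right 0. x + h * y \<in> I" for y
  proof -
    have "((\<lambda>h. x + h * y) \<longlongrightarrow> x) (at_right 0)" by (auto intro!: tendsto_eq_intros)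
    then show ?thesis using I x by (rule topological_tendstoD)
  qed
  then have "\<forall>\<^sub>F h in at_right 0. \<forall>y\<in>(\<Union>\<sigma>\<in>{1, -1, 0}. d \<sigma> ` {..<n}). x + h * y \<in> I"
    by (intro eventually_ball_finite) auto
  then have "\<forall>\<^sub>F h in at_right 0. 0 \<le> R h"
    using eventually_at_right_less[of 0]
  proof eventually_elim
    case (elim h)
    let ?l = "convexity_functional n (1 / 2) (v h) (u 1) (\<lambda>k. x + h * d 1 k)
        (u (- 1)) (\<lambda>k. x + h * d (- 1) k) (u 0) (\<lambda>k. x + h * d 0 k)"
    let ?T = "\<lambda>\<sigma> i j. complex_of_real h * path_mat \<sigma> i j + (if i = j then complex_of_real x else 0)"
    have "spectral n (\<lambda>i j. complex_of_real (1 / 2) * ?T 1 i j + complex_of_real (1 - 1 / 2) * ?T (- 1) i j)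
        (u 0) (\<lambda>k. x + h * d 0 k)"
      using spectral_affine[OF ud[of 0], of h x]
      by (rule spectral_cong[THEN iffD1, rotated]) (auto simp: path_mat_def field_simps)
    then have "?l \<in> convexity_functionals n"
      by (intro convexity_functionalsI[OF spectral_affine[OF ud] spectral_affine[OF ud]]) simp_all
    moreover have "snd ` set ?l \<subseteq> I"
      unfolding nodes_convexity_functional using elim(1) by auto
    ultimately have "0 \<le> wsum ?l (F 0)" using pos by (auto simp: nonneg_on_def)
    also have "wsum ?l (F 0) = (S 1 h + S (- 1) h) / 2 - S 0 h"
      by (simp add: wsum_convexity_functional S_def wt_def)
    also have "\<dots> = h ^ ?m * R h" using R_eq[OF elim(2)] by simp
    finally have "0 \<le> h ^ ?m * R h" .
    moreover have "0 < h ^ ?m" using elim(2) by simp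
    ultimately show ?case by (simp add: zero_le_mult_iff)
  qed
  then have "0 \<le> Z 0" using R_lim by (intro tendsto_lowerbound) auto
  then show "0 \<le> (\<Sum>i<n. \<Sum>j<n. c i * c j * (F (i + j + 2) x / fact (i + j + 2)))"
    by (simp add: Z0 f_def)
qed

section \<open>Both conditions imply convexity\<close>

text \<open>A divided difference depends on the set of nodes only, which makes it easier to add two nodes.\<close>

definition set_divided_difference :: "real set \<Rightarrow> (real \<Rightarrow> real) \<Rightarrow> real" where
  "set_divided_difference S g = (\<Sum>x\<in>S. g x / (\<Prod>y\<in>S - {x}. x - y))"

lemma divided_difference_eq_set:
  assumes "inj_on x {..m}"
  shows "divided_difference m x g = set_divided_difference (x ` {..m}) g"
proof -
  have "(\<Prod>j\<in>{..m} - {i}. x i - x j) = (\<Prod>y\<in>x ` {..m} - {x i}. x i - y)" if "i \<le> m" for i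
  proof -
    have "x ` {..m} - {x i} = x ` ({..m} - {i})"
      using assms that by (auto simp: inj_on_def)
    moreover have "inj_on x ({..m} - {i})" using assms by (rule inj_on_subset) auto
    ultimately show ?thesis by (simp add: prod.reindex)
  qed
  then show ?thesis
    unfolding divided_difference_def set_divided_difference_def
    by (subst sum.reindex[OF assms]) simp
qed

definition dd_nonneg :: "nat \<Rightarrow> real set \<Rightarrow> (real \<Rightarrow> real) \<Rightarrow> bool" where
  "dd_nonneg n I f \<longleftrightarrow> (\<forall>(q :: real poly) x. degree q < n \<longrightarrow> inj_on x {..2 * n} \<longrightarrow> x ` {..2 * n} \<subseteq> I
     \<longrightarrow> 0 \<le> divided_difference (2 * n) x (\<lambda>t. f t * (poly q t)\<^sup>2))"

lemma dd_nonneg_set: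
  assumes "dd_nonneg n I f" "degree q < n" "finite S" "card S = Suc (2 * n)" "S \<subseteq> I"
  shows "0 \<le> set_divided_difference S (\<lambda>t. f t * (poly q t)\<^sup>2)"
proof -
  obtain x where "bij_betw x {0..<card S} S" using ex_bij_betw_nat_finite[OF assms(3)] by blast
  then have x: "inj_on x {..2 * n}" "x ` {..2 * n} = S"
    by (auto simp: bij_betw_def assms(4) atLeast0LessThan lessThan_Suc_atMost)
  then have "0 \<le> divided_difference (2 * n) x (\<lambda>t. f t * (poly q t)\<^sup>2)"
    using assms(1,2,5) unfolding dd_nonneg_def by blast
  then show ?thesis by (simp add: divided_difference_eq_set[OF x(1)] x(2))
qed

text \<open>Nothing is known about the regularity of \<open>f\<close>, but on an uncountable compact set some bound on \<open>|f|\<close>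
holds at infinitely many points, and these accumulate.\<close>

lemma bounded_values_accumulate:
  fixes f :: "real \<Rightarrow> real"
  assumes "open U" "U \<noteq> {}"
  shows "\<exists>t s N. t \<in> U \<and> s \<longlonglongrightarrow> t \<and> (\<forall>k :: nat. s k \<in> U \<and> s k \<noteq> t \<and> \<bar>f (s k)\<bar> \<le> N)"
proof -
  obtain p e where e: "0 < e" "cball p e \<subseteq> U"
    using assms open_contains_cball by blast
  define A where "A N = {x \<in> cball p e. \<bar>f x\<bar> \<le> real N}" for N
  have "uncountable (cball p e)" by (rule uncountable_cball[OF e(1)])
  moreover have "cball p e = (\<Union>N. A N)"
    unfolding A_def using real_arch_simple by fastforce
  ultimately obtain N where N: "infinite (A N)"
    by (metis countable_UN countable_finite countableI_type)
  obtain t where t: "t \<in> cball p e" "t islimpt A N"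
  proof -
    have "\<exists>t\<in>cball p e. t islimpt A N"
    proof (rule ccontr)
      assume "\<not> ?thesis"
      then have "finite (cball p e \<inter> A N)"
        by (intro finite_not_islimpt_in_compact) auto
      moreover have "cball p e \<inter> A N = A N" by (auto simp: A_def)
      ultimately show False using N by simp
    qed
    then show ?thesis using that by blast
  qed
  then obtain s where s: "\<And>k :: nat. s k \<in> A N - {t}" "s \<longlonglongrightarrow> t"
    unfolding islimpt_sequential by blast
  have "s k \<in> U \<and> s k \<noteq> t \<and> \<bar>f (s k)\<bar> \<le> real N" for k
    using s(1)[of k] e(2) by (auto simp: A_def)
  then show ?thesis using t(1) e(2) s(2) by blast
qed

text \<open>Add a node \<open>t\<close> and a node \<open>s\<^sub>k\<close> close to it, and multiply \<open>q\<close> by \<open>z - t\<close>. The node \<open>t\<close> drops out,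
\<open>s\<^sub>k\<close> contributes a term of the order \<open>f(s\<^sub>k) (s\<^sub>k - t)\<close>, and at the old nodes the new factors cancel in
the limit \<open>s\<^sub>k \<rightarrow> t\<close>. It suffices that \<open>f\<close> is bounded along the sequence \<open>s\<^sub>k\<close>.\<close>

lemma dd_nonneg_Suc:
  assumes I: "open I" "I \<noteq> {}" and D: "dd_nonneg (Suc n) I f"
  shows "dd_nonneg n I f"
  unfolding dd_nonneg_def
proof (intro allI impI)
  fix q :: "real poly" and x :: "nat \<Rightarrow> real"
  assume q: "degree q < n" and inj: "inj_on x {..2 * n}" and x: "x ` {..2 * n} \<subseteq> I"
  define S where "S = x ` {..2 * n}"
  have S: "finite S" "card S = Suc (2 * n)" "S \<subseteq> I"
    using inj x by (auto simp: S_def card_image)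
  have "open (I - S)" using I(1) S(1) by (intro open_Diff finite_imp_closed)
  moreover have "I - S \<noteq> {}"
  proof
    assume "I - S = {}"
    then have "I \<subseteq> S" by blast
    then have "finite I" using S(1) by (rule finite_subset)
    then show False using finite_imp_not_open[of I] I by simp
  qed
  ultimately have "\<exists>t s N. t \<in> I - S \<and> s \<longlonglongrightarrow> t \<and> (\<forall>k :: nat. s k \<in> I - S \<and> s k \<noteq> t \<and> \<bar>f (s k)\<bar> \<le> N)"
    by (rule bounded_values_accumulate)
  then obtain t s N where t: "t \<in> I - S" and lim: "s \<longlonglongrightarrow> t"
    and *: "\<forall>k :: nat. s k \<in> I - S \<and> s k \<noteq> t \<and> \<bar>f (s k)\<bar> \<le> N"
    by blast
  have s: "s k \<in> I - S \<and> s k \<noteq> t \<and> \<bar>f (s k)\<bar> \<le> N" for k using * ..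
  define w where "w y = f y * (poly q y)\<^sup>2 / (\<Prod>z\<in>S - {y}. y - z)" for y
  define R where "R k = f (s k) * (poly q (s k))\<^sup>2 * (s k - t) / (\<Prod>z\<in>S. s k - z)" for k
  let ?q = "[:- t, 1:] * q"
  have dq: "degree ?q < Suc n"
    using degree_mult_le[of "[:- t, 1:]" q] q by simp
  have q_eval: "poly ?q z = (z - t) * poly q z" for z by (simp add: algebra_simps)
  have cancel1: "c * (a * b)\<^sup>2 / (a * p) = c * b\<^sup>2 * a / p" if "a \<noteq> 0" for a b c p :: real
    using that by (simp add: power2_eq_square)
  have cancel2: "c * (a * b)\<^sup>2 / (a * (e * p)) = c * b\<^sup>2 / p * (a / e)" if "a \<noteq> 0" for a b c e p :: real
    using that by (simp add: power2_eq_square mult_ac)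
  have nonneg: "0 \<le> (\<Sum>y\<in>S. w y * ((y - t) / (y - s k))) + R k" for k
  proof -
    let ?S = "insert t (insert (s k) S)"
    have st: "t \<notin> insert (s k) S" "s k \<notin> S" using s[of k] t by auto
    have "0 \<le> set_divided_difference ?S (\<lambda>y. f y * (poly ?q y)\<^sup>2)"
      by (rule dd_nonneg_set[OF D dq]) (use S s[of k] t st in auto)
    also have "\<dots> = f (s k) * (poly ?q (s k))\<^sup>2 / (\<Prod>z\<in>?S - {s k}. s k - z)
        + (\<Sum>y\<in>S. f y * (poly ?q y)\<^sup>2 / (\<Prod>z\<in>?S - {y}. y - z))"
      unfolding set_divided_difference_def using S(1) st by simp
    also have "f (s k) * (poly ?q (s k))\<^sup>2 / (\<Prod>z\<in>?S - {s k}. s k - z) = R k"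
    proof -
      have "?S - {s k} = insert t S" using st by auto
      then have "(\<Prod>z\<in>?S - {s k}. s k - z) = (s k - t) * (\<Prod>z\<in>S. s k - z)"
        using S(1) st by simp
      then show ?thesis using cancel1[of "s k - t" "f (s k)"] s[of k]
        by (simp only: R_def q_eval right_minus_eq not_False_eq_True)
    qed
    also have "(\<Sum>y\<in>S. f y * (poly ?q y)\<^sup>2 / (\<Prod>z\<in>?S - {y}. y - z)) = (\<Sum>y\<in>S. w y * ((y - t) / (y - s k)))"
    proof (rule sum.cong[OF refl])
      fix y assume y: "y \<in> S"
      then have yt: "y - t \<noteq> 0" "y - s k \<noteq> 0" using st by auto
      have "?S - {y} = insert t (insert (s k) (S - {y}))" using st y by auto
      then have "(\<Prod>z\<in>?S - {y}. y - z) = (y - t) * ((y - s k) * (\<Prod>z\<in>S - {y}. y - z))"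
        using S(1) st by simp
      then show "f y * (poly ?q y)\<^sup>2 / (\<Prod>z\<in>?S - {y}. y - z) = w y * ((y - t) / (y - s k))"
        using cancel2[OF yt(1), of "f y"] by (simp only: w_def q_eval)
    qed
    finally show ?thesis by linarith
  qed
  have "(\<lambda>k. \<Sum>y\<in>S. w y * ((y - t) / (y - s k))) \<longlonglongrightarrow> (\<Sum>y\<in>S. w y * ((y - t) / (y - t)))"
    by (intro tendsto_intros lim) (use t in auto)
  moreover have "R \<longlonglongrightarrow> 0"
  proof -
    have "(\<lambda>k. (poly q (s k))\<^sup>2 * (s k - t) / (\<Prod>z\<in>S. s k - z)) \<longlonglongrightarrow> (poly q t)\<^sup>2 * (t - t) / (\<Prod>z\<in>S. t - z)"
      by (intro tendsto_intros lim) (use S(1) t in auto)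
    then have "(\<lambda>k. (poly q (s k))\<^sup>2 * (s k - t) / (\<Prod>z\<in>S. s k - z)) \<longlonglongrightarrow> 0" by simp
    then have "(\<lambda>k. f (s k) * ((poly q (s k))\<^sup>2 * (s k - t) / (\<Prod>z\<in>S. s k - z))) \<longlonglongrightarrow> 0"
    proof (rule lim_null_mult_left_bounded[rotated])
      show "eventually (\<lambda>k. norm (f (s k)) \<le> N) sequentially" using s by simp
    qed
    then show ?thesis by (simp add: R_def[abs_def] mult.assoc)
  qed
  ultimately have "(\<lambda>k. (\<Sum>y\<in>S. w y * ((y - t) / (y - s k))) + R k) \<longlonglongrightarrow> (\<Sum>y\<in>S. w y * ((y - t) / (y - t))) + 0"
    by (rule tendsto_add)
  then have "0 \<le> (\<Sum>y\<in>S. w y * ((y - t) / (y - t))) + 0"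
    by (rule LIMSEQ_le_const) (use nonneg in auto)
  also have "(\<Sum>y\<in>S. w y * ((y - t) / (y - t))) + 0 = (\<Sum>y\<in>S. w y)"
    using t by (auto intro!: sum.cong)
  also have "\<dots> = divided_difference (2 * n) x (\<lambda>t. f t * (poly q t)\<^sup>2)"
    by (simp add: divided_difference_eq_set[OF inj] set_divided_difference_def S_def w_def)
  finally show "0 \<le> divided_difference (2 * n) x (\<lambda>t. f t * (poly q t)\<^sup>2)" .
qed

text \<open>For \<open>n = 1\<close> and \<open>q = 1\<close> the condition is the nonnegativity of the divided differences of second
order, which is convexity.\<close>

lemma convex_on_if_dd_nonneg:
  assumes I: "open I" "convex I" "I \<noteq> {}" and n: "0 < n" and D: "dd_nonneg n I f"
  shows "convex_on I f"
proof -
  have "dd_nonneg m I f" if "1 \<le> m" "m \<le> n" for m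
    using that(2,1)
  proof (induction m rule: inc_induct)
    case base
    then show ?case using D by simp
  next
    case (step m)
    then have "dd_nonneg (Suc m) I f" by simp
    then show ?case by (rule dd_nonneg_Suc[OF I(1,3)])
  qed
  then have D1: "dd_nonneg 1 I f" using n by simp
  show ?thesis
  proof (rule convex_on_linorderI[OF _ I(2)])
    fix t x y :: real assume t: "0 < t" "t < 1" and xy: "x \<in> I" "y \<in> I" "x < y"
    define z where "z = (1 - t) * x + t * y"
    have zx: "z - x = t * (y - x)" and yz: "y - z = (1 - t) * (y - x)"
      by (simp_all add: z_def algebra_simps)
    have "0 < z - x" "0 < y - z" unfolding zx yz using t xy(3) by (auto intro!: mult_pos_pos)
    then have ord: "x < z" "z < y" by auto
    have "closed_segment x y \<subseteq> I" by (rule closed_segment_subset[OF xy(1,2) I(2)])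
    then have zI: "z \<in> I" using ord by (auto simp: closed_segment_eq_real_ivl)
    have "0 \<le> set_divided_difference {x, z, y} (\<lambda>s. f s * (poly 1 s)\<^sup>2)"
      by (rule dd_nonneg_set[OF D1]) (use xy zI ord in auto)
    also have "\<dots> = f x / ((x - z) * (x - y)) + f z / ((z - x) * (z - y)) + f y / ((y - x) * (y - z))"
    proof -
      have "{x, z, y} - {x} = {z, y}" "{x, z, y} - {z} = {x, y}" "{x, z, y} - {y} = {x, z}"
        using ord by auto
      then show ?thesis using ord by (simp add: set_divided_difference_def)
    qed
    finally have "0 \<le> ((z - x) * (y - z) * (y - x)) *
        (f x / ((x - z) * (x - y)) + f z / ((z - x) * (z - y)) + f y / ((y - x) * (y - z)))"
      using ord by (intro mult_nonneg_nonneg) auto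
    also have "\<dots> = f x * (y - z) - f z * (y - x) + f y * (z - x)"
    proof -
      have cancel: "(p * q * r) * (A / ((- p) * (- r)) + B / (p * (- q)) + C / (r * q)) = A * q - B * r + C * p"
        if "p \<noteq> 0" "q \<noteq> 0" "r \<noteq> 0" for p q r A B C :: real
        using that by (simp add: ring_distribs)
      have signs: "x - z = - (z - x)" "x - y = - (y - x)" "z - y = - (y - z)" by simp_all
      show ?thesis unfolding signs by (rule cancel) (use ord in auto)
    qed
    also have "\<dots> = (y - x) * ((1 - t) * f x + t * f y - f z)"
      unfolding zx yz by (simp add: algebra_simps)
    finally have "0 \<le> (1 - t) * f x + t * f y - f z"
      using xy(3) by (simp add: zero_le_mult_iff)
    then show "f ((1 - t) *\<^sub>R x + t *\<^sub>R y) \<le> (1 - t) * f x + t * f y" by (simp add: z_def)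
  qed
qed

lemma spectral_scalar:
  "spectral n (\<lambda>i j. if i = j then complex_of_real x else 0) (\<lambda>k i. if i = k then 1 else 0) (\<lambda>_. x)"
proof (rule spectralI)
  show "orthonormal n (\<lambda>k i. if i = k then 1 else 0)"
    unfolding orthonormal_def
  proof (intro allI impI)
    fix k l assume kl: "k < n" "l < n"
    have "cip n (\<lambda>i. if i = k then 1 else 0) (\<lambda>i. if i = l then 1 else 0)
        = (\<Sum>i<n. if i = k then (if k = l then 1 else 0) else 0)"
      unfolding cip_def by (intro sum.cong refl) auto
    then show "cip n (\<lambda>i. if i = k then 1 else 0) (\<lambda>i. if i = l then 1 else 0) = (if k = l then 1 else 0)"
      using kl by simp
  qed
  fix k i assume "k < n" "i < n"
  have "(\<Sum>j<n. (if i = j then complex_of_real x else 0) * (if j = k then 1 else 0))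
      = (\<Sum>j<n. if j = k then (if i = k then complex_of_real x else 0) else 0)"
    by (intro sum.cong refl) auto
  then show "(\<Sum>j<n. (if i = j then complex_of_real x else 0) * (if j = k then 1 else 0))
      = complex_of_real x * (if i = k then 1 else 0)"
    using \<open>k < n\<close> by simp
qed

lemma convex_on_if_convexity_functionals_nonneg:
  assumes I: "convex I" and n: "0 < n" and pos: "nonneg_on (convexity_functionals n) I f"
  shows "convex_on I f"
proof (rule convex_on_linorderI[OF _ I])
  fix t x y :: real assume t: "0 < t" "t < 1" and xy: "x \<in> I" "y \<in> I" "x < y"
  define z where "z = (1 - t) * x + t * y"
  let ?e = "\<lambda>k i :: nat. if i = k then 1 else (0 :: complex)"
  let ?l = "convexity_functional n t (?e 0) ?e (\<lambda>_. y) ?e (\<lambda>_. x) ?e (\<lambda>_. z)"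
  have zI: "z \<in> I" using I xy(1,2) t by (auto simp: z_def convex_alt)
  have "spectral n (\<lambda>i j. complex_of_real t * (if i = j then complex_of_real y else 0)
      + complex_of_real (1 - t) * (if i = j then complex_of_real x else 0)) ?e (\<lambda>_. z)"
    using spectral_scalar[of n z]
    by (rule spectral_cong[THEN iffD1, rotated]) (auto simp: z_def)
  then have "?l \<in> convexity_functionals n"
    by (intro convexity_functionalsI[OF spectral_scalar spectral_scalar]) (use t in auto)
  moreover have "snd ` set ?l \<subseteq> I"
    unfolding nodes_convexity_functional using xy zI by auto
  ultimately have "0 \<le> wsum ?l f" using pos by (auto simp: nonneg_on_def)
  moreover have "(\<Sum>k<n. g * spectral_weight n (?e 0) (?e k)) = g" for g
  proof -
    have "orthonormal n ?e" using spectral_scalar[of n 0] by (simp add: spectral_def)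
    then have "(\<Sum>k<n. g * spectral_weight n (?e 0) (?e k)) = (\<Sum>k<n. if k = 0 then g else 0)"
      using n by (intro sum.cong refl) (auto simp: spectral_weight_def orthonormal_def)
    then show ?thesis using n by simp
  qed
  ultimately have "0 \<le> t * f y + (1 - t) * f x - f z"
    by (simp add: wsum_convexity_functional)
  then show "f ((1 - t) *\<^sub>R x + t *\<^sub>R y) \<le> (1 - t) * f x + t * f y" by (simp add: z_def)
qed

section \<open>Divided differences as finite functionals\<close>

definition divided_difference_functional :: "nat \<Rightarrow> real poly \<Rightarrow> (nat \<Rightarrow> real) \<Rightarrow> (real \<times> real) list" where
  "divided_difference_functional n q x =
     map (\<lambda>i. ((poly q (x i))\<^sup>2 / (\<Prod>j\<in>{..2 * n} - {i}. x i - x j), x i)) [0..<Suc (2 * n)]"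

definition divided_difference_functionals :: "nat \<Rightarrow> (real \<times> real) list set" where
  "divided_difference_functionals n =
     {divided_difference_functional n q x | q x. degree q < n \<and> inj_on x {..2 * n}}"

lemma wsum_divided_difference_functional:
  "wsum (divided_difference_functional n q x) f = divided_difference (2 * n) x (\<lambda>t. f t * (poly q t)\<^sup>2)"
  unfolding divided_difference_functional_def wsum_upt divided_difference_def lessThan_Suc_atMost
  by (intro sum.cong refl) simp

lemma nodes_divided_difference_functional:
  "snd ` set (divided_difference_functional n q x) = x ` {..2 * n}"
  unfolding divided_difference_functional_def set_map set_upt image_image snd_conv
    atLeast0LessThan lessThan_Suc_atMost ..

lemma nonneg_on_divided_difference_functionals:
  "nonneg_on (divided_difference_functionals n) I f \<longleftrightarrow> dd_nonneg n I f"
proof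
  assume pos: "nonneg_on (divided_difference_functionals n) I f"
  show "dd_nonneg n I f"
    unfolding dd_nonneg_def
  proof (intro allI impI)
    fix q :: "real poly" and x assume "degree q < n" "inj_on x {..2 * n}" "x ` {..2 * n} \<subseteq> I"
    then have "divided_difference_functional n q x \<in> divided_difference_functionals n"
      "snd ` set (divided_difference_functional n q x) \<subseteq> I"
      by (auto simp only: divided_difference_functionals_def nodes_divided_difference_functional)
    then have "0 \<le> wsum (divided_difference_functional n q x) f"
      using pos unfolding nonneg_on_def by blast
    then show "0 \<le> divided_difference (2 * n) x (\<lambda>t. f t * (poly q t)\<^sup>2)"
      unfolding wsum_divided_difference_functional .
  qed
next
  assume D: "dd_nonneg n I f"
  show "nonneg_on (divided_difference_functionals n) I f"
    unfolding nonneg_on_def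
  proof (intro ballI impI)
    fix l assume "l \<in> divided_difference_functionals n" and nodes: "snd ` set l \<subseteq> I"
    then obtain q x where l: "l = divided_difference_functional n q x"
      and q: "degree q < n" "inj_on x {..2 * n}"
      unfolding divided_difference_functionals_def by blast
    have "x ` {..2 * n} \<subseteq> I" using nodes unfolding l nodes_divided_difference_functional .
    then show "0 \<le> wsum l f"
      using D q unfolding l wsum_divided_difference_functional dd_nonneg_def by blast
  qed
qed

text \<open>A translation of the nodes is compensated by a translation of \<open>q\<close>.\<close>

lemma translation_invariant_divided_difference_functionals:
  "translation_invariant (divided_difference_functionals n)"
  unfolding translation_invariant_def
proof (intro ballI allI)
  fix l and s :: real assume "l \<in> divided_difference_functionals n"
  then obtain q x where l: "l = divided_difference_functional n q x"
    and q: "degree q < n" and x: "inj_on x {..2 * n}"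
    unfolding divided_difference_functionals_def by blast
  have "map (\<lambda>(w, x). (w, x + s)) l
      = divided_difference_functional n (pcompose q [:- s, 1:]) (\<lambda>i. x i + s)"
    by (simp add: l divided_difference_functional_def comp_def poly_pcompose del: upt_Suc)
  moreover have "degree (pcompose q [:- s, 1:]) < n" using q by simp
  moreover have "inj_on (\<lambda>i. x i + s) {..2 * n}" using x by (simp add: inj_on_def)
  ultimately show "map (\<lambda>(w, x). (w, x + s)) l \<in> divided_difference_functionals n"
    unfolding divided_difference_functionals_def by blast
qed

section \<open>The characterization of matrix convexity\<close>

lemma convex_einterval: "convex (einterval a b)"
proof -
  have "is_interval (einterval a b)"
    unfolding is_interval_1
  proof (intro ballI allI impI)
    fix x y z assume "x \<in> einterval a b" "y \<in> einterval a b" "x \<le> z \<and> z \<le> y"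
    then have "a < ereal x" "ereal x \<le> ereal z" "ereal z \<le> ereal y" "ereal y < b"
      by (auto simp: einterval_def)
    then have "a < ereal z" "ereal z < b" by (blast intro: less_le_trans, blast intro: le_less_trans)
    then show "z \<in> einterval a b" by (simp add: einterval_def)
  qed
  then show ?thesis by (rule is_interval_convex)
qed

theorem theorem1p4:
  fixes n :: nat and a b :: ereal and f :: "real \<Rightarrow> real"
  assumes "n \<ge> 1" and "a < b"
  shows "n_convex n (einterval a b) f \<longleftrightarrow>
    (\<forall>(q :: real poly) (x :: nat \<Rightarrow> real).
       degree q \<le> n - 1 \<longrightarrow>
       inj_on x {..2 * n} \<longrightarrow>
       x ` {..2 * n} \<subseteq> einterval a b \<longrightarrow>
       divided_difference (2 * n) x (\<lambda>t. f t * (poly q t)\<^sup>2) \<ge> 0)"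
proof -
  let ?I = "einterval a b"
  have n: "0 < n" using assms(1) by simp
  have I: "open ?I" "convex ?I" by (simp_all add: convex_einterval)
  have ne: "?I \<noteq> {}" using einterval_nonempty[OF assms(2)] by blast
  let ?\<Phi> = "convexity_functionals n" and ?\<Psi> = "divided_difference_functionals n"
  have "nonneg_on ?\<Phi> ?I f \<longleftrightarrow> nonneg_on ?\<Psi> ?I f"
  proof
    assume pos: "nonneg_on ?\<Phi> ?I f"
    show "nonneg_on ?\<Psi> ?I f"
    proof (rule nonneg_on_smoothing[OF translation_invariant_convexity_functionals _ I _ pos])
      show "continuous_on ?I f"
        by (rule convex_on_continuous[OF I(1) convex_on_if_convexity_functionals_nonneg[OF I(2) n pos]])
      fix J F
      assume J: "open J" "convex J" and F: "smooth_seq (2 * n) J F" and pos': "nonneg_on ?\<Phi> J (F 0)"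
      have H: "hankel_nonneg n (\<lambda>k. F k x / fact k)" if "x \<in> J" for x
        by (rule hankel_if_convexity_functionals_nonneg[OF n J(1) F that pos'])
      show "nonneg_on ?\<Psi> J (F 0)"
        unfolding nonneg_on_divided_difference_functionals dd_nonneg_def
        by (intro allI impI divided_difference_nonneg_if_hankel[OF F J(2) H])
    qed
  next
    assume pos: "nonneg_on ?\<Psi> ?I f"
    show "nonneg_on ?\<Phi> ?I f"
    proof (rule nonneg_on_smoothing[OF translation_invariant_divided_difference_functionals _ I _ pos])
      show "continuous_on ?I f"
        using convex_on_if_dd_nonneg[OF I ne n] pos
        by (intro convex_on_continuous[OF I(1)]) (simp add: nonneg_on_divided_difference_functionals)
      fix J F
      assume J: "open J" "convex J" and F: "smooth_seq (2 * n) J F" and "nonneg_on ?\<Psi> J (F 0)"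
      then have "dd_nonneg n J (F 0)" by (simp add: nonneg_on_divided_difference_functionals)
      then have "hankel_nonneg n (\<lambda>k. F k x / fact k)" if "x \<in> J" for x
        by (intro hankel_if_divided_difference_nonneg[OF F J(1) that n]) (auto simp: dd_nonneg_def)
      then show "nonneg_on ?\<Phi> J (F 0)"
        by (rule convexity_functionals_nonneg_if_hankel[OF n J(2) F])
    qed
  qed
  moreover have "degree q \<le> n - 1 \<longleftrightarrow> degree q < n" for q :: "real poly" using n by linarith
  ultimately show ?thesis
    by (simp add: n_convex_iff[OF I(2)] nonneg_on_divided_difference_functionals dd_nonneg_def)
qed

end
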